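(* Let $G$ be a Métivier group with structure matrices $U^{(1)},\dots,U^{(m)}$, let $\lambda\in\mathbb R^m\setminus\{0\}$, $0\le r<R\le\infty$ and $p,q\in\mathbb Z_+$. Let $f(z)=\tilde a(\rho)P_{p,q}(z)$ on $B_{r,R}$, where $\rho=|z|$ and $P_{p,q}\in H_{p,q}$. If $f\in Z^\ast_{r,R}$, then $\tilde a$ satisfies on $r<\rho<R$ the ODE $$\left(\sum_{|\beta|+k=q}d_{\beta,k}\,\rho^{2k}\bar D^\beta\right)\left(\sum_{|\alpha|+l=p}c_{\alpha,l}\,\rho^{2l}D^\alpha\right)\tilde a=0$$ for some scalars $c_{\alpha,l},d_{\beta,k}\in\mathbb C$ (the sums run over multi-indices $\alpha,\beta\in\mathbb Z_+^n$ and $l,k\in\mathbb Z_+$). In particular, if $P_{p,q}(z)=z_{l_1}^p\bar z_{l_2}^q$ for some $1\le l_1,l_2\le n$, then there exist $A_i,B_k\in\mathbb C$ such that $$\tilde a(\rho)=\sum_{i=0}^pA_i\,e^{-\frac{\nu_{l_1}}{4}\rho^2}\rho^{-2(p+q+n-i)}+\sum_{k=0}^qB_k\,e^{\frac{\nu_{l_2}}{4}\rho^2}\rho^{-2(p+q+n-k)}$$ for $r<\rho<R$, where $A_0=B_0=0$.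
   Context: **Métivier group and twisted spherical mean.** $U^{(1)},\dots,U^{(m)}$ are real skew-symmetric $2n\times2n$ matrices such that $\sum_{j}\lambda_jU^{(j)}$ is non-singular for every $\lambda\in\mathbb R^m\setminus\{0\}$; the Métivier group is $G=\mathbb R^{2n}\times\mathbb R^m$ with law $(x,t)(\xi,\tau)=(x+\xi,\ (t_j+\tau_j+\tfrac12\langle x,U^{(j)}\xi\rangle)_{j})$. Identify $x=(x_1,\dots,x_n,y_1,\dots,y_n)\in\mathbb R^{2n}$ with its complexification $z=(x_1+iy_1,\dots,x_n+iy_n)\in\mathbb C^n$; $U^{(j)}w$ denotes the complexification of $U^{(j)}\xi$ if $w$ is that of $\xi$, and $z\cdot w=\sum_jz_jw_j$. With $\mu_s$ the normalized surface measure on $\{|w|=s\}\subset\mathbb C^n$, the $\lambda$-twisted spherical mean is $$f\times_\lambda\mu_s(z)=\int_{|w|=s}f(z-w)\,e^{\frac i2\sum_{j=1}^m\lambda_j\mathrm{Re}(z\cdot\overline{U^{(j)}w})}\,d\mu_s(w).$$ $B_{r,R}=\{z\in\mathbb C^n:r<|z|<R\}$. $Z_{r,R}$ is the space of continuous functions $f$ on $B_{r,R}$ with $f\times_\lambda\mu_s(z)=0$ for all $z\in\mathbb C^n$, $s>0$ such that the sphere $S_s(z)\subset B_{r,R}$ and the ball $B_r(0)\subseteq B_s(z)$. **Bi-graded harmonics.** $P_{p,q}$ (the space) consists of polynomials $\sum_{|\alpha|=p,|\beta|=q}c_{\alpha\beta}z^\alpha\bar z^\beta$; $H_{p,q}$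 is its subspace of harmonic polynomials, identified with their restrictions to $S^{2n-1}$. $\{Y_j^{p,q}\}_{1\le j\le d_{p,q}}$ is an orthonormal basis of $H_{p,q}$ in $L^2(S^{2n-1})$. A function expands as $f(\rho\omega)=\sum_{p,q}\sum_ja_j^{p,q}(\rho)Y_j^{p,q}(\omega)$, and $\Pi_{p,q}f(\rho\omega)=\sum_ja_j^{p,q}(\rho)Y_j^{p,q}(\omega)$. Put $\tilde a_j^{p,q}(\rho)=\rho^{-(p+q)}a_j^{p,q}(\rho)$ and $P_j^{p,q}(z)=|z|^{p+q}Y_j^{p,q}(z/|z|)$. **Vector fields.** For fixed $j\in\{1,\dots,n\}$ and $1\le l\le n$ put $\alpha_l^\lambda=\frac12\sum_k\lambda_k(U^{(k)}_{l,j}-iU^{(k)}_{l,n+j})$, $\beta_l^\lambda=\frac12\sum_k\lambda_k(U^{(k)}_{n+l,j}-iU^{(k)}_{n+l,n+j})$, $\eta_l=\beta_l^\lambda+i\alpha_l^\lambda$, $\nu_l=-\beta_l^\lambda+i\alpha_l^\lambda$ (these depend on $j$; $\eta_j=0$). Define $$Z_j^\lambda=\partial_{z_j}+\tfrac14\sum_{l=1}^n(\eta_lz_l+\nu_l\bar z_l),\qquad \bar Z_j^\lambda=\partial_{\bar z_j}-\tfrac14\sum_{l=1}^n(\bar\nu_lz_l+\bar\eta_l\bar z_l).$$ When $\nu_j$ appears by itself (in $D_j$, $\bar D_j$ and in the claim), it is the quantity $\nu_l$ with $l=j$ for the operator of index $j$, i.e. $\nu_j=\sum_k\lambda_kU^{(k)}_{j,n+j}$.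 **The space $Z^\ast_{r,R}$.** For each $P_j^{p,q}$ fix a monomial $z^\alpha\bar z^\beta$ ($|\alpha|=p,|\beta|=q$) occurring in $P_j^{p,q}$ with non-zero coefficient, and put $P_j^{p,0}(Z)=Z^\alpha=(Z_1^\lambda)^{\alpha_1}\cdots(Z_n^\lambda)^{\alpha_n}$ and $P_j^{0,q}(Z)=\bar Z^\beta=(\bar Z_1^\lambda)^{\beta_1}\cdots(\bar Z_n^\lambda)^{\beta_n}$. $Z^\ast_{r,R}$ is the space of smooth functions $f$ on $B_{r,R}$ such that, for all $p,q\in\mathbb Z_+$ and $1\le j\le d_{p,q}$, $$\Pi_{0,0}\Big(P_j^{0,q}(Z)\Big(\Pi_{0,q}\big(P_j^{p,0}(Z)(\tilde a_j^{p,q}P_j^{p,q})\big)\Big)\Big)\in Z_{r,R}.$$ For $f=\tilde aP_{p,q}$ with a single $P_{p,q}\in H_{p,q}$, $P_{p,q}$ is regarded (up to a scalar) as a basis element, so that the condition reads $\Pi_{0,0}(\bar Z^\beta\,\Pi_{0,q}(Z^\alpha(\tilde aP_{p,q})))\in Z_{r,R}$ with $z^\alpha\bar z^\beta$ a monomial of $P_{p,q}$. **Operators in $\rho$.** $D_j=\rho\frac{\partial}{\partial\rho}+\frac{\nu_j}{2}\rho^2$, $\bar D_j=\rho\frac{\partial}{\partial\rho}-\frac{\bar\nu_j}{2}\rho^2$, and for multi-indices $\alpha,\beta$ $$D^\alpha=\prod_{i_1=1}^{\alpha_1}(\kappa_{1,i_1}D_1+2)\cdots\prod_{i_n=1}^{\alpha_n}(\kappa_{n,i_n}D_n+2),\qquad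 \bar D^\beta=\prod_{j_1=1}^{\beta_1}(\tilde\kappa_{1,j_1}\bar D_1+2)\cdots\prod_{j_n=1}^{\beta_n}(\tilde\kappa_{n,j_n}\bar D_n+2),$$ where the $\kappa_{l,i_l},\tilde\kappa_{k,j_k}$ are suitable elements of $\{\gamma_{p',q'}=\frac1{n+p'+q'-1}:0\le p'\le p,\ 0\le q'\le q\}$.
   Formalization: The closed formula for P = z_{l1}^p \bar z_{l2}^q is stated only when p = 0, q = 0, or ν_{l1}+ν_{l2} ≠ 0; otherwise it is false (n = 2, p = q = 1, ν_1 = ν_2 = 0: ã = ρ^{-4} gives f in Z*, but only multiples of ρ^{-6} are offered). *)

theory Defs
  imports "HOL-Analysis.Analysis"
begin

text \<open>
  \<open>\<real>\<^sup>2\<^sup>n\<close> is \<open>real ^ ('n + 'n)\<close>, where \<open>Inl l\<close> is the index \<open>l\<close> (the coordinate \<open>x\<^sub>l\<close>)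
  and \<open>Inr l\<close> is the index \<open>n + l\<close> (the coordinate \<open>y\<^sub>l\<close>); \<open>\<complex>\<^sup>n\<close> is \<open>complex ^ 'n\<close>.
  The type \<open>'n\<close> plays the role of \<open>{1..n}\<close>; it is linearly ordered because the products
  \<open>Z\<^sup>\<alpha>\<close> and \<open>D\<^sup>\<alpha>\<close> below are products of non-commuting operators.
\<close>

section \<open>Structure matrices and the twisted spherical mean\<close>

definition metivier_matrices :: "('m::finite \<Rightarrow> real ^ ('n::finite + 'n) ^ ('n + 'n)) \<Rightarrow> bool" where
  "metivier_matrices U \<longleftrightarrow>
     (\<forall>k. transpose (U k) = - U k) \<and>
     (\<forall>lam :: real ^ 'm. lam \<noteq> 0 \<longrightarrow> invertible (\<Sum>k\<in>UNIV. (lam $ k) *\<^sub>R U k))"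

definition complexify :: "real ^ ('n::finite + 'n) \<Rightarrow> complex ^ 'n" where
  "complexify x = (\<chi> l. Complex (x $ Inl l) (x $ Inr l))"

definition realify :: "complex ^ 'n::finite \<Rightarrow> real ^ ('n + 'n)" where
  "realify z = (\<chi> s. case s of Inl l \<Rightarrow> Re (z $ l) | Inr l \<Rightarrow> Im (z $ l))"

text \<open>
  The normalized surface measure on \<open>{w. norm w = s}\<close> (for \<open>s > 0\<close>), as the image of the uniform
  distribution on the unit ball under radial projection.
\<close>

definition sphere_measure :: "real \<Rightarrow> 'a::euclidean_space measure" where
  "sphere_measure s =
     distr (uniform_measure lborel (ball 0 1)) borel (\<lambda>x. (s / norm x) *\<^sub>R x)"

text \<open>
  The integral is restricted to the sphere explicitly, so that the arbitrary values of \<open>f\<close>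
  away from the sphere cannot affect integrability.
\<close>

definition twisted_mean ::
  "('m::finite \<Rightarrow> real ^ ('n::finite + 'n) ^ ('n + 'n)) \<Rightarrow> real ^ 'm \<Rightarrow>
   (complex ^ 'n \<Rightarrow> complex) \<Rightarrow> real \<Rightarrow> complex ^ 'n \<Rightarrow> complex" where
  "twisted_mean U lam f s z =
     (LINT w : sphere 0 s | sphere_measure s.
        f (z - w) *
        exp (\<i> / 2 * complex_of_real (\<Sum>k\<in>UNIV. lam $ k *
               Re (\<Sum>l\<in>UNIV. z $ l * cnj (complexify (U k *v realify w) $ l)))))"

definition shell :: "real \<Rightarrow> ereal \<Rightarrow> (complex ^ 'n::finite) set" where
  "shell r R = {z. r < norm z \<and> ereal (norm z) < R}"

text \<open>
  The spheres considered are those in the shell that surround the hole \<open>{z. norm z \<le> r}\<close>. With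
  closed balls this also says, for \<open>r = 0\<close>, that the sphere surrounds the origin; for
  \<open>r > 0\<close> open and closed balls give the same condition.
\<close>

definition Z_space ::
  "('m::finite \<Rightarrow> real ^ ('n::finite + 'n) ^ ('n + 'n)) \<Rightarrow> real ^ 'm \<Rightarrow> real \<Rightarrow> ereal \<Rightarrow>
   (complex ^ 'n \<Rightarrow> complex) set" where
  "Z_space U lam r R =
     {f. continuous_on (shell r R) f \<and>
         (\<forall>z s. s > 0 \<and> sphere z s \<subseteq> shell r R \<and> cball 0 r \<subseteq> cball z s
            \<longrightarrow> twisted_mean U lam f s z = 0)}"

section \<open>Smooth functions and complex partial derivatives\<close>

text \<open>\<open>C\<^sup>k\<close> functions, in the real sense; only used for open \<open>S\<close>.\<close>

fun Ck_on :: "nat \<Rightarrow> 'a::euclidean_space set \<Rightarrow> ('a \<Rightarrow> 'b::real_normed_vector) \<Rightarrow> bool" where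
  "Ck_on 0 S f = continuous_on S f"
| "Ck_on (Suc k) S f =
     ((\<forall>x\<in>S. f differentiable (at x)) \<and>
      (\<forall>v. Ck_on k S (\<lambda>x. frechet_derivative f (at x) v)))"

definition smooth_fun_on :: "'a::euclidean_space set \<Rightarrow> ('a \<Rightarrow> 'b::real_normed_vector) \<Rightarrow> bool" where
  "smooth_fun_on S f \<longleftrightarrow> (\<forall>k. Ck_on k S f)"

definition d_z :: "'n::finite \<Rightarrow> (complex ^ 'n \<Rightarrow> complex) \<Rightarrow> complex ^ 'n \<Rightarrow> complex" where
  "d_z j f z = (frechet_derivative f (at z) (axis j 1)
                - \<i> * frechet_derivative f (at z) (axis j \<i>)) / 2"

definition d_zbar :: "'n::finite \<Rightarrow> (complex ^ 'n \<Rightarrow> complex) \<Rightarrow> complex ^ 'n \<Rightarrow> complex" where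
  "d_zbar j f z = (frechet_derivative f (at z) (axis j 1)
                   + \<i> * frechet_derivative f (at z) (axis j \<i>)) / 2"

definition laplacian :: "('a::euclidean_space \<Rightarrow> complex) \<Rightarrow> 'a \<Rightarrow> complex" where
  "laplacian f x =
     (\<Sum>b\<in>Basis. frechet_derivative (\<lambda>y. frechet_derivative f (at y) b) (at x) b)"

section \<open>Bigraded harmonics\<close>

definition midx :: "nat \<Rightarrow> ('n::finite \<Rightarrow> nat) set" where
  "midx p = {\<alpha>. (\<Sum>l\<in>UNIV. \<alpha> l) = p}"

definition bimonom :: "('n::finite \<Rightarrow> nat) \<Rightarrow> ('n \<Rightarrow> nat) \<Rightarrow> complex ^ 'n \<Rightarrow> complex" where
  "bimonom \<alpha> \<beta> z = (\<Prod>l\<in>UNIV. (z $ l) ^ \<alpha> l) * (\<Prod>l\<in>UNIV. cnj (z $ l) ^ \<beta> l)"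

definition bipoly ::
  "nat \<Rightarrow> nat \<Rightarrow> (('n::finite \<Rightarrow> nat) \<Rightarrow> ('n \<Rightarrow> nat) \<Rightarrow> complex) \<Rightarrow> complex ^ 'n \<Rightarrow> complex" where
  "bipoly p q c z = (\<Sum>\<alpha>\<in>midx p. \<Sum>\<beta>\<in>midx q. c \<alpha> \<beta> * bimonom \<alpha> \<beta> z)"

definition P_space :: "nat \<Rightarrow> nat \<Rightarrow> (complex ^ 'n::finite \<Rightarrow> complex) set" where
  "P_space p q = range (bipoly p q)"

definition H_space :: "nat \<Rightarrow> nat \<Rightarrow> (complex ^ 'n::finite \<Rightarrow> complex) set" where
  "H_space p q = {P \<in> P_space p q. \<forall>z. laplacian P z = 0}"

text \<open>
  The monomial \<open>z\<^sup>\<alpha> \<bar>z\<^sup>\<beta>\<close> occurs in \<open>P\<close> with non-zero coefficient. (The coefficients of a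
  polynomial in \<open>z, \<bar>z\<close> are determined by the function.)
\<close>

definition monom_occurs ::
  "nat \<Rightarrow> nat \<Rightarrow> (complex ^ 'n::finite \<Rightarrow> complex) \<Rightarrow> ('n \<Rightarrow> nat) \<times> ('n \<Rightarrow> nat) \<Rightarrow> bool" where
  "monom_occurs p q P = (\<lambda>(\<alpha>, \<beta>). \<alpha> \<in> midx p \<and> \<beta> \<in> midx q \<and>
     (\<exists>c. P = bipoly p q c \<and> c \<alpha> \<beta> \<noteq> 0))"

text \<open>
  \<open>Y p q j\<close> with \<open>j \<in> {1..d p q}\<close> is an orthonormal basis of \<open>H\<^sub>p\<^sub>,\<^sub>q\<close> in \<open>L\<^sup>2\<close> of the unit sphere.
  Elements of \<open>H\<^sub>p\<^sub>,\<^sub>q\<close> are identified with their restrictions to the sphere; as \<open>Y p q j\<close> is the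
  homogeneous polynomial itself, it is also the function
  \<open>P\<^sub>j(z) = |z|\<^sup>p\<^sup>+\<^sup>q Y\<^sub>j(z/|z|)\<close>.
\<close>

definition harmonic_basis ::
  "(nat \<Rightarrow> nat \<Rightarrow> nat) \<Rightarrow> (nat \<Rightarrow> nat \<Rightarrow> nat \<Rightarrow> complex ^ 'n::finite \<Rightarrow> complex) \<Rightarrow> bool" where
  "harmonic_basis d Y \<longleftrightarrow> (\<forall>p q.
     (\<forall>j\<in>{1..d p q}. Y p q j \<in> H_space p q) \<and>
     (\<forall>i\<in>{1..d p q}. \<forall>j\<in>{1..d p q}.
        (LINT w : sphere 0 1 | sphere_measure 1. Y p q i w * cnj (Y p q j w))
          = (if i = j then 1 else 0)) \<and>
     (\<forall>P\<in>H_space p q. \<exists>c. P = (\<lambda>z. \<Sum>j=1..d p q. c j * Y p q j z)))"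

text \<open>\<open>a\<^sub>j\<^sup>p\<^sup>,\<^sup>q(\<rho>)\<close>, \<open>\<Pi>\<^sub>p\<^sub>,\<^sub>q\<close> and \<open>\<tilde>a\<^sub>j\<^sup>p\<^sup>,\<^sup>q(\<rho>)\<close>\<close>

definition harm_coeff ::
  "(nat \<Rightarrow> nat \<Rightarrow> nat \<Rightarrow> complex ^ 'n::finite \<Rightarrow> complex) \<Rightarrow> nat \<Rightarrow> nat \<Rightarrow> nat \<Rightarrow>
   (complex ^ 'n \<Rightarrow> complex) \<Rightarrow> real \<Rightarrow> complex" where
  "harm_coeff Y p q j f \<rho> =
     (LINT w : sphere 0 1 | sphere_measure 1. f (\<rho> *\<^sub>R w) * cnj (Y p q j w))"

definition harm_proj ::
  "(nat \<Rightarrow> nat \<Rightarrow> nat) \<Rightarrow> (nat \<Rightarrow> nat \<Rightarrow> nat \<Rightarrow> complex ^ 'n::finite \<Rightarrow> complex) \<Rightarrow> nat \<Rightarrow> nat \<Rightarrow>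
   (complex ^ 'n \<Rightarrow> complex) \<Rightarrow> complex ^ 'n \<Rightarrow> complex" where
  "harm_proj d Y p q f z =
     (\<Sum>j=1..d p q. harm_coeff Y p q j f (norm z) * Y p q j (z /\<^sub>R norm z))"

definition harm_coeff_tilde ::
  "(nat \<Rightarrow> nat \<Rightarrow> nat \<Rightarrow> complex ^ 'n::finite \<Rightarrow> complex) \<Rightarrow> nat \<Rightarrow> nat \<Rightarrow> nat \<Rightarrow>
   (complex ^ 'n \<Rightarrow> complex) \<Rightarrow> real \<Rightarrow> complex" where
  "harm_coeff_tilde Y p q j f \<rho> = harm_coeff Y p q j f \<rho> / complex_of_real (\<rho> ^ (p + q))"

section \<open>The vector fields and the space \<open>Z\<^sup>*\<close>\<close>

definition alpha_c ::
  "('m::finite \<Rightarrow> real ^ ('n::finite + 'n) ^ ('n + 'n)) \<Rightarrow> real ^ 'm \<Rightarrow> 'n \<Rightarrow> 'n \<Rightarrow> complex" where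
  "alpha_c U lam j l =
     (1/2) * (\<Sum>k\<in>UNIV. complex_of_real (lam $ k) *
       (complex_of_real (U k $ Inl l $ Inl j) - \<i> * complex_of_real (U k $ Inl l $ Inr j)))"

definition beta_c ::
  "('m::finite \<Rightarrow> real ^ ('n::finite + 'n) ^ ('n + 'n)) \<Rightarrow> real ^ 'm \<Rightarrow> 'n \<Rightarrow> 'n \<Rightarrow> complex" where
  "beta_c U lam j l =
     (1/2) * (\<Sum>k\<in>UNIV. complex_of_real (lam $ k) *
       (complex_of_real (U k $ Inr l $ Inl j) - \<i> * complex_of_real (U k $ Inr l $ Inr j)))"

text \<open>\<open>eta U lam j l\<close> and \<open>nu U lam j l\<close> are \<open>\<eta>\<^sub>l\<close> and \<open>\<nu>\<^sub>l\<close> for the operator of index \<open>j\<close>.\<close>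

definition eta ::
  "('m::finite \<Rightarrow> real ^ ('n::finite + 'n) ^ ('n + 'n)) \<Rightarrow> real ^ 'm \<Rightarrow> 'n \<Rightarrow> 'n \<Rightarrow> complex" where
  "eta U lam j l = beta_c U lam j l + \<i> * alpha_c U lam j l"

definition nu ::
  "('m::finite \<Rightarrow> real ^ ('n::finite + 'n) ^ ('n + 'n)) \<Rightarrow> real ^ 'm \<Rightarrow> 'n \<Rightarrow> 'n \<Rightarrow> complex" where
  "nu U lam j l = - beta_c U lam j l + \<i> * alpha_c U lam j l"

abbreviation nu_diag ::
  "('m::finite \<Rightarrow> real ^ ('n::finite + 'n) ^ ('n + 'n)) \<Rightarrow> real ^ 'm \<Rightarrow> 'n \<Rightarrow> complex" where
  "nu_diag U lam j \<equiv> nu U lam j j"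

definition Z_op ::
  "('m::finite \<Rightarrow> real ^ ('n::finite + 'n) ^ ('n + 'n)) \<Rightarrow> real ^ 'm \<Rightarrow> 'n \<Rightarrow>
   (complex ^ 'n \<Rightarrow> complex) \<Rightarrow> complex ^ 'n \<Rightarrow> complex" where
  "Z_op U lam j f z = d_z j f z
     + (1/4) * (\<Sum>l\<in>UNIV. eta U lam j l * z $ l + nu U lam j l * cnj (z $ l)) * f z"

definition Zbar_op ::
  "('m::finite \<Rightarrow> real ^ ('n::finite + 'n) ^ ('n + 'n)) \<Rightarrow> real ^ 'm \<Rightarrow> 'n \<Rightarrow>
   (complex ^ 'n \<Rightarrow> complex) \<Rightarrow> complex ^ 'n \<Rightarrow> complex" where
  "Zbar_op U lam j f z = d_zbar j f z
     - (1/4) * (\<Sum>l\<in>UNIV. cnj (nu U lam j l) * z $ l + cnj (eta U lam j l) * cnj (z $ l)) * f z"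

text \<open>\<open>T\<^sub>1\<^bsup>\<alpha>\<^sub>1\<^esup> \<dots> T\<^sub>n\<^bsup>\<alpha>\<^sub>n\<^esup>\<close>, in this order (the operator with the largest index acts first).\<close>

definition op_power ::
  "('n::{finite,linorder} \<Rightarrow> 'f \<Rightarrow> 'f) \<Rightarrow> ('n \<Rightarrow> nat) \<Rightarrow> 'f \<Rightarrow> 'f" where
  "op_power T \<alpha> f = foldr (\<lambda>l. T l ^^ \<alpha> l) (sorted_list_of_set UNIV) f"

text \<open>\<open>mon p q j\<close> is the pair \<open>(\<alpha>, \<beta>)\<close> of the monomial chosen for \<open>P\<^sub>j\<^sup>p\<^sup>,\<^sup>q\<close>.\<close>

definition Zstar_space ::
  "(nat \<Rightarrow> nat \<Rightarrow> nat) \<Rightarrow>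
   (nat \<Rightarrow> nat \<Rightarrow> nat \<Rightarrow> complex ^ 'n::{finite,linorder} \<Rightarrow> complex) \<Rightarrow>
   (nat \<Rightarrow> nat \<Rightarrow> nat \<Rightarrow> ('n \<Rightarrow> nat) \<times> ('n \<Rightarrow> nat)) \<Rightarrow>
   ('m::finite \<Rightarrow> real ^ ('n + 'n) ^ ('n + 'n)) \<Rightarrow> real ^ 'm \<Rightarrow>
   real \<Rightarrow> ereal \<Rightarrow> (complex ^ 'n::{finite,linorder} \<Rightarrow> complex) set" where
  "Zstar_space d Y mon U lam r R =
     {f. smooth_fun_on (shell r R) f \<and>
         (\<forall>p q. \<forall>j\<in>{1..d p q}.
            harm_proj d Y 0 0
              (op_power (Zbar_op U lam) (snd (mon p q j))
                (harm_proj d Y 0 q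
                  (op_power (Z_op U lam) (fst (mon p q j))
                    (\<lambda>z. harm_coeff_tilde Y p q j f (norm z) * Y p q j z))))
            \<in> Z_space U lam r R)}"

section \<open>The operators in \<open>\<rho>\<close>\<close>

definition D_op ::
  "('m::finite \<Rightarrow> real ^ ('n::finite + 'n) ^ ('n + 'n)) \<Rightarrow> real ^ 'm \<Rightarrow> 'n \<Rightarrow>
   (real \<Rightarrow> complex) \<Rightarrow> real \<Rightarrow> complex" where
  "D_op U lam j g \<rho> = complex_of_real \<rho> * vector_derivative g (at \<rho>)
     + nu_diag U lam j / 2 * complex_of_real (\<rho>\<^sup>2) * g \<rho>"

definition Dbar_op ::
  "('m::finite \<Rightarrow> real ^ ('n::finite + 'n) ^ ('n + 'n)) \<Rightarrow> real ^ 'm \<Rightarrow> 'n \<Rightarrow>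
   (real \<Rightarrow> complex) \<Rightarrow> real \<Rightarrow> complex" where
  "Dbar_op U lam j g \<rho> = complex_of_real \<rho> * vector_derivative g (at \<rho>)
     - cnj (nu_diag U lam j) / 2 * complex_of_real (\<rho>\<^sup>2) * g \<rho>"

text \<open>\<open>\<Prod>\<^bsub>i=1\<^esub>\<^bsup>\<alpha>\<^sub>1\<^esup>(\<kappa>\<^sub>1\<^sub>,\<^sub>i T\<^sub>1 + 2) \<dots> \<Prod>\<^bsub>i=1\<^esub>\<^bsup>\<alpha>\<^sub>n\<^esup>(\<kappa>\<^sub>n\<^sub>,\<^sub>i T\<^sub>n + 2)\<close>, the rightmost factor acting first.\<close>

definition shifted_power ::
  "('n::{finite,linorder} \<Rightarrow> (real \<Rightarrow> complex) \<Rightarrow> real \<Rightarrow> complex) \<Rightarrow> ('n \<Rightarrow> nat \<Rightarrow> real) \<Rightarrow>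
   ('n \<Rightarrow> nat) \<Rightarrow> (real \<Rightarrow> complex) \<Rightarrow> real \<Rightarrow> complex" where
  "shifted_power T \<kappa> \<alpha> g =
     foldr (\<lambda>l. foldr (\<lambda>i h \<rho>. complex_of_real (\<kappa> l i) * T l h \<rho> + 2 * h \<rho>) [1..<Suc (\<alpha> l)])
       (sorted_list_of_set UNIV) g"

text \<open>\<open>\<Sum>\<^bsub>|\<alpha>|+l=p\<^esub> c\<^sub>\<alpha>\<^sub>,\<^sub>l \<rho>\<^sup>2\<^sup>l T\<^sup>\<alpha>\<close>; the constants \<open>\<kappa>\<close> in \<open>T\<^sup>\<alpha>\<close> may depend on \<open>\<alpha>\<close>.\<close>

definition ode_factor ::
  "('n::{finite,linorder} \<Rightarrow> (real \<Rightarrow> complex) \<Rightarrow> real \<Rightarrow> complex) \<Rightarrow> nat \<Rightarrow>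
   (('n \<Rightarrow> nat) \<Rightarrow> 'n \<Rightarrow> nat \<Rightarrow> real) \<Rightarrow> (('n \<Rightarrow> nat) \<Rightarrow> nat \<Rightarrow> complex) \<Rightarrow>
   (real \<Rightarrow> complex) \<Rightarrow> real \<Rightarrow> complex" where
  "ode_factor T p \<kappa> c g \<rho> =
     (\<Sum>(\<alpha>, l)\<in>{(\<alpha>, l). (\<Sum>i\<in>UNIV. \<alpha> i) + l = p}.
        c \<alpha> l * complex_of_real (\<rho> ^ (2 * l)) * shifted_power T (\<kappa> \<alpha>) \<alpha> g \<rho>)"

text \<open>
  The coefficient of \<open>(\<rho> d/d\<rho>)\<^sup>p\<close> in \<open>ode_factor T p \<kappa> c\<close> for \<open>T = D\<close> or \<open>T = \<bar>D\<close>. If it is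
  non-zero then \<open>ode_factor T p \<kappa> c\<close> is a differential operator of order exactly \<open>p\<close>; without such
  a requirement the scalars could be chosen so that the operator vanishes.
\<close>

definition ode_lead ::
  "nat \<Rightarrow> (('n::finite \<Rightarrow> nat) \<Rightarrow> 'n \<Rightarrow> nat \<Rightarrow> real) \<Rightarrow> (('n \<Rightarrow> nat) \<Rightarrow> nat \<Rightarrow> complex) \<Rightarrow> complex" where
  "ode_lead p \<kappa> c =
     (\<Sum>\<alpha>\<in>midx p. c \<alpha> 0 * (\<Prod>l\<in>UNIV. \<Prod>i=1..\<alpha> l. complex_of_real (\<kappa> \<alpha> l i)))"

text \<open>
  The numbers \<open>\<gamma>\<^bsub>p',q'\<^esub> = 1/(n+p'+q'-1)\<close>; the undefined \<open>\<gamma>\<^bsub>0,0\<^esub>\<close> for \<open>n = 1\<close> is excluded.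
\<close>

definition gammas :: "nat \<Rightarrow> nat \<Rightarrow> nat \<Rightarrow> real set" where
  "gammas n p q = {1 / (real n + real p' + real q' - 1) | p' q'. p' \<le> p \<and> q' \<le> q \<and> n + p' + q' \<noteq> 1}"

definition kappas_in ::
  "nat \<Rightarrow> (('n::finite \<Rightarrow> nat) \<Rightarrow> 'n \<Rightarrow> nat \<Rightarrow> real) \<Rightarrow> real set \<Rightarrow> bool" where
  "kappas_in p \<kappa> G \<longleftrightarrow>
     (\<forall>\<alpha>. (\<Sum>l\<in>UNIV. \<alpha> l) \<le> p \<longrightarrow> (\<forall>l. \<forall>i\<in>{1..\<alpha> l}. \<kappa> \<alpha> l i \<in> G))"

end

theory Submission
  imports Defs "HOL-Probability.Probability_Measure" "HOL-Computational_Algebra.Fundamental_Theorem_Algebra"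
begin

text \<open>
  Consider \<open>f = a(\<rho>) P\<close> and the spheres centred at the origin. There the twisted mean of a radial
  function is its value, so the hypothesis implies that the projection to bidegree \<open>(0, 0)\<close> of the
  iterated operators applied to \<open>a P\<close> vanishes (\<open>Z_space_mean_zero\<close>). It remains to compute this
  projection and to see that it is a factorizable differential operator applied to \<open>a\<close>.

  Let \<open>t = \<rho>\<^sup>2\<close> and let \<open>N\<^sub>H(F)(t)\<close> be \<open>t\<^sup>n\<^sup>-\<^sup>1\<close> times the mean of \<open>F H\<close> over the sphere of radius \<open>\<rho>\<close>. The
  divergence theorem gives \<open>N\<^sub>H(\<partial>\<^sub>j F) = d/dt N\<^sub>X(F) - N\<^sub>Y(F)\<close> with \<open>X = cnj z\<^sub>j H\<close> and \<open>Y = \<partial>\<^sub>j H\<close>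
  (\<open>rmean_adjoint\<close>). Thus the operators \<open>Z\<^sub>j\<close> can be moved to the test polynomial \<open>H\<close>. After as many steps
  as there are operators \<open>H\<close> is paired with \<open>P\<close>, which is orthogonal to polynomials of the wrong bidegree
  balance and of lower degree (\<open>sphere_mean_unbalanced\<close>, \<open>sphere_mean_harmonic_lower\<close>). Only the
  contributions survive in which every operator has multiplied \<open>H\<close> by a linear form
  \<open>cnj z\<^sub>j d/dt + 1/4 \<Sum>\<^sub>l \<nu>\<^sub>l cnj z\<^sub>l\<close> (\<open>rmean_twisted_top\<close>). The conjugate operators are treated in the same way.
  With \<open>b(t) = t\<^sup>n\<^sup>+\<^sup>p\<^sup>+\<^sup>q\<^sup>-\<^sup>1 a(\<rho>)\<close> the hypothesis becomes a linear equation with constant coefficients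
  for \<open>b\<close> in the variable \<open>t\<close>, of order \<open>p + q\<close> (\<open>two_stage_identity\<close>). Its leading coefficient is the mean
  of \<open>P\<close> times the conjugate of the chosen monomial, a positive multiple of the coefficient of that
  monomial in \<open>P\<close> (\<open>sphere_mean_monomial_nonzero\<close>).

  The operators \<open>\<kappa> D\<^sub>j + 2\<close> are \<open>d/dt + \<nu>\<^sub>j/4\<close> in disguise: for \<open>\<kappa> = 1/m\<close> they map \<open>t\<^sup>-\<^sup>m b\<close> to
  \<open>(2/m) t\<^sup>-\<^sup>m\<^sup>+\<^sup>1 (b' + \<nu>\<^sub>j/4 b)\<close> (\<open>shifted_step\<close>). Hence every polynomial in \<open>d/dt\<close> of degree \<open>p\<close> is of the form
  required of a factor of the equation (\<open>ode_factor_realize\<close>), and the factorization follows from the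
  fundamental theorem of algebra for the characteristic polynomial. If \<open>P\<close> is a monomial in one variable and
  one conjugate variable, the characteristic polynomial is a multiple of \<open>(s + \<nu>\<^sub>1/4)\<^sup>p (s - \<nu>\<^sub>2/4)\<^sup>q\<close>
  (\<open>sphere_mean_monomial_symbols\<close>), where \<open>\<nu>\<^sub>1\<close> and \<open>\<nu>\<^sub>2\<close> are real and belong to the two variables, and
  solving the equation for distinct roots, or for a single root if \<open>p\<close> or \<open>q\<close> is zero, gives the
  explicit formula (\<open>two_root_solution\<close>).
\<close>

section \<open>Rotation invariance of Lebesgue measure\<close>

text \<open>
  By Vitali's covering theorem an open set is, up to a null set, a countable disjoint union of
  balls. A linear isometry maps a ball to a ball of the same radius and null sets to null sets.
\<close>

lemma emeasure_orthogonal_image_open: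
  fixes T :: "'a::euclidean_space \<Rightarrow> 'a"
  assumes T: "orthogonal_transformation T" and U: "open U"
  shows "emeasure lborel (T ` U) = emeasure lborel U"
proof -
  define K where "K = {p. snd p > 0 \<and> ball (fst p) (snd p) \<subseteq> U}"
  have "\<exists>i. i \<in> K \<and> x \<in> ball (fst i) (snd i) \<and> snd i < d" if "x \<in> U" "0 < d" for x d
  proof -
    have "\<exists>e>0. ball x e \<subseteq> U" using U that(1) by (simp add: open_contains_ball)
    then obtain e where e: "e > 0" "ball x e \<subseteq> U" by (elim exE conjE)
    have "ball x (min e (d/2)) \<subseteq> U" using e by (meson subset_ball min.cobounded1 order_trans)
    then show ?thesis using e that by (intro exI[of _ "(x, min e (d/2))"]) (auto simp: K_def)
  qed
  then obtain C where C: "countable C" "C \<subseteq> K"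
      and disj: "pairwise (\<lambda>i j. disjnt (ball (fst i) (snd i)) (ball (fst j) (snd j))) C"
      and neg: "negligible (U - (\<Union>i \<in> C. ball (fst i) (snd i)))"
    using Vitali_covering_theorem_balls[where K=K and a=fst and r=snd and S=U] by blast
  define V where "V = (\<Union>i \<in> C. ball (fst i) (snd i))"
  have lin: "linear T" using T by (rule orthogonal_transformation_linear)
  have inj: "inj T" using T by (rule orthogonal_transformation_inj)
  have imb: "T ` ball a s = ball (T a) s" for a s
    using T by (rule image_orthogonal_transformation_ball)
  have openT: "open (T ` W)" if "open W" for W
    using that lin T by (intro open_surjective_linear_image) (auto simp: orthogonal_transformation_surj)
  have VU: "V \<subseteq> U" using C by (auto simp: V_def K_def)
  have oV: "open V" by (auto simp: V_def)
  have negT: "negligible (T ` (U - V))"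
    using neg lin by (intro negligible_differentiable_image_negligible)
      (auto simp: V_def linear_imp_differentiable_on)
  have null: "emeasure lborel A = emeasure lborel B"
    if "negligible (A - B)" "B \<subseteq> A" "open A" "open B" for A B :: "'a set"
  proof -
    have "A - B \<in> null_sets lebesgue" using that(1) by (simp add: negligible_iff_null_sets)
    then have "A - B \<in> null_sets lborel"
      using that by (subst (asm) null_sets_completion_iff) auto
    then have "emeasure lborel (B \<union> (A - B)) = emeasure lborel B"
      using that by (intro emeasure_Un_null_set) auto
    then show ?thesis using that(2) by (simp add: Un_absorb1)
  qed
  have df: "disjoint_family_on (\<lambda>i. ball (fst i) (snd i)) C"
    using disj by (auto simp: disjoint_family_on_def pairwise_def disjnt_def)
  have df': "disjoint_family_on (\<lambda>i. ball (T (fst i)) (snd i)) C"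
    unfolding disjoint_family_on_def imb[symmetric]
    using df inj by (auto simp: disjoint_family_on_def image_Int[symmetric])
  have TV: "T ` V = (\<Union>i\<in>C. ball (T (fst i)) (snd i))"
    by (simp add: V_def image_UN imb)
  have ball_eq: "emeasure lborel (ball (T (fst i)) (snd i)) = emeasure lborel (ball (fst i) (snd i))"
    if "i \<in> C" for i
  proof -
    have "snd i \<ge> 0" using that C(2) by (auto simp: K_def)
    then show ?thesis by (simp add: emeasure_ball)
  qed
  have "emeasure lborel (T ` V) = (\<integral>\<^sup>+i. emeasure lborel (ball (T (fst i)) (snd i)) \<partial>count_space C)"
    unfolding TV using C df' by (intro emeasure_UN_countable) auto
  also have "\<dots> = (\<integral>\<^sup>+i. emeasure lborel (ball (fst i) (snd i)) \<partial>count_space C)"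
    using ball_eq by (intro nn_integral_cong) auto
  also have "\<dots> = emeasure lborel V"
    unfolding V_def using C df by (intro emeasure_UN_countable[symmetric]) auto
  finally have "emeasure lborel (T ` V) = emeasure lborel V" .
  moreover have "emeasure lborel U = emeasure lborel V"
    using neg VU oV U by (intro null) (auto simp: V_def)
  moreover have "emeasure lborel (T ` U) = emeasure lborel (T ` V)"
    using negT VU openT[OF oV] openT[OF U] inj by (intro null) (auto simp: image_set_diff)
  ultimately show ?thesis by simp
qed

lemma lborel_distr_orthogonal:
  fixes T :: "'a::euclidean_space \<Rightarrow> 'a"
  assumes T: "orthogonal_transformation T"
  shows "distr lborel borel T = lborel"
proof (rule sym, rule lborel_eqI)
  have lin: "linear T" using T by (rule orthogonal_transformation_linear)
  have meas: "T \<in> borel_measurable borel"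
    using lin by (intro borel_measurable_continuous_onI linear_continuous_on linear_conv_bounded_linear[THEN iffD1])
  fix l u :: 'a assume le: "\<And>b. b \<in> Basis \<Longrightarrow> l \<bullet> b \<le> u \<bullet> b"
  have "emeasure (distr lborel borel T) (box l u) = emeasure lborel (T -` box l u)"
    using meas by (simp add: emeasure_distr)
  also have "T -` box l u = inv T ` box l u"
    using T by (simp add: bij_vimage_eq_inv_image orthogonal_transformation_bij)
  also have "emeasure lborel \<dots> = emeasure lborel (box l u)"
    using T by (intro emeasure_orthogonal_image_open orthogonal_transformation_inv) auto
  finally show "emeasure (distr lborel borel T) (box l u) = (\<Prod>b\<in>Basis. (u - l) \<bullet> b)"
    using le by (simp add: emeasure_lborel_box_eq)
qed simp

section \<open>The normalized surface measure\<close>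

lemma sphere_measure_measurable [measurable]:
  "(\<lambda>x::'a::euclidean_space. (s / norm x) *\<^sub>R x) \<in> borel_measurable borel"
  by measurable

lemma sets_sphere_measure [simp, measurable_cong]: "sets (sphere_measure s) = sets borel"
  by (simp add: sphere_measure_def)

lemma uniform_unit_ball_prob:
  "prob_space (uniform_measure lborel (ball (0::'a::euclidean_space) 1))"
proof (rule prob_space_uniform_measure)
  have "unit_ball_vol (real DIM('a)) \<noteq> 0" using unit_ball_vol_pos[of "real DIM('a)"] by linarith
  then show "emeasure lborel (ball (0::'a) 1) \<noteq> 0"
    by (simp add: emeasure_ball)
  show "emeasure lborel (ball (0::'a) 1) \<noteq> \<infinity>"
    by (simp add: emeasure_ball)
qed

lemma prob_space_sphere_measure: "prob_space (sphere_measure s :: 'a::euclidean_space measure)"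
proof -
  interpret prob_space "uniform_measure lborel (ball (0::'a) 1)" by (rule uniform_unit_ball_prob)
  show ?thesis unfolding sphere_measure_def by (rule prob_space_distr) simp
qed

text \<open>
  Only the centre of the ball is not projected to the sphere, and it is a null set.
\<close>

lemma AE_sphere_measure:
  assumes "s > 0"
  shows "AE w in (sphere_measure s :: 'a::euclidean_space measure). w \<in> sphere 0 s"
proof -
  have "AE x in lborel. x \<noteq> (0::'a)" by (rule AE_lborel_singleton)
  then have "AE x in uniform_measure lborel (ball (0::'a) 1). x \<noteq> 0"
    by (intro AE_uniform_measureI) auto
  then have "AE x in uniform_measure lborel (ball (0::'a) 1). (s / norm x) *\<^sub>R x \<in> sphere 0 s"
    by eventually_elim (use assms in auto)
  then show ?thesis
    unfolding sphere_measure_def by (subst AE_distr_iff) auto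
qed

lemma sphere_measure_orthogonal:
  fixes T :: "'a::euclidean_space \<Rightarrow> 'a"
  assumes T: "orthogonal_transformation T"
  shows "distr (sphere_measure s) borel T = sphere_measure s"
proof -
  have lin: "linear T" using T by (rule orthogonal_transformation_linear)
  have meas [measurable]: "T \<in> borel_measurable borel"
    using lin by (intro borel_measurable_continuous_onI linear_continuous_on linear_conv_bounded_linear[THEN iffD1])
  let ?B = "ball (0::'a) 1"
  have nT: "norm (T x) = norm x" for x using T by (rule orthogonal_transformation_norm)
  have "distr (uniform_measure lborel ?B) borel T = uniform_measure lborel ?B"
  proof (rule measure_eqI)
    fix A assume "A \<in> sets (distr (uniform_measure lborel ?B) borel T)"
    then have A [measurable]: "A \<in> sets borel" by simp
    have TA: "T -` A \<in> sets borel" using measurable_sets[OF meas A] by simp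
    have "?B \<inter> T -` A = T -` (?B \<inter> A)" using nT by auto
    then have "emeasure lborel (?B \<inter> T -` A) = emeasure (distr lborel borel T) (?B \<inter> A)"
      by (simp add: emeasure_distr)
    also have "\<dots> = emeasure lborel (?B \<inter> A)" using lborel_distr_orthogonal[OF T] by simp
    finally show "emeasure (distr (uniform_measure lborel ?B) borel T) A
        = emeasure (uniform_measure lborel ?B) A"
      using TA by (simp add: emeasure_distr)
  qed simp
  then have "sphere_measure s = distr (distr (uniform_measure lborel ?B) borel T) borel (\<lambda>x. (s / norm x) *\<^sub>R x)"
    by (simp add: sphere_measure_def)
  also have "\<dots> = distr (uniform_measure lborel ?B) borel ((\<lambda>x. (s / norm x) *\<^sub>R x) \<circ> T)"
    by (rule distr_distr) auto
  also have "(\<lambda>x. (s / norm x) *\<^sub>R x) \<circ> T = T \<circ> (\<lambda>x. (s / norm x) *\<^sub>R x)"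
    using lin by (auto simp: nT linear_cmul)
  also have "distr (uniform_measure lborel ?B) borel (T \<circ> (\<lambda>x. (s / norm x) *\<^sub>R x)) = distr (sphere_measure s) borel T"
    unfolding sphere_measure_def by (rule distr_distr[symmetric]) auto
  finally show ?thesis by simp
qed

abbreviation sphere_mean :: "('a::euclidean_space \<Rightarrow> complex) \<Rightarrow> complex" where
  "sphere_mean G \<equiv> (LINT w : sphere 0 1 | sphere_measure 1. G w)"

lemma set_integrable_sphere:
  fixes G :: "'a::euclidean_space \<Rightarrow> complex"
  assumes "continuous_on (sphere 0 s) G"
  shows "set_integrable (sphere_measure s) (sphere 0 s) G"
proof -
  interpret prob_space "sphere_measure s :: 'a measure" by (rule prob_space_sphere_measure)
  have [measurable]: "(\<lambda>w. indicator (sphere 0 s) w *\<^sub>R G w) \<in> borel_measurable borel"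
    using assms by (intro borel_measurable_continuous_on_indicator) auto
  have "bounded (G ` sphere 0 s)"
    using assms by (intro compact_imp_bounded compact_continuous_image) auto
  then obtain B where B: "\<And>w. w \<in> sphere 0 s \<Longrightarrow> norm (G w) \<le> B"
    unfolding bounded_iff by blast
  show ?thesis unfolding set_integrable_def
  proof (rule integrable_const_bound[where B="max B 0"])
    show "AE w in sphere_measure s. norm (indicat_real (sphere 0 s) w *\<^sub>R G w) \<le> max B 0"
      using B by (auto simp: indicator_def intro!: AE_I2) (metis max.coboundedI1 mem_sphere_0)
  qed (simp add: measurable_cong_sets[OF sets_sphere_measure refl])
qed

lemma sphere_mean_cong:
  "(\<And>w. norm w = 1 \<Longrightarrow> F w = G w) \<Longrightarrow> sphere_mean F = sphere_mean G"
  by (rule set_lebesgue_integral_cong) auto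

lemma sphere_mean_add:
  "continuous_on (sphere 0 1) F \<Longrightarrow> continuous_on (sphere 0 1) G \<Longrightarrow>
     sphere_mean (\<lambda>w. F w + G w) = sphere_mean F + sphere_mean G"
  by (intro set_integral_add set_integrable_sphere)

lemma sphere_mean_diff:
  "continuous_on (sphere 0 1) F \<Longrightarrow> continuous_on (sphere 0 1) G \<Longrightarrow>
     sphere_mean (\<lambda>w. F w - G w) = sphere_mean F - sphere_mean G"
  by (intro set_integral_diff set_integrable_sphere)

lemma sphere_mean_cmult: "sphere_mean (\<lambda>w. c * F w) = c * sphere_mean F"
  by (rule set_integral_mult_right)

lemma sphere_mean_sum:
  "finite A \<Longrightarrow> (\<And>i. i \<in> A \<Longrightarrow> continuous_on (sphere 0 1) (F i)) \<Longrightarrow>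
     sphere_mean (\<lambda>w. \<Sum>i\<in>A. F i w) = (\<Sum>i\<in>A. sphere_mean (F i))"
proof (induction A rule: finite_induct)
  case empty
  then show ?case by (simp add: set_lebesgue_integral_def)
next
  case (insert i A)
  then have "sphere_mean (\<lambda>w. F i w + (\<Sum>i\<in>A. F i w)) = sphere_mean (F i) + sphere_mean (\<lambda>w. \<Sum>i\<in>A. F i w)"
    by (intro sphere_mean_add continuous_on_sum) auto
  then show ?case using insert by simp
qed

lemma sphere_mean_cnj: "sphere_mean (\<lambda>w. cnj (F w)) = cnj (sphere_mean F)"
proof -
  have eq: "(\<lambda>w. indicat_real (sphere 0 1) w *\<^sub>R cnj (F w)) = (\<lambda>w. cnj (indicat_real (sphere 0 1) w *\<^sub>R F w))"
    by auto
  show ?thesis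
    unfolding set_lebesgue_integral_def eq by (rule Bochner_Integration.integral_cnj)
qed

lemma sphere_mean_const: "(LINT w : sphere 0 s | (sphere_measure s :: 'a::euclidean_space measure). c) = (c::complex)"
  if "s > 0"
proof -
  interpret prob_space "sphere_measure s :: 'a measure" by (rule prob_space_sphere_measure)
  have "(LINT w : sphere 0 s | (sphere_measure s :: 'a measure). c) = (LINT w | (sphere_measure s :: 'a measure). c)"
    unfolding set_lebesgue_integral_def
  proof (rule integral_cong_AE)
    show "AE w in (sphere_measure s :: 'a measure). indicat_real (sphere 0 s) w *\<^sub>R c = c"
      using AE_sphere_measure[OF that, where 'a='a] by (auto elim!: eventually_mono)
    show "(\<lambda>w. indicat_real (sphere 0 s) w *\<^sub>R c) \<in> borel_measurable (sphere_measure s)"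
      using set_integrable_sphere[of s "\<lambda>_. c"] by (auto simp: set_integrable_def intro: borel_measurable_integrable)
  qed simp
  then show ?thesis using prob_space by simp
qed

lemma sphere_mean_orthogonal:
  fixes T :: "'a::euclidean_space \<Rightarrow> 'a"
  assumes T: "orthogonal_transformation T" and G: "continuous_on (sphere 0 1) G"
  shows "sphere_mean (\<lambda>w. G (T w)) = sphere_mean G"
proof -
  have lin: "linear T" using T by (rule orthogonal_transformation_linear)
  have meas [measurable]: "T \<in> borel_measurable borel"
    using lin by (intro borel_measurable_continuous_onI linear_continuous_on linear_conv_bounded_linear[THEN iffD1])
  have nT: "norm (T x) = norm x" for x using T by (rule orthogonal_transformation_norm)
  have [measurable]: "(\<lambda>w. indicat_real (sphere 0 1) w *\<^sub>R G w) \<in> borel_measurable borel"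
    using G by (intro borel_measurable_continuous_on_indicator) auto
  have "sphere_mean G = (LINT w|distr (sphere_measure 1) borel T. indicat_real (sphere 0 1) w *\<^sub>R G w)"
    by (simp add: set_lebesgue_integral_def sphere_measure_orthogonal[OF T])
  also have "\<dots> = (LINT w|sphere_measure 1. indicat_real (sphere 0 1) (T w) *\<^sub>R G (T w))"
    by (rule integral_distr) (auto simp: measurable_cong_sets[OF sets_sphere_measure refl])
  also have "\<dots> = sphere_mean (\<lambda>w. G (T w))"
    by (simp add: set_lebesgue_integral_def indicator_def nT)
  finally show ?thesis by simp
qed

text \<open>
  For a skew map \<open>A\<close> with \<open>A\<^sup>3 = -A\<close> the maps \<open>exp (s A) = 1 + sin s A + (1 - cos s) A\<^sup>2\<close> form a
  one-parameter group of rotations. The mean of \<open>G \<circ> exp (s A)\<close> does not depend on \<open>s\<close>, and its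
  derivative at \<open>s = 0\<close> is the mean of the derivative of \<open>G\<close> along the vector field \<open>A\<close>; the
  difference quotients for \<open>s = 1/(n+1)\<close> are bounded on the sphere by the mean value theorem, so
  that dominated convergence applies.
\<close>

lemma sphere_mean_rotation_derivative:
  fixes G :: "'a::euclidean_space \<Rightarrow> complex" and A :: "'a \<Rightarrow> 'a"
  assumes A: "linear A" and skew: "\<And>x y. A x \<bullet> y = - (x \<bullet> A y)" and cube: "\<And>x. A (A (A x)) = - A x"
    and G: "\<And>x. (G has_derivative G' x) (at x)"
    and cont: "continuous_on UNIV (\<lambda>x. G' x (A x))"
  shows "sphere_mean (\<lambda>w. G' w (A w)) = 0"
proof -
  define E where "E = (\<lambda>s x. x + sin s *\<^sub>R A x + (1 - cos s) *\<^sub>R A (A x))"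
  have linE: "linear (E s)" for s
    using A by (auto intro!: linearI simp: E_def linear_add linear_cmul algebra_simps)
  have xAx: "x \<bullet> A x = 0" for x using skew[of x x] by (simp add: inner_commute)
  have normE: "norm (E s x) = norm x" for s x
  proof -
    have 1: "A x \<bullet> A (A x) = 0" by (rule xAx)
    have 2: "x \<bullet> A (A x) = - (A x \<bullet> A x)" using skew[of x "A x"] by simp
    have 3: "A (A x) \<bullet> A (A x) = A x \<bullet> A x" using skew[of "A x" "A (A x)"] cube by simp
    have expand: "(x + a *\<^sub>R u + b *\<^sub>R v) \<bullet> (x + a *\<^sub>R u + b *\<^sub>R v)
        = x \<bullet> x + a\<^sup>2 * (u \<bullet> u) + b\<^sup>2 * (v \<bullet> v) + 2 * a * (x \<bullet> u) + 2 * b * (x \<bullet> v) + 2 * a * b * (u \<bullet> v)"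
      for a b :: real and u v :: 'a
      unfolding inner_simps inner_commute[of u x] inner_commute[of v x] inner_commute[of v u]
      by (simp add: power2_eq_square algebra_simps)
    have "E s x \<bullet> E s x = x \<bullet> x + ((sin s)\<^sup>2 + (1 - cos s)\<^sup>2 - 2 * (1 - cos s)) * (A x \<bullet> A x)"
      unfolding E_def expand 1 2 3 xAx[of x] by (simp add: algebra_simps)
    also have "(sin s)\<^sup>2 + (1 - cos s)\<^sup>2 - 2 * (1 - cos s) = 0"
      using sin_cos_squared_add[of s] by (simp add: power2_eq_square algebra_simps)
    finally show ?thesis by (simp add: norm_eq)
  qed
  have orth: "orthogonal_transformation (E s)" for s
    using linE normE by (simp add: orthogonal_transformation)
  have derE: "((\<lambda>s. E s x) has_vector_derivative A (E s x)) (at s within X)" for s x X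
  proof -
    have "A (E s x) = cos s *\<^sub>R A x + sin s *\<^sub>R A (A x)"
      using A by (simp add: E_def linear_add[OF A] linear_cmul[OF A] linear_diff[OF A] cube scaleR_diff_left)
    then show ?thesis unfolding E_def
      by (auto intro!: derivative_eq_intros simp: has_vector_derivative_def algebra_simps)
  qed
  have contG: "continuous_on X G" for X
    using G by (meson continuous_at_imp_continuous_on has_derivative_continuous)
  have derG: "((\<lambda>s. G (E s x)) has_vector_derivative G' (E s x) (A (E s x))) (at s within X)" for s x X
  proof -
    have "(G has_derivative G' (E s x)) (at (E s x) within (\<lambda>s. E s x) ` X)"
      using G has_derivative_at_withinI by blast
    then have "((G \<circ> (\<lambda>s. E s x)) has_derivative G' (E s x) \<circ> (\<lambda>h. h *\<^sub>R A (E s x))) (at s within X)"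
      using derE[of x s X] by (intro diff_chain_within) (auto simp: has_vector_derivative_def)
    moreover have "linear (G' (E s x))" using G has_derivative_linear by blast
    ultimately show ?thesis
      by (simp add: has_vector_derivative_def o_def linear_cmul)
  qed
  have "bounded ((\<lambda>x. G' x (A x)) ` sphere 0 1)"
    using cont by (intro compact_imp_bounded compact_continuous_image) (auto intro: continuous_on_subset)
  then obtain B where "\<forall>x\<in>sphere 0 1. norm (G' x (A x)) \<le> B"
    unfolding bounded_iff image_iff by blast
  then have B: "norm (G' x (A x)) \<le> B" if "norm x = 1" for x using that by simp
  \<comment> \<open>difference quotients of \<open>G \<circ> exp (s A)\<close> at \<open>s = 0\<close>\<close>
  define Q where "Q = (\<lambda>n::nat. \<lambda>w. of_nat (Suc n) * (G (E (1 / real (Suc n)) w) - G w))"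
  have Qlim: "(\<lambda>n. Q n w) \<longlonglongrightarrow> G' w (A w)" for w
  proof -
    have "((\<lambda>s. G (E s w)) has_vector_derivative G' w (A w)) (at 0)"
      using derG[of w 0 UNIV] A by (simp add: E_def)
    then have lim: "((\<lambda>h. norm (G (E h w) - G w - h *\<^sub>R G' w (A w)) / norm h) \<longlongrightarrow> 0) (at 0)"
      by (simp add: has_vector_derivative_def has_derivative_at E_def)
    have "((\<lambda>h. (1/h) *\<^sub>R (G (E h w) - G w) - G' w (A w)) \<longlongrightarrow> 0) (at 0)"
    proof (rule tendsto_norm_zero_cancel, rule Lim_transform_eventually[OF lim])
      show "\<forall>\<^sub>F h in at 0. norm (G (E h w) - G w - h *\<^sub>R G' w (A w)) / norm h
              = norm ((1/h) *\<^sub>R (G (E h w) - G w) - G' w (A w))"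
      proof (rule eventually_at_filter[THEN iffD2], rule always_eventually, intro allI impI)
        fix h :: real assume h: "h \<noteq> 0"
        have "(1/h) *\<^sub>R (G (E h w) - G w) - G' w (A w) = (1/h) *\<^sub>R (G (E h w) - G w - h *\<^sub>R G' w (A w))"
          using h by (simp add: scaleR_diff_right)
        then show "norm (G (E h w) - G w - h *\<^sub>R G' w (A w)) / norm h
              = norm ((1/h) *\<^sub>R (G (E h w) - G w) - G' w (A w))"
          by (simp add: divide_inverse)
      qed
    qed
    then have "((\<lambda>h. (1/h) *\<^sub>R (G (E h w) - G w)) \<longlongrightarrow> G' w (A w)) (at 0)"
      by (rule Lim_null[THEN iffD2])
    moreover have "filterlim (\<lambda>n. 1 / real (Suc n)) (at 0) sequentially"
      unfolding filterlim_at using LIMSEQ_Suc[OF lim_1_over_n] by (auto simp: )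
    ultimately have "(\<lambda>n. (1/(1 / real (Suc n))) *\<^sub>R (G (E (1 / real (Suc n)) w) - G w)) \<longlonglongrightarrow> G' w (A w)"
      by (rule filterlim_compose)
    then show ?thesis by (simp add: Q_def scaleR_conv_of_real)
  qed
  have Qbound: "norm (Q n w) \<le> B" if w: "norm w = 1" for n w
  proof -
    have "norm (G (E (1 / real (Suc n)) w) - G (E 0 w)) \<le> B * norm (1 / real (Suc n) - 0)"
    proof (rule differentiable_bound[where S=UNIV and f="\<lambda>s. G (E s w)"])
      show "((\<lambda>s. G (E s w)) has_derivative (\<lambda>h. h *\<^sub>R G' (E s w) (A (E s w)))) (at s within UNIV)" for s
        using derG by (simp add: has_vector_derivative_def)
      show "onorm (\<lambda>h. h *\<^sub>R G' (E s w) (A (E s w))) \<le> B" for s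
        using B[of "E s w"] normE[of s w] w by (intro onorm_le) (simp add: mult.commute[of B] mult_left_mono)
    qed auto
    moreover have "E 0 w = w" by (simp add: E_def)
    ultimately have "norm (G (E (1 / real (Suc n)) w) - G w) \<le> B * (1 / real (Suc n))" by simp
    then have "real (Suc n) * norm (G (E (1 / real (Suc n)) w) - G w) \<le> B"
      by (simp only: times_divide_eq_right mult_1_right pos_le_divide_eq of_nat_0_less_iff zero_less_Suc mult.commute)
    then show ?thesis unfolding Q_def norm_mult norm_of_nat .
  qed
  have contE: "continuous_on (sphere 0 1) (\<lambda>w. G (E s w))" for s
    using linE by (intro continuous_on_compose2[OF contG] linear_continuous_on linear_conv_bounded_linear[THEN iffD1]) auto
  have contQ: "continuous_on (sphere 0 1) (Q n)" for n
    unfolding Q_def by (intro continuous_intros contE contG)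
  have "sphere_mean (Q n) = 0" for n
  proof -
    show ?thesis unfolding Q_def
      using sphere_mean_orthogonal[OF orth contG, of "1 / real (Suc n)"] contG contE
      by (simp add: sphere_mean_cmult sphere_mean_diff)
  qed
  moreover have "(\<lambda>n. sphere_mean (Q n)) \<longlonglongrightarrow> sphere_mean (\<lambda>w. G' w (A w))"
    unfolding set_lebesgue_integral_def
  proof (rule integral_dominated_convergence)
    interpret prob_space "sphere_measure 1 :: 'a measure" by (rule prob_space_sphere_measure)
    show "integrable (sphere_measure 1 :: 'a measure) (\<lambda>x. max B 0)" by simp
    show "AE x in sphere_measure 1. (\<lambda>n. indicat_real (sphere 0 1) x *\<^sub>R Q n x) \<longlonglongrightarrow> indicat_real (sphere 0 1) x *\<^sub>R G' x (A x)"
      using Qlim by (auto intro!: AE_I2 tendsto_intros)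
    show "AE x in sphere_measure 1. norm (indicat_real (sphere 0 1) x *\<^sub>R Q n x) \<le> max B 0" for n
      using Qbound by (auto simp: indicator_def intro!: AE_I2) (metis max.coboundedI1)
    show "(\<lambda>x. indicat_real (sphere 0 1) x *\<^sub>R G' x (A x)) \<in> borel_measurable (sphere_measure 1)"
      using set_integrable_sphere[of 1 "\<lambda>x. G' x (A x)"] cont
      by (auto simp: set_integrable_def intro: continuous_on_subset borel_measurable_integrable)
    show "(\<lambda>x. indicat_real (sphere 0 1) x *\<^sub>R Q n x) \<in> borel_measurable (sphere_measure 1)" for n
      using set_integrable_sphere[OF contQ] by (auto simp: set_integrable_def intro: borel_measurable_integrable)
  qed
  ultimately show ?thesis by (simp add: LIMSEQ_const_iff)
qed

section \<open>Wirtinger calculus\<close>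

lemma vec_real_decomp:
  fixes v :: "complex ^ 'n::finite"
  shows "v = (\<Sum>j\<in>UNIV. Re (v $ j) *\<^sub>R axis j 1 + Im (v $ j) *\<^sub>R axis j \<i>)"
proof (rule vec_eq_iff[THEN iffD2], intro allI)
  fix i
  have "(\<Sum>j\<in>UNIV. Re (v $ j) *\<^sub>R axis j 1 + Im (v $ j) *\<^sub>R axis j \<i>) $ i
      = (\<Sum>j\<in>UNIV. if i = j then v $ j else 0)"
    unfolding sum_component by (intro sum.cong refl) (auto simp: axis_def complex_eq_iff)
  then show "v $ i = (\<Sum>j\<in>UNIV. Re (v $ j) *\<^sub>R axis j 1 + Im (v $ j) *\<^sub>R axis j \<i>) $ i" by simp
qed

text \<open>
  A real linear map on \<open>\<complex>\<^sup>n\<close> is the sum of a complex linear and a conjugate linear one; the Wirtinger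
  derivatives are their coefficients.
\<close>

lemma frechet_derivative_wirtinger:
  fixes F :: "complex ^ 'n::finite \<Rightarrow> complex"
  assumes "F differentiable at z"
  shows "frechet_derivative F (at z) v = (\<Sum>j\<in>UNIV. d_z j F z * v $ j + d_zbar j F z * cnj (v $ j))"
proof -
  let ?D = "frechet_derivative F (at z)"
  have lin: "linear ?D" using assms by (rule linear_frechet_derivative)
  have *: "Re a *\<^sub>R x + Im a *\<^sub>R y = (x - \<i> * y) / 2 * a + (x + \<i> * y) / 2 * cnj a" for a x y :: complex
    by (simp add: complex_eq_iff field_simps)
  have "?D v = ?D (\<Sum>j\<in>UNIV. Re (v $ j) *\<^sub>R axis j 1 + Im (v $ j) *\<^sub>R axis j \<i>)"
    by (subst vec_real_decomp[of v]) (rule refl)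
  also have "\<dots> = (\<Sum>j\<in>UNIV. Re (v $ j) *\<^sub>R ?D (axis j 1) + Im (v $ j) *\<^sub>R ?D (axis j \<i>))"
    using lin by (simp add: linear_sum linear_add linear_cmul)
  finally show ?thesis unfolding d_z_def d_zbar_def * .
qed

lemma d_z_eqI:
  assumes "(F has_derivative D) (at z)"
  shows "d_z j F z = (D (axis j 1) - \<i> * D (axis j \<i>)) / 2"
    and "d_zbar j F z = (D (axis j 1) + \<i> * D (axis j \<i>)) / 2"
  using frechet_derivative_at[OF assms] by (simp_all add: d_z_def d_zbar_def)

lemma differentiable_frechet:
  "F differentiable at z \<Longrightarrow> (F has_derivative frechet_derivative F (at z)) (at z)"
  by (simp add: frechet_derivative_works)

lemma d_z_const [simp]: "d_z j (\<lambda>z. c) = (\<lambda>z. 0)"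
  by (rule ext) (simp add: d_z_eqI(1)[OF has_derivative_const])

lemma d_z_add:
  assumes "F differentiable at z" "G differentiable at z"
  shows "d_z j (\<lambda>z. F z + G z) z = d_z j F z + d_z j G z"
  by (subst d_z_eqI(1)[OF has_derivative_add[OF assms[THEN differentiable_frechet]]])
    (simp add: d_z_def field_simps)

lemma d_z_mult:
  assumes "F differentiable at z" "G differentiable at z"
  shows "d_z j (\<lambda>z. F z * G z) z = d_z j F z * G z + F z * d_z j G z"
  by (subst d_z_eqI(1)[OF has_derivative_mult[OF assms[THEN differentiable_frechet]]])
    (simp add: d_z_def field_simps)

lemma d_z_cmult:
  assumes "F differentiable at z"
  shows "d_z j (\<lambda>z. c * F z) z = c * d_z j F z"
  using d_z_mult[of "\<lambda>z. c" z F] assms by simp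

lemma d_z_cnj:
  assumes "F differentiable at z"
  shows "d_z j (\<lambda>z. cnj (F z)) z = cnj (d_zbar j F z)"
  using d_z_eqI(1)[OF has_derivative_cnj[OF assms[THEN differentiable_frechet]]]
  by (simp add: d_zbar_def)

lemma differentiable_cnj:
  assumes "F differentiable at z"
  shows "(\<lambda>z. cnj (F z)) differentiable at z"
  using has_derivative_cnj[OF assms[THEN differentiable_frechet]] by (auto simp: differentiable_def)

lemma d_zbar_cnj:
  assumes "F differentiable at z"
  shows "d_zbar j F z = cnj (d_z j (\<lambda>z. cnj (F z)) z)"
  using d_z_cnj[OF assms] by simp

lemma has_derivative_vec_coord: "((\<lambda>z. z $ l) has_derivative (\<lambda>v. v $ l)) (at z)"
  by (rule bounded_linear_imp_has_derivative, rule bounded_linear_vec_nth)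

lemma differentiable_coord [simp]: "(\<lambda>z::complex^'n::finite. z $ l) differentiable at z"
  using has_derivative_vec_coord by (auto simp: differentiable_def)

lemma differentiable_cnj_coord [simp]: "(\<lambda>z::complex^'n::finite. cnj (z $ l)) differentiable at z"
  by (intro differentiable_cnj differentiable_coord)

lemma d_z_coord: "d_z j (\<lambda>z::complex^'n::finite. z $ l) = (\<lambda>z. if l = j then 1 else 0)"
  by (rule ext) (simp add: d_z_eqI(1)[OF has_derivative_vec_coord] axis_def)

lemma d_z_cnj_coord: "d_z j (\<lambda>z::complex^'n::finite. cnj (z $ l)) = (\<lambda>z. 0)"
  by (rule ext) (simp add: d_z_eqI(1)[OF has_derivative_cnj[OF has_derivative_vec_coord]] axis_def)

lemma has_derivative_norm_sq:
  "((\<lambda>z::'a::real_inner. (norm z)\<^sup>2) has_derivative (\<lambda>v. 2 * (z \<bullet> v))) (at z)"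
  unfolding power2_norm_eq_inner by (auto intro!: derivative_eq_intros simp: inner_commute)

lemma has_derivative_radial:
  fixes z :: "'a::real_inner" and b :: "real \<Rightarrow> complex"
  assumes "(b has_vector_derivative b') (at ((norm z)\<^sup>2))"
  shows "((\<lambda>z. b ((norm z)\<^sup>2)) has_derivative (\<lambda>v. (2 * (z \<bullet> v)) *\<^sub>R b')) (at z)"
  using diff_chain_at[OF has_derivative_norm_sq[of z] assms[unfolded has_vector_derivative_def]]
  by (simp add: o_def)

text \<open>
  On functions of \<open>t = |z|\<^sup>2\<close> the operator \<open>\<partial>/\<partial>z\<^sub>j\<close> is multiplication by \<open>cnj z\<^sub>j\<close> after \<open>d/dt\<close>, without
  any factor depending on \<open>t\<close>. This is why the square of the radius is the radial variable below.
\<close>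

lemma d_z_radial:
  fixes z :: "complex^'n::finite" and b :: "real \<Rightarrow> complex"
  assumes "(b has_vector_derivative b') (at ((norm z)\<^sup>2))"
  shows "d_z j (\<lambda>z. b ((norm z)\<^sup>2)) z = b' * cnj (z $ j)"
proof -
  have "z \<bullet> axis j 1 = Re (z $ j)" "z \<bullet> axis j \<i> = Im (z $ j)"
    by (simp_all add: inner_axis inner_complex_def)
  then show ?thesis
    by (subst d_z_eqI(1)[OF has_derivative_radial[OF assms]]) (simp add: complex_eq_iff field_simps)
qed

lemma d_z_cong:
  assumes "open S" "z \<in> S" "\<And>w. w \<in> S \<Longrightarrow> F w = G w"
  shows "d_z j F z = d_z j G z" "d_zbar j F z = d_zbar j G z"
proof -
  have "(F has_derivative D) (at z) \<longleftrightarrow> (G has_derivative D) (at z)" for D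
    using assms has_derivative_transform_within_open by metis
  then have "frechet_derivative F (at z) = frechet_derivative G (at z)"
    by (simp add: frechet_derivative_def)
  then show "d_z j F z = d_z j G z" "d_zbar j F z = d_zbar j G z"
    by (simp_all add: d_z_def d_zbar_def)
qed

section \<open>Bihomogeneous polynomials\<close>

text \<open>
  The space \<open>P\<^sub>a\<^sub>,\<^sub>b\<close> of bihomogeneous polynomials, generated by multiplication with coordinates instead
  of by coefficients (the two descriptions agree by \<open>P_space_bihom\<close> and \<open>bihom_P_space\<close>): closure
  properties, derivatives and Euler's identities then follow by rule induction.
\<close>

inductive bihom :: "nat \<Rightarrow> nat \<Rightarrow> (complex ^ 'n::finite \<Rightarrow> complex) \<Rightarrow> bool" where
  bihom_zero: "bihom a b (\<lambda>z. 0)"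
| bihom_const: "bihom 0 0 (\<lambda>z. c)"
| bihom_add: "bihom a b M \<Longrightarrow> bihom a b N \<Longrightarrow> bihom a b (\<lambda>z. M z + N z)"
| bihom_coord: "bihom a b M \<Longrightarrow> bihom (Suc a) b (\<lambda>z. z $ l * M z)"
| bihom_cnj_coord: "bihom a b M \<Longrightarrow> bihom a (Suc b) (\<lambda>z. cnj (z $ l) * M z)"

lemma bihom_differentiable: "bihom a b M \<Longrightarrow> M differentiable at z"
  by (induction rule: bihom.induct)
    (auto intro!: differentiable_add differentiable_mult differentiable_const)

lemma bihom_continuous: "bihom a b M \<Longrightarrow> continuous_on S M"
  by (meson bihom_differentiable continuous_at_imp_continuous_on differentiable_imp_continuous_within)

lemma bihom_cmult: "bihom a b M \<Longrightarrow> bihom a b (\<lambda>z. c * M z)"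
proof (induction rule: bihom.induct)
  case (bihom_coord a b M l)
  then show ?case using bihom.bihom_coord[of a b "\<lambda>z. c * M z" l] by (simp add: mult.left_commute)
next
  case (bihom_cnj_coord a b M l)
  then show ?case using bihom.bihom_cnj_coord[of a b "\<lambda>z. c * M z" l] by (simp add: mult.left_commute)
qed (auto simp: distrib_left intro: bihom.intros)

lemma bihom_sum: "(\<And>i. i \<in> A \<Longrightarrow> bihom a b (M i)) \<Longrightarrow> bihom a b (\<lambda>z. \<Sum>i\<in>A. M i z)"
  by (induction A rule: infinite_finite_induct) (auto intro: bihom.intros)

lemma bihom_mult: "bihom a b M \<Longrightarrow> bihom a' b' N \<Longrightarrow> bihom (a + a') (b + b') (\<lambda>z. M z * N z)"
proof (induction rule: bihom.induct)
  case (bihom_const c)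
  then show ?case by (simp add: bihom_cmult)
next
  case (bihom_coord a b M l)
  then show ?case using bihom.bihom_coord[of "a + a'" "b + b'" "\<lambda>z. M z * N z" l] by (simp add: mult.assoc)
next
  case (bihom_cnj_coord a b M l)
  then show ?case using bihom.bihom_cnj_coord[of "a + a'" "b + b'" "\<lambda>z. M z * N z" l] by (simp add: mult.assoc)
qed (auto simp: distrib_right intro: bihom.intros)

lemma bihom_cnj: "bihom a b M \<Longrightarrow> bihom b a (\<lambda>z. cnj (M z))"
  by (induction rule: bihom.induct) (auto intro: bihom.intros)

lemma bihom_scale: "bihom a b M \<Longrightarrow> M (s *\<^sub>R z) = complex_of_real s ^ (a + b) * M z"
  by (induction rule: bihom.induct) (auto simp: algebra_simps scaleR_conv_of_real[where 'a=complex])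

lemma bihom_00: "bihom 0 0 M \<Longrightarrow> M z = M 0"
  using bihom_scale[of 0 0 M 0 z] by simp

lemma d_z_coord_mult:
  assumes "bihom a b M"
  shows "d_z j (\<lambda>z. z $ l * M z) = (\<lambda>z. (if l = j then 1 else 0) * M z + z $ l * d_z j M z)"
  by (rule ext) (simp add: d_z_mult bihom_differentiable[OF assms] d_z_coord)

lemma d_z_cnj_coord_mult:
  assumes "bihom a b M"
  shows "d_z j (\<lambda>z. cnj (z $ l) * M z) = (\<lambda>z. cnj (z $ l) * d_z j M z)"
  by (rule ext) (simp add: d_z_mult bihom_differentiable[OF assms] d_z_cnj_coord)

lemma d_z_bihom_add:
  assumes "bihom a b M" "bihom a' b' N"
  shows "d_z j (\<lambda>z. M z + N z) = (\<lambda>z. d_z j M z + d_z j N z)"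
  by (rule ext) (simp add: d_z_add bihom_differentiable[OF assms(1)] bihom_differentiable[OF assms(2)])

lemma d_z_bihom_mult:
  assumes "bihom a b M" "bihom a' b' N"
  shows "d_z j (\<lambda>z. M z * N z) = (\<lambda>z. d_z j M z * N z + M z * d_z j N z)"
  by (rule ext) (simp add: d_z_mult bihom_differentiable[OF assms(1)] bihom_differentiable[OF assms(2)])

lemma d_z_bihom_cmult:
  assumes "bihom a b M"
  shows "d_z j (\<lambda>z. c * M z) = (\<lambda>z. c * d_z j M z)"
  by (rule ext) (simp add: d_z_cmult bihom_differentiable[OF assms])

lemma d_zbar_bihom: "bihom a b M \<Longrightarrow> d_zbar j M = (\<lambda>z. cnj (d_z j (\<lambda>z. cnj (M z)) z))"
  by (rule ext) (rule d_zbar_cnj, rule bihom_differentiable)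

lemma d_z_cnj_bihom: "bihom a b M \<Longrightarrow> d_z j (\<lambda>z. cnj (M z)) = (\<lambda>z. cnj (d_zbar j M z))"
  by (rule ext) (rule d_z_cnj, rule bihom_differentiable)

lemma d_zbar_cnj_bihom: "bihom a b M \<Longrightarrow> d_zbar j (\<lambda>z. cnj (M z)) = (\<lambda>z. cnj (d_z j M z))"
  using d_zbar_bihom[OF bihom_cnj] by simp

text \<open>
  The truncated difference \<open>a - 1\<close> hides that the derivative vanishes when \<open>a = 0\<close>. Both facts are
  proved together because the second one is used when \<open>z\<^sub>l M\<close> is differentiated with \<open>a = 0\<close>.
\<close>

lemma bihom_d_z_aux:
  "bihom a b M \<Longrightarrow> bihom (a - 1) b (d_z j M) \<and> (a = 0 \<longrightarrow> d_z j M = (\<lambda>z. 0))"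
proof (induction rule: bihom.induct)
  case (bihom_add a b M N)
  then show ?case by (auto simp: d_z_bihom_add[OF bihom_add(1,2)] intro: bihom.intros)
next
  case (bihom_coord a b M l)
  have "bihom a b (\<lambda>z. z $ l * d_z j M z)"
    by (cases a) (use bihom_coord in \<open>auto intro: bihom.intros\<close>)
  then show ?case
    using bihom_coord by (auto simp: d_z_coord_mult[OF bihom_coord(1)] intro!: bihom.bihom_add bihom_cmult)
next
  case (bihom_cnj_coord a b M l)
  then show ?case by (auto simp: d_z_cnj_coord_mult[OF bihom_cnj_coord(1)] intro: bihom.intros)
qed (auto intro: bihom.intros)

lemma bihom_d_z: "bihom a b M \<Longrightarrow> bihom (a - 1) b (d_z j M)"
  and d_z_bihom_0: "bihom 0 b N \<Longrightarrow> d_z j N = (\<lambda>z. 0)"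
  using bihom_d_z_aux by blast+

lemma bihom_d_zbar: "bihom a b M \<Longrightarrow> bihom a (b - 1) (d_zbar j M)"
  using bihom_cnj[OF bihom_d_z[OF bihom_cnj]] by (simp add: d_zbar_bihom)

lemma d_zbar_bihom_0: "bihom a 0 M \<Longrightarrow> d_zbar j M = (\<lambda>z. 0)"
  by (simp add: d_zbar_bihom d_z_bihom_0[OF bihom_cnj])

lemma d_zbar_coord_mult:
  assumes "bihom a b M"
  shows "d_zbar j (\<lambda>z. z $ l * M z) = (\<lambda>z. z $ l * d_zbar j M z)"
  using d_zbar_bihom[OF bihom_coord[OF assms], of j l] d_z_cnj_coord_mult[OF bihom_cnj[OF assms], of j l]
  by (simp add: d_zbar_bihom[OF assms])

lemma d_zbar_cnj_coord_mult:
  assumes "bihom a b M"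
  shows "d_zbar j (\<lambda>z. cnj (z $ l) * M z) = (\<lambda>z. (if l = j then 1 else 0) * M z + cnj (z $ l) * d_zbar j M z)"
  using d_zbar_bihom[OF bihom_cnj_coord[OF assms], of j l] d_z_coord_mult[OF bihom_cnj[OF assms], of j l]
  by (auto simp: d_zbar_bihom[OF assms] fun_eq_iff)

lemma d_zbar_bihom_add:
  assumes "bihom a b M" "bihom a' b' N"
  shows "d_zbar j (\<lambda>z. M z + N z) = (\<lambda>z. d_zbar j M z + d_zbar j N z)"
proof
  fix z
  have "(\<lambda>z. M z + N z) differentiable at z"
    using assms by (intro differentiable_add bihom_differentiable)
  then show "d_zbar j (\<lambda>z. M z + N z) z = d_zbar j M z + d_zbar j N z"
    using assms d_z_bihom_add[OF assms[THEN bihom_cnj], of j]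
    by (simp add: d_zbar_cnj d_zbar_bihom[OF assms(1)] d_zbar_bihom[OF assms(2)])
qed

lemma d_zbar_bihom_cmult:
  assumes "bihom a b M"
  shows "d_zbar j (\<lambda>z. c * M z) = (\<lambda>z. c * d_zbar j M z)"
  using d_zbar_bihom[OF bihom_cmult[OF assms], of j c] d_z_bihom_cmult[OF bihom_cnj[OF assms], of j "cnj c"]
  by (simp add: d_zbar_bihom[OF assms])

lemma d_z_d_zbar_commute:
  "bihom a b M \<Longrightarrow> d_z i (d_zbar j M) = d_zbar j (d_z i M)"
proof (induction rule: bihom.induct)
  case (bihom_add a b M N)
  then show ?case
    by (simp add: d_zbar_bihom_add[OF bihom_add(1,2)] d_z_bihom_add[OF bihom_add(1,2)]
        d_z_bihom_add[OF bihom_d_zbar bihom_d_zbar] d_zbar_bihom_add[OF bihom_d_z bihom_d_z])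
next
  case (bihom_coord a b M l)
  have "d_z i (d_zbar j (\<lambda>z. z $ l * M z))
      = (\<lambda>z. (if l = i then 1 else 0) * d_zbar j M z + z $ l * d_z i (d_zbar j M) z)"
    unfolding d_zbar_coord_mult[OF bihom_coord(1)] d_z_coord_mult[OF bihom_d_zbar[OF bihom_coord(1)]] ..
  moreover have "d_zbar j (d_z i (\<lambda>z. z $ l * M z))
      = (\<lambda>z. (if l = i then 1 else 0) * d_zbar j M z + z $ l * d_zbar j (d_z i M) z)"
    unfolding d_z_coord_mult[OF bihom_coord(1)]
      d_zbar_bihom_add[OF bihom_cmult[OF bihom_coord(1)] bihom.bihom_coord[OF bihom_d_z[OF bihom_coord(1)]]]
      d_zbar_coord_mult[OF bihom_d_z[OF bihom_coord(1)]] d_zbar_bihom_cmult[OF bihom_coord(1)] ..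
  ultimately show ?case using bihom_coord(2) by simp
next
  case (bihom_cnj_coord a b M l)
  have "d_z i (d_zbar j (\<lambda>z. cnj (z $ l) * M z))
      = (\<lambda>z. (if l = j then 1 else 0) * d_z i M z + cnj (z $ l) * d_z i (d_zbar j M) z)"
    unfolding d_zbar_cnj_coord_mult[OF bihom_cnj_coord(1)]
      d_z_bihom_add[OF bihom_cmult[OF bihom_cnj_coord(1)] bihom.bihom_cnj_coord[OF bihom_d_zbar[OF bihom_cnj_coord(1)]]]
      d_z_cnj_coord_mult[OF bihom_d_zbar[OF bihom_cnj_coord(1)]] d_z_bihom_cmult[OF bihom_cnj_coord(1)] ..
  moreover have "d_zbar j (d_z i (\<lambda>z. cnj (z $ l) * M z))
      = (\<lambda>z. (if l = j then 1 else 0) * d_z i M z + cnj (z $ l) * d_zbar j (d_z i M) z)"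
    unfolding d_z_cnj_coord_mult[OF bihom_cnj_coord(1)] d_zbar_cnj_coord_mult[OF bihom_d_z[OF bihom_cnj_coord(1)]] ..
  ultimately show ?case using bihom_cnj_coord(2) by simp
qed (auto simp: d_zbar_bihom[OF bihom.bihom_zero] d_zbar_bihom[OF bihom.bihom_const])

lemma d_z_d_z_commute:
  "bihom a b M \<Longrightarrow> d_z i (d_z j M) = d_z j (d_z i M)"
proof (induction rule: bihom.induct)
  case (bihom_add a b M N)
  then show ?case
    by (simp add: d_z_bihom_add[OF bihom_add(1,2)] d_z_bihom_add[OF bihom_d_z bihom_d_z])
next
  case (bihom_coord a b M l)
  have "d_z i (d_z j (\<lambda>z. z $ l * M z)) = (\<lambda>z. (if l = j then 1 else 0) * d_z i M z
      + ((if l = i then 1 else 0) * d_z j M z + z $ l * d_z i (d_z j M) z))" for i j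
    unfolding d_z_coord_mult[OF bihom_coord(1)]
      d_z_bihom_add[OF bihom_cmult[OF bihom_coord(1)] bihom.bihom_coord[OF bihom_d_z[OF bihom_coord(1)]]]
      d_z_coord_mult[OF bihom_d_z[OF bihom_coord(1)]] d_z_bihom_cmult[OF bihom_coord(1)] by simp
  then show ?case using bihom_coord(2) by (auto simp: fun_eq_iff)
next
  case (bihom_cnj_coord a b M l)
  then show ?case
    by (simp add: d_z_cnj_coord_mult[OF bihom_cnj_coord(1)] d_z_cnj_coord_mult[OF bihom_d_z])
qed auto

lemma bihom_euler: "bihom a b M \<Longrightarrow> (\<Sum>j\<in>UNIV. z $ j * d_z j M z) = of_nat a * M z"
proof (induction rule: bihom.induct)
  case (bihom_add a b M N)
  then show ?case by (simp add: d_z_bihom_add[OF bihom_add(1,2)] sum.distrib distrib_left)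
next
  case (bihom_coord a b M l)
  have "(\<Sum>j\<in>UNIV. z $ j * d_z j (\<lambda>z. z $ l * M z) z)
      = (\<Sum>j\<in>UNIV. (if l = j then z $ j * M z else 0) + z $ l * (z $ j * d_z j M z))"
    unfolding d_z_coord_mult[OF bihom_coord(1)] by (intro sum.cong) (auto simp: algebra_simps)
  also have "\<dots> = z $ l * M z + z $ l * (of_nat a * M z)"
    by (simp add: sum.distrib bihom_coord(2)[symmetric] sum_distrib_left)
  finally show ?case by (simp add: algebra_simps)
next
  case (bihom_cnj_coord a b M l)
  have "(\<Sum>j\<in>UNIV. z $ j * d_z j (\<lambda>z. cnj (z $ l) * M z) z)
      = (\<Sum>j\<in>UNIV. cnj (z $ l) * (z $ j * d_z j M z))"
    unfolding d_z_cnj_coord_mult[OF bihom_cnj_coord(1)] by (intro sum.cong) (auto simp: algebra_simps)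
  also have "\<dots> = cnj (z $ l) * (of_nat a * M z)"
    by (simp add: bihom_cnj_coord(2)[symmetric] sum_distrib_left)
  finally show ?case by (simp add: algebra_simps)
qed auto

lemma bihom_euler_cnj: "bihom a b M \<Longrightarrow> (\<Sum>j\<in>UNIV. cnj (z $ j) * d_zbar j M z) = of_nat b * M z"
  using arg_cong[OF bihom_euler[OF bihom_cnj, of a b M z], of cnj]
  by (simp add: d_zbar_bihom)

lemma d_zbar_bihom_mult:
  assumes "bihom a b M" "bihom a' b' N"
  shows "d_zbar j (\<lambda>z. M z * N z) = (\<lambda>z. d_zbar j M z * N z + M z * d_zbar j N z)"
  using d_z_bihom_mult[OF assms[THEN bihom_cnj], of j] d_zbar_bihom[OF bihom_mult[OF assms], of j]
  by (simp add: d_zbar_bihom[OF assms(1)] d_zbar_bihom[OF assms(2)])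

section \<open>Green's identity on the sphere\<close>

lemma sphere_mean_bihom_add:
  "bihom a b M \<Longrightarrow> bihom a' b' N \<Longrightarrow> sphere_mean (\<lambda>w. M w + N w) = sphere_mean M + sphere_mean N"
  by (intro sphere_mean_add bihom_continuous)

lemma sphere_mean_bihom_sum:
  "finite A \<Longrightarrow> (\<And>i. i \<in> A \<Longrightarrow> bihom a b (M i)) \<Longrightarrow>
     sphere_mean (\<lambda>w. \<Sum>i\<in>A. M i w) = (\<Sum>i\<in>A. sphere_mean (M i))"
  by (intro sphere_mean_sum) (auto intro: bihom_continuous)

text \<open>
  The infinitesimal rotations in the plane of two complex coordinates, and for \<open>i = k\<close> and \<open>u = \<i>\<close> the
  generator of the circle action on one coordinate.
\<close>

definition rot_gen :: "'n::finite \<Rightarrow> 'n \<Rightarrow> complex \<Rightarrow> complex ^ 'n \<Rightarrow> complex ^ 'n" where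
  "rot_gen i k u w = (\<chi> l. if l = k then u * w $ i else if l = i then - cnj u * w $ k else 0)"

lemma rot_gen_linear: "linear (rot_gen i k u)"
  by (rule linearI) (auto simp: rot_gen_def vec_eq_iff algebra_simps scaleR_conv_of_real[where 'a=complex])

lemma inner_vec_two:
  fixes x y :: "complex ^ 'n::finite"
  assumes "\<And>l. l \<noteq> i \<Longrightarrow> l \<noteq> k \<Longrightarrow> x $ l = 0 \<or> y $ l = 0" "i \<noteq> k"
  shows "x \<bullet> y = x $ i \<bullet> y $ i + x $ k \<bullet> y $ k"
proof -
  have "x \<bullet> y = (\<Sum>l\<in>{i,k}. x $ l \<bullet> y $ l)"
    unfolding inner_vec_def
  proof (rule sum.mono_neutral_right)
    show "\<forall>l\<in>UNIV - {i, k}. x $ l \<bullet> y $ l = 0"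
      using assms(1) by (metis DiffD2 inner_zero_left inner_zero_right insertCI)
  qed auto
  then show ?thesis using assms(2) by simp
qed

lemma rot_gen_skew:
  assumes "i \<noteq> k \<or> cnj u = - u"
  shows "rot_gen i k u x \<bullet> y = - (x \<bullet> rot_gen i k u y)"
proof (cases "i = k")
  case True
  have "rot_gen i k u x \<bullet> y = (\<Sum>l\<in>{k}. rot_gen i k u x $ l \<bullet> y $ l)"
    unfolding inner_vec_def using True by (intro sum.mono_neutral_right) (auto simp: rot_gen_def)
  moreover have "x \<bullet> rot_gen i k u y = (\<Sum>l\<in>{k}. x $ l \<bullet> rot_gen i k u y $ l)"
    unfolding inner_vec_def using True by (intro sum.mono_neutral_right) (auto simp: rot_gen_def)
  ultimately show ?thesis using True assms
    by (auto simp: rot_gen_def inner_complex_def complex_eq_iff algebra_simps)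
next
  case False
  have "rot_gen i k u x \<bullet> y = rot_gen i k u x $ i \<bullet> y $ i + rot_gen i k u x $ k \<bullet> y $ k"
    using False by (intro inner_vec_two) (auto simp: rot_gen_def)
  moreover have "x \<bullet> rot_gen i k u y = x $ i \<bullet> rot_gen i k u y $ i + x $ k \<bullet> rot_gen i k u y $ k"
    using False by (intro inner_vec_two) (auto simp: rot_gen_def)
  ultimately show ?thesis using False
    by (auto simp: rot_gen_def inner_complex_def algebra_simps)
qed

lemma rot_gen_cube:
  assumes "i \<noteq> k \<or> cnj u = - u" "u * cnj u = 1"
  shows "rot_gen i k u (rot_gen i k u (rot_gen i k u w)) = - rot_gen i k u w"
proof (cases "i = k")
  case True
  then have "u * - u = 1" using assms by simp
  then have "u * u = -1" by (simp add: minus_equation_iff)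
  then have "u * (u * c) = - c" for c by (simp flip: mult.assoc)
  then show ?thesis using True by (auto simp: rot_gen_def vec_eq_iff)
next
  case False
  have "u * (cnj u * c) = c" "cnj u * (u * c) = c" for c
    using assms(2) by (simp_all add: mult.commute[of "cnj u"] flip: mult.assoc)
  then show ?thesis using False by (auto simp: rot_gen_def vec_eq_iff)
qed

lemma sphere_mean_rot_gen:
  assumes "bihom a b M" and u: "i \<noteq> k \<or> cnj u = - u" "u * cnj u = 1"
  shows "sphere_mean (\<lambda>w. \<Sum>j\<in>UNIV. d_z j M w * rot_gen i k u w $ j + d_zbar j M w * cnj (rot_gen i k u w $ j)) = 0"
proof -
  have diff: "M differentiable at z" for z using assms(1) by (rule bihom_differentiable)
  have "continuous_on UNIV (\<lambda>w. \<Sum>j\<in>UNIV. d_z j M w * rot_gen i k u w $ j + d_zbar j M w * cnj (rot_gen i k u w $ j))"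
    using assms(1) by (intro continuous_intros bihom_continuous[OF bihom_d_z] bihom_continuous[OF bihom_d_zbar]
        linear_continuous_on linear_conv_bounded_linear[THEN iffD1] rot_gen_linear)
  then have "sphere_mean (\<lambda>w. frechet_derivative M (at w) (rot_gen i k u w)) = 0"
    using diff by (intro sphere_mean_rotation_derivative[where G=M and G'="\<lambda>x. frechet_derivative M (at x)", OF rot_gen_linear rot_gen_skew rot_gen_cube] u differentiable_frechet)
      (simp_all add: frechet_derivative_wirtinger)
  then show ?thesis using diff by (simp add: frechet_derivative_wirtinger)
qed

text \<open>
  The generators \<open>rot_gen i k u\<close> with \<open>u = 1\<close> and \<open>u = \<i>\<close> combine to the complex vector field
  \<open>z\<^sub>i \<partial>\<^sub>k - cnj z\<^sub>k \<partial>bar\<^sub>i\<close>, so the derivative of a polynomial along it has mean zero.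
\<close>

lemma sphere_mean_rotation:
  assumes M: "bihom a b (M :: complex ^ 'n::finite \<Rightarrow> complex)"
  shows "sphere_mean (\<lambda>w. w $ i * d_z k M w) = sphere_mean (\<lambda>w. cnj (w $ k) * d_zbar i M w)"
proof -
  define X where "X = (\<lambda>i k. sphere_mean (\<lambda>w. w $ i * d_z k M w))"
  define Y where "Y = (\<lambda>i k. sphere_mean (\<lambda>w. cnj (w $ i) * d_zbar k M w))"
  have c1: "bihom (Suc (a - 1)) b (\<lambda>w. c * (w $ i * d_z k M w))" for i k c
    by (intro bihom_cmult bihom_coord bihom_d_z M)
  have c2: "bihom a (Suc (b - 1)) (\<lambda>w. c * (cnj (w $ i) * d_zbar k M w))" for i k c
    by (intro bihom_cmult bihom_cnj_coord bihom_d_zbar M)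
  note cont = bihom_continuous[OF c1] bihom_continuous[OF c2]
  show ?thesis
  proof (cases "i = k")
    case True
    have "(\<Sum>j\<in>UNIV. d_z j M w * rot_gen i k \<i> w $ j + d_zbar j M w * cnj (rot_gen i k \<i> w $ j))
        = (\<Sum>j\<in>UNIV. if j = k then \<i> * (w $ i * d_z k M w) + (-\<i>) * (cnj (w $ i) * d_zbar k M w) else 0)" for w
      using True by (intro sum.cong) (auto simp: rot_gen_def algebra_simps)
    then have "sphere_mean (\<lambda>w. \<i> * (w $ i * d_z k M w) + (-\<i>) * (cnj (w $ i) * d_zbar k M w)) = 0"
      using sphere_mean_rot_gen[OF M, of i k \<i>] by simp
    then have "\<i> * X i k + (-\<i>) * Y i k = 0"
      unfolding X_def Y_def by (subst (asm) sphere_mean_add[OF cont]) (simp only: sphere_mean_cmult)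
    then show ?thesis using True by (simp add: X_def Y_def)
  next
    case False
    have *: "u * X i k + (- cnj u) * X k i + (cnj u * Y i k + (- u) * Y k i) = 0" if "u * cnj u = 1" for u
    proof -
      have "(\<Sum>j\<in>UNIV. d_z j M w * rot_gen i k u w $ j + d_zbar j M w * cnj (rot_gen i k u w $ j))
        = (u * (w $ i * d_z k M w) + (- cnj u) * (w $ k * d_z i M w))
            + (cnj u * (cnj (w $ i) * d_zbar k M w) + (- u) * (cnj (w $ k) * d_zbar i M w))" for w
      proof -
        have "(\<Sum>j\<in>UNIV. d_z j M w * rot_gen i k u w $ j + d_zbar j M w * cnj (rot_gen i k u w $ j))
          = (\<Sum>j\<in>UNIV. (if j = k then u * (w $ i * d_z k M w) + cnj u * (cnj (w $ i) * d_zbar k M w) else 0)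
            + (if j = i then (- cnj u) * (w $ k * d_z i M w) + (- u) * (cnj (w $ k) * d_zbar i M w) else 0))"
          using False by (intro sum.cong) (auto simp: rot_gen_def algebra_simps)
        then show ?thesis by (simp add: sum.distrib)
      qed
      then have "sphere_mean (\<lambda>w. (u * (w $ i * d_z k M w) + (- cnj u) * (w $ k * d_z i M w))
            + (cnj u * (cnj (w $ i) * d_zbar k M w) + (- u) * (cnj (w $ k) * d_zbar i M w))) = 0"
        using sphere_mean_rot_gen[OF M _ that, of i k] False by presburger
      then show ?thesis
        unfolding X_def Y_def
        by (subst (asm) sphere_mean_add[OF continuous_on_add[OF cont(1,1)] continuous_on_add[OF cont(2,2)]],
            subst (asm) sphere_mean_add[OF cont(1,1)], subst (asm) sphere_mean_add[OF cont(2,2)])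
          (simp only: sphere_mean_cmult)
    qed
    have A: "X i k - X k i + (Y i k - Y k i) = 0" using *[of 1] by simp
    have "\<i> * (X i k + X k i - Y i k - Y k i) = 0" using *[of \<i>] by (simp add: algebra_simps)
    then have B: "X i k + X k i - Y i k - Y k i = 0" by simp
    have "2 * X i k - 2 * Y k i = (X i k - X k i + (Y i k - Y k i)) + (X i k + X k i - Y i k - Y k i)"
      by simp
    then have "2 * X i k = 2 * Y k i" unfolding A B by simp
    then show ?thesis by (simp add: X_def Y_def)
  qed
qed

text \<open>
  Invariance under the circle action \<open>w \<mapsto> exp (i s) w\<close>, in infinitesimal form: the case \<open>i = k\<close> of the
  previous lemma, summed over \<open>k\<close> with Euler's identities.
\<close>

lemma sphere_mean_unbalanced:
  assumes M: "bihom a b M" and "a \<noteq> b"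
  shows "sphere_mean M = 0"
proof -
  have "of_nat a * sphere_mean M = sphere_mean (\<lambda>w. \<Sum>k\<in>UNIV. w $ k * d_z k M w)"
    by (simp add: bihom_euler[OF M] sphere_mean_cmult)
  also have "\<dots> = (\<Sum>k\<in>UNIV. sphere_mean (\<lambda>w. w $ k * d_z k M w))"
    by (rule sphere_mean_bihom_sum[OF finite bihom_coord[OF bihom_d_z[OF M]]])
  also have "\<dots> = (\<Sum>k\<in>UNIV. sphere_mean (\<lambda>w. cnj (w $ k) * d_zbar k M w))"
    by (simp add: sphere_mean_rotation[OF M])
  also have "\<dots> = sphere_mean (\<lambda>w. \<Sum>k\<in>UNIV. cnj (w $ k) * d_zbar k M w)"
    by (rule sphere_mean_bihom_sum[OF finite bihom_cnj_coord[OF bihom_d_zbar[OF M]], symmetric])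
  also have "\<dots> = of_nat b * sphere_mean M"
    by (simp add: bihom_euler_cnj[OF M] sphere_mean_cmult)
  finally show ?thesis using assms(2) by simp
qed

lemma sum_coord_cnj: "(\<Sum>i\<in>UNIV. w $ i * cnj (w $ i)) = complex_of_real ((norm (w :: complex ^ 'n::finite))\<^sup>2)"
  unfolding power2_norm_eq_inner inner_vec_def
  by (simp add: complex_mult_cnj inner_complex_def power2_eq_square)

text \<open>
  The divergence theorem on the sphere. It results from the rotation identity for \<open>cnj z\<^sub>i M\<close>, summed over
  \<open>i\<close>: on one side \<open>|w| = 1\<close> restores the derivative of \<open>M\<close>, on the other side Euler's identity
  produces the factor.
\<close>

lemma sphere_mean_green:
  assumes M: "bihom a b (M :: complex ^ 'n::finite \<Rightarrow> complex)"
  shows "sphere_mean (d_z k M) = of_nat (CARD('n) + b) * sphere_mean (\<lambda>w. cnj (w $ k) * M w)"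
proof -
  have "sphere_mean (d_z k M) = sphere_mean (\<lambda>w. (\<Sum>i\<in>UNIV. w $ i * cnj (w $ i)) * d_z k M w)"
    unfolding sum_coord_cnj by (intro sphere_mean_cong) simp
  also have "\<dots> = sphere_mean (\<lambda>w. \<Sum>i\<in>UNIV. w $ i * d_z k (\<lambda>w. cnj (w $ i) * M w) w)"
    by (simp add: d_z_cnj_coord_mult[OF M] sum_distrib_right mult.assoc)
  also have "\<dots> = (\<Sum>i\<in>UNIV. sphere_mean (\<lambda>w. w $ i * d_z k (\<lambda>w. cnj (w $ i) * M w) w))"
    by (rule sphere_mean_bihom_sum[OF finite bihom_coord[OF bihom_d_z[OF bihom_cnj_coord[OF M]]]])
  also have "\<dots> = (\<Sum>i\<in>UNIV. sphere_mean (\<lambda>w. cnj (w $ k) * d_zbar i (\<lambda>w. cnj (w $ i) * M w) w))"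
    by (simp add: sphere_mean_rotation[OF bihom_cnj_coord[OF M]])
  also have "\<dots> = sphere_mean (\<lambda>w. \<Sum>i\<in>UNIV. cnj (w $ k) * d_zbar i (\<lambda>w. cnj (w $ i) * M w) w)"
    by (rule sphere_mean_bihom_sum[OF finite bihom_cnj_coord[OF bihom_d_zbar[OF bihom_cnj_coord[OF M]]], symmetric])
  also have "\<dots> = sphere_mean (\<lambda>w. of_nat (CARD('n) + b) * (cnj (w $ k) * M w))"
  proof (rule sphere_mean_cong)
    fix w :: "complex ^ 'n"
    have "(\<Sum>i\<in>UNIV. cnj (w $ k) * d_zbar i (\<lambda>w. cnj (w $ i) * M w) w)
      = cnj (w $ k) * ((\<Sum>i\<in>(UNIV::'n set). M w) + (\<Sum>i\<in>UNIV. cnj (w $ i) * d_zbar i M w))"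
      by (simp add: d_zbar_cnj_coord_mult[OF M] sum_distrib_left sum.distrib distrib_left)
    then show "(\<Sum>i\<in>UNIV. cnj (w $ k) * d_zbar i (\<lambda>w. cnj (w $ i) * M w) w)
        = of_nat (CARD('n) + b) * (cnj (w $ k) * M w)"
      by (simp add: bihom_euler_cnj[OF M] algebra_simps)
  qed
  finally show ?thesis by (simp only: sphere_mean_cmult)
qed

lemma sphere_mean_green_cnj:
  assumes M: "bihom a b (M :: complex ^ 'n::finite \<Rightarrow> complex)"
  shows "sphere_mean (d_zbar k M) = of_nat (CARD('n) + a) * sphere_mean (\<lambda>w. w $ k * M w)"
proof -
  have "sphere_mean (\<lambda>w. cnj (w $ k) * cnj (M w)) = cnj (sphere_mean (\<lambda>w. w $ k * M w))"
    by (simp only: sphere_mean_cnj[symmetric] complex_cnj_mult)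
  then show ?thesis
    using arg_cong[OF sphere_mean_green[OF bihom_cnj[OF M], of k], of cnj]
    by (simp add: d_z_cnj_bihom[OF M] sphere_mean_cnj)
qed

section \<open>Harmonic polynomials\<close>

text \<open>
  Up to the factor \<open>4\<close> the sum is the Laplacian, see \<open>laplacian_bihom\<close>.
\<close>

definition harmonic :: "nat \<Rightarrow> nat \<Rightarrow> (complex ^ 'n::finite \<Rightarrow> complex) \<Rightarrow> bool" where
  "harmonic p q P \<longleftrightarrow> bihom p q P \<and> (\<forall>z. (\<Sum>j\<in>UNIV. d_z j (d_zbar j P) z) = 0)"

lemma harmonic_bihom: "harmonic p q P \<Longrightarrow> bihom p q P"
  by (simp add: harmonic_def)

lemma harmonic_cnj:
  assumes "harmonic p q P" shows "harmonic q p (\<lambda>z. cnj (P z))"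
proof -
  have b: "bihom p q P" using assms by (rule harmonic_bihom)
  have "d_z j (d_zbar j (\<lambda>z. cnj (P z))) = (\<lambda>z. cnj (d_z j (d_zbar j P) z))" for j
    by (simp add: d_zbar_cnj_bihom[OF b] d_z_cnj_bihom[OF bihom_d_z[OF b]] d_z_d_zbar_commute[OF b])
  then show ?thesis
    using assms b by (simp add: harmonic_def bihom_cnj flip: cnj_sum)
qed

lemma d_z_bihom_sum:
  assumes "finite A" "\<And>i. i \<in> A \<Longrightarrow> bihom a b (M i)"
  shows "d_z j (\<lambda>z. \<Sum>i\<in>A. M i z) = (\<lambda>z. \<Sum>i\<in>A. d_z j (M i) z)"
  using assms
proof (induction A rule: finite_induct)
  case (insert x A)
  then show ?case using d_z_bihom_add[of a b "M x" a b "\<lambda>z. \<Sum>i\<in>A. M i z" j]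
    by (simp add: bihom_sum)
qed simp

lemma harmonic_d_z:
  assumes "harmonic p q P" shows "harmonic (p - 1) q (d_z k P)"
proof -
  have b: "bihom p q P" using assms by (rule harmonic_bihom)
  have eq: "(\<Sum>j\<in>UNIV. d_z j (d_zbar j (d_z k P)) z) = d_z k (\<lambda>z. \<Sum>j\<in>UNIV. d_z j (d_zbar j P) z) z" for z
  proof -
    have "d_z j (d_zbar j (d_z k P)) = d_z k (d_z j (d_zbar j P))" for j
      by (simp add: d_z_d_zbar_commute[OF b, symmetric] d_z_d_z_commute[OF bihom_d_zbar[OF b], of j k])
    then show ?thesis
      by (simp add: d_z_bihom_sum[OF _ bihom_d_z[OF bihom_d_zbar[OF b]]])
  qed
  have "(\<lambda>z. \<Sum>j\<in>UNIV. d_z j (d_zbar j P) z) = (\<lambda>z. 0)"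
    using assms by (simp add: harmonic_def)
  with eq have "(\<Sum>j\<in>UNIV. d_z j (d_zbar j (d_z k P)) z) = 0" for z by simp
  then show ?thesis using bihom_d_z[OF b, of k] by (simp add: harmonic_def)
qed

lemma harmonic_d_zbar:
  assumes "harmonic p q P" shows "harmonic p (q - 1) (d_zbar k P)"
  using harmonic_cnj[OF harmonic_d_z[OF harmonic_cnj[OF assms], of k]]
  by (simp add: d_z_cnj_bihom[OF harmonic_bihom[OF assms]])

lemma harmonic_holomorphic: "bihom p 0 P \<Longrightarrow> harmonic p 0 P"
  by (simp add: harmonic_def d_zbar_bihom_0)

lemma harmonic_antiholomorphic: "bihom 0 q P \<Longrightarrow> harmonic 0 q P"
  by (simp add: harmonic_def d_z_bihom_0[OF bihom_d_zbar])

text \<open>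
  By Euler's identity \<open>q P\<close> is the sum of the \<open>cnj z\<^sub>k \<partial>bar\<^sub>k P\<close>, whose means are by Green's identity
  proportional to those of \<open>\<partial>\<^sub>k \<partial>bar\<^sub>k P\<close>; these add up to the Laplacian of \<open>P\<close>.
\<close>

lemma sphere_mean_harmonic:
  assumes P: "harmonic p q P" and "0 < p + q"
  shows "sphere_mean P = 0"
proof (cases "p = q")
  case True
  have b: "bihom p q P" using P by (rule harmonic_bihom)
  have q: "q > 0" using True assms(2) by simp
  have "of_nat q * sphere_mean P = sphere_mean (\<lambda>w. \<Sum>k\<in>UNIV. cnj (w $ k) * d_zbar k P w)"
    by (simp add: bihom_euler_cnj[OF b] sphere_mean_cmult)
  also have "\<dots> = (\<Sum>k\<in>UNIV. sphere_mean (\<lambda>w. cnj (w $ k) * d_zbar k P w))"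
    by (rule sphere_mean_bihom_sum[OF finite bihom_cnj_coord[OF bihom_d_zbar[OF b]]])
  finally have "of_nat (CARD('a) + (q - 1)) * (of_nat q * sphere_mean P)
      = (\<Sum>k\<in>UNIV. sphere_mean (d_z k (d_zbar k P)))"
    by (simp add: sphere_mean_green[OF bihom_d_zbar[OF b]] sum_distrib_left)
  also have "\<dots> = sphere_mean (\<lambda>w. \<Sum>k\<in>UNIV. d_z k (d_zbar k P) w)"
    by (rule sphere_mean_bihom_sum[OF finite bihom_d_z[OF bihom_d_zbar[OF b]], symmetric])
  also have "\<dots> = 0" using P by (simp add: harmonic_def set_lebesgue_integral_def)
  finally have "of_nat (CARD('a) + (q - 1)) * (of_nat q * sphere_mean P) = 0" .
  moreover have "CARD('a) + (q - 1) \<noteq> 0" by simp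
  ultimately show ?thesis using q by (simp del: of_nat_add)
qed (use sphere_mean_unbalanced[OF harmonic_bihom[OF P]] in auto)

text \<open>
  Splitting a coordinate off \<open>H\<close>, Green's identity makes a derivative act either on \<open>P\<close>, which stays
  harmonic and loses one degree, or on the rest of \<open>H\<close>. In both cases the second factor has smaller
  degree than \<open>H\<close>, and its degree is still below that of the first factor.
\<close>

lemma sphere_mean_harmonic_lower:
  assumes "harmonic p q P" "bihom s k H" "s + k < p + q"
  shows "sphere_mean (\<lambda>w. P w * H w) = 0"
  using assms
proof (induction "s + k" arbitrary: p q P s k H rule: less_induct)
  case less
  note IH = less.hyps
  have P: "harmonic p q P" and lt: "s + k < p + q" using less.prems by auto
  have bP: "bihom p q P" using P by (rule harmonic_bihom)
  have "sphere_mean (\<lambda>w. P w * N w) = 0" if "bihom a b N" "a + b = s + k" for a b N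
    using that
  proof (induction rule: bihom.induct)
    case (bihom_zero a b)
    then show ?case by (simp add: set_lebesgue_integral_def)
  next
    case (bihom_const c)
    then show ?case using sphere_mean_harmonic[OF P] lt by (simp add: mult.commute[of _ c] sphere_mean_cmult)
  next
    case (bihom_add a b M N)
    then show ?case
      using sphere_mean_bihom_add[OF bihom_mult[OF bP bihom_add(1)] bihom_mult[OF bP bihom_add(2)]]
      by (simp add: distrib_left)
  next
    case (bihom_coord a b M l)
    have m: "bihom (p + a) (q + b) (\<lambda>w. P w * M w)" by (rule bihom_mult[OF bP bihom_coord(1)])
    have "sphere_mean (\<lambda>w. d_zbar l P w * M w) = 0"
    proof (cases "q = 0")
      case True
      then show ?thesis using bP by (simp add: d_zbar_bihom_0 set_lebesgue_integral_def)
    next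
      case False
      then show ?thesis using bihom_coord lt by (intro IH[OF _ harmonic_d_zbar[OF P]]) auto
    qed
    moreover have "sphere_mean (\<lambda>w. P w * d_zbar l M w) = 0"
      using bihom_coord lt by (intro IH[OF _ P bihom_d_zbar[OF bihom_coord(1)]]) auto
    ultimately have "sphere_mean (d_zbar l (\<lambda>w. P w * M w)) = 0"
      using sphere_mean_bihom_add[OF bihom_mult[OF bihom_d_zbar[OF bP] bihom_coord(1)]
          bihom_mult[OF bP bihom_d_zbar[OF bihom_coord(1)]]]
      by (simp add: d_zbar_bihom_mult[OF bP bihom_coord(1)])
    then have "sphere_mean (\<lambda>w. w $ l * (P w * M w)) = 0"
      using sphere_mean_green_cnj[OF m, of l] by (simp del: of_nat_add)
    then show ?case by (simp add: mult.left_commute)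
  next
    case (bihom_cnj_coord a b M l)
    have m: "bihom (p + a) (q + b) (\<lambda>w. P w * M w)" by (rule bihom_mult[OF bP bihom_cnj_coord(1)])
    have "sphere_mean (\<lambda>w. d_z l P w * M w) = 0"
    proof (cases "p = 0")
      case True
      then show ?thesis using bP by (simp add: d_z_bihom_0 set_lebesgue_integral_def)
    next
      case False
      then show ?thesis using bihom_cnj_coord lt by (intro IH[OF _ harmonic_d_z[OF P]]) auto
    qed
    moreover have "sphere_mean (\<lambda>w. P w * d_z l M w) = 0"
      using bihom_cnj_coord lt by (intro IH[OF _ P bihom_d_z[OF bihom_cnj_coord(1)]]) auto
    ultimately have "sphere_mean (d_z l (\<lambda>w. P w * M w)) = 0"
      using sphere_mean_bihom_add[OF bihom_mult[OF bihom_d_z[OF bP] bihom_cnj_coord(1)]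
          bihom_mult[OF bP bihom_d_z[OF bihom_cnj_coord(1)]]]
      by (simp add: d_z_bihom_mult[OF bP bihom_cnj_coord(1)])
    then have "sphere_mean (\<lambda>w. cnj (w $ l) * (P w * M w)) = 0"
      using sphere_mean_green[OF m, of l] by (simp del: of_nat_add)
    then show ?case by (simp add: mult.left_commute)
  qed
  then show ?case using less.prems(2) by blast
qed

section \<open>Leading coefficients\<close>

lemma sphere_mean_zero [simp]: "sphere_mean (\<lambda>w. 0) = 0"
  by (simp add: set_lebesgue_integral_def)

text \<open>
  In the mean over the sphere, multiplication by \<open>cnj z\<^sub>j\<close> is up to a positive factor adjoint to \<open>\<partial>\<^sub>j\<close> acting
  on \<open>P\<close>: the other term of Green's identity pairs \<open>P\<close> with a polynomial of lower degree.
\<close>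

lemma sphere_mean_green_harmonic:
  assumes P: "harmonic p q (P :: complex ^ 'n::finite \<Rightarrow> complex)" and X: "bihom s k X" and "s + k \<le> p + q"
  shows "of_nat (CARD('n) + (q + k)) * sphere_mean (\<lambda>w. P w * (cnj (w $ j) * X w))
    = sphere_mean (\<lambda>w. d_z j P w * X w)"
proof -
  have b: "bihom p q P" using P by (rule harmonic_bihom)
  have "sphere_mean (\<lambda>w. P w * d_z j X w) = 0"
  proof (cases "s = 0")
    case True
    then show ?thesis using X by (simp add: d_z_bihom_0)
  next
    case False
    then show ?thesis using assms(3) by (intro sphere_mean_harmonic_lower[OF P bihom_d_z[OF X]]) simp
  qed
  then have "sphere_mean (d_z j (\<lambda>w. P w * X w)) = sphere_mean (\<lambda>w. d_z j P w * X w)"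
    using sphere_mean_bihom_add[OF bihom_mult[OF bihom_d_z[OF b] X] bihom_mult[OF b bihom_d_z[OF X]]]
    by (simp add: d_z_bihom_mult[OF b X])
  then show ?thesis
    using sphere_mean_green[OF bihom_mult[OF b X], of j] by (simp add: mult.left_commute del: of_nat_add)
qed

text \<open>
  Monomials are indexed by words, since products of operators along a word produce them factor by
  factor.
\<close>

abbreviation wmon :: "'n::finite list \<Rightarrow> complex ^ 'n \<Rightarrow> complex" where
  "wmon w z \<equiv> prod_list (map (\<lambda>j. z $ j) w)"

abbreviation wmon_cnj :: "'n::finite list \<Rightarrow> complex ^ 'n \<Rightarrow> complex" where
  "wmon_cnj w z \<equiv> prod_list (map (\<lambda>j. cnj (z $ j)) w)"

lemma bihom_wmon: "bihom (length w) 0 (wmon w)"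
  by (induction w) (auto intro: bihom.intros)

lemma bihom_wmon_cnj: "bihom 0 (length w) (wmon_cnj w)"
  by (induction w) (auto intro: bihom.intros)

lemma cnj_wmon: "cnj (wmon w z) = wmon_cnj w z"
  by (induction w) auto

lemma cnj_wmon_cnj: "cnj (wmon_cnj w z) = wmon w z"
  by (simp flip: cnj_wmon)

lemma harmonic_fold_d_z: "harmonic p q P \<Longrightarrow> harmonic (p - length w) q (fold d_z w P)"
proof (induction w arbitrary: p P)
  case (Cons j w)
  then show ?case using Cons.IH[OF harmonic_d_z[OF Cons.prems]] by simp
qed simp

lemma fold_d_z_cnj:
  "bihom a b P \<Longrightarrow> fold d_z w (\<lambda>z. cnj (P z)) = (\<lambda>z. cnj (fold d_zbar w P z))"
proof (induction w arbitrary: b P)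
  case (Cons j w)
  then show ?case using Cons.IH[OF bihom_d_zbar[OF Cons.prems]] by (simp add: d_z_cnj_bihom)
qed simp

lemma sphere_mean_wmon_cnj:
  assumes "harmonic (length w) q (P :: complex ^ 'n::finite \<Rightarrow> complex)" "bihom q 0 X"
  shows "\<exists>K>0. sphere_mean (\<lambda>z. P z * (wmon_cnj w z * X z)) = complex_of_real K * sphere_mean (\<lambda>z. fold d_z w P z * X z)"
  using assms
proof (induction w arbitrary: P)
  case Nil
  then show ?case by (intro exI[of _ 1]) simp
next
  case (Cons j w)
  have "harmonic (length w) q (d_z j P)" using harmonic_d_z[OF Cons.prems(1), of j] by simp
  from Cons.IH[OF this Cons.prems(2)] obtain K where K: "K > 0"
    "sphere_mean (\<lambda>z. d_z j P z * (wmon_cnj w z * X z)) = complex_of_real K * sphere_mean (\<lambda>z. fold d_z w (d_z j P) z * X z)"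
    by blast
  define N where "N = CARD('n) + (q + length w)"
  have N: "N > 0" by (simp add: N_def)
  have b: "bihom q (length w) (\<lambda>z. wmon_cnj w z * X z)"
    using bihom_mult[OF bihom_wmon_cnj Cons.prems(2), of w] by simp
  have "of_nat N * sphere_mean (\<lambda>z. P z * (cnj (z $ j) * (wmon_cnj w z * X z)))
    = sphere_mean (\<lambda>z. d_z j P z * (wmon_cnj w z * X z))"
    unfolding N_def by (rule sphere_mean_green_harmonic[OF Cons.prems(1) b]) simp
  then have "of_nat N * sphere_mean (\<lambda>z. P z * (cnj (z $ j) * (wmon_cnj w z * X z)))
      = complex_of_real K * sphere_mean (\<lambda>z. fold d_z w (d_z j P) z * X z)"
    by (simp only: K(2))
  moreover have "x = complex_of_real (K / N) * y" if "of_nat N * x = complex_of_real K * y" for x y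
    using that N by (simp add: field_simps)
  ultimately have "sphere_mean (\<lambda>z. P z * (cnj (z $ j) * (wmon_cnj w z * X z)))
      = complex_of_real (K / N) * sphere_mean (\<lambda>z. fold d_z w (d_z j P) z * X z)"
    by blast
  then show ?case using K(1) N by (intro exI[of _ "K / N"]) (simp add: mult.assoc)
qed

lemma sphere_mean_bihom_00: "bihom 0 0 M \<Longrightarrow> sphere_mean M = M 0"
  using sphere_mean_const[of 1 "M 0"] sphere_mean_cong[of M "\<lambda>_. M 0"] bihom_00 by force

text \<open>
  All coordinates of the monomial are moved to \<open>P\<close>, where they act as derivatives; since the degrees
  match, a constant remains.
\<close>

lemma sphere_mean_wmon:
  assumes P: "harmonic (length w1) (length w2) P"
  shows "\<exists>K>0. sphere_mean (\<lambda>z. P z * (wmon_cnj w1 z * wmon w2 z))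
    = complex_of_real K * fold d_zbar w2 (fold d_z w1 P) 0"
proof -
  define Q where "Q = fold d_z w1 P"
  have Q: "harmonic 0 (length w2) Q" using harmonic_fold_d_z[OF P, of w1] by (simp add: Q_def)
  obtain K where K: "K > 0" "sphere_mean (\<lambda>z. P z * (wmon_cnj w1 z * wmon w2 z))
      = complex_of_real K * sphere_mean (\<lambda>z. Q z * wmon w2 z)"
    using sphere_mean_wmon_cnj[OF P bihom_wmon] unfolding Q_def by blast
  have Q': "harmonic (length w2) 0 (\<lambda>z. cnj (Q z))" by (rule harmonic_cnj[OF Q])
  have eq: "fold d_z w2 (\<lambda>z. cnj (Q z)) = (\<lambda>z. cnj (fold d_zbar w2 Q z))"
    by (rule fold_d_z_cnj[OF harmonic_bihom[OF Q]])
  have "bihom 0 0 (fold d_z w2 (\<lambda>z. cnj (Q z)))"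
    using harmonic_bihom[OF harmonic_fold_d_z[OF Q', of w2]] by simp
  from sphere_mean_bihom_00[OF this] obtain K' where K': "K' > 0"
    "sphere_mean (\<lambda>z. cnj (Q z) * (wmon_cnj w2 z * 1)) = complex_of_real K' * cnj (fold d_zbar w2 Q 0)"
    using sphere_mean_wmon_cnj[OF Q' bihom_const[of 1]] eq by auto
  have "sphere_mean (\<lambda>z. Q z * wmon w2 z) = cnj (sphere_mean (\<lambda>z. cnj (Q z) * (wmon_cnj w2 z * 1)))"
    by (simp flip: sphere_mean_cnj cnj_wmon)
  also have "\<dots> = complex_of_real K' * fold d_zbar w2 Q 0" using K' by simp
  finally show ?thesis using K K' by (intro exI[of _ "K * K'"]) (simp add: Q_def)
qed

lemma fold_d_z_cmult: "bihom a b M \<Longrightarrow> fold d_z w (\<lambda>z. c * M z) = (\<lambda>z. c * fold d_z w M z)"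
proof (induction w arbitrary: a M)
  case (Cons j w)
  then show ?case using Cons.IH[OF bihom_d_z[OF Cons.prems]] by (simp add: d_z_bihom_cmult)
qed simp

lemma fold_d_z_sum:
  "finite A \<Longrightarrow> (\<And>i. i \<in> A \<Longrightarrow> bihom a b (M i)) \<Longrightarrow>
     fold d_z w (\<lambda>z. \<Sum>i\<in>A. M i z) = (\<lambda>z. \<Sum>i\<in>A. fold d_z w (M i) z)"
proof (induction w arbitrary: a M)
  case (Cons j w)
  have "fold d_z (j # w) (\<lambda>z. \<Sum>i\<in>A. M i z) = fold d_z w (\<lambda>z. \<Sum>i\<in>A. d_z j (M i) z)"
    by (simp add: d_z_bihom_sum[OF Cons.prems])
  also have "\<dots> = (\<lambda>z. \<Sum>i\<in>A. fold d_z w (d_z j (M i)) z)"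
    by (rule Cons.IH[OF Cons.prems(1) bihom_d_z[OF Cons.prems(2)]])
  finally show ?case by simp
qed simp

lemma bihom_coord_power: "bihom k 0 (\<lambda>z. (z $ l) ^ k)"
  by (induction k) (auto intro: bihom.intros)

lemma bihom_prod_coord: "finite A \<Longrightarrow> bihom (sum \<alpha> A) 0 (\<lambda>z. \<Prod>l\<in>A. (z $ l) ^ \<alpha> l)"
proof (induction A rule: finite_induct)
  case (insert l A)
  then show ?case using bihom_mult[OF bihom_coord_power insert.IH] by simp
qed (simp add: bihom_const)

lemma bihom_prod_cnj_coord: "finite A \<Longrightarrow> bihom 0 (sum \<alpha> A) (\<lambda>z. \<Prod>l\<in>A. cnj (z $ l) ^ \<alpha> l)"
  using bihom_cnj[OF bihom_prod_coord, of A \<alpha>] by simp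

lemma bihom_bimonom: "bihom (sum \<alpha> UNIV) (sum \<beta> UNIV) (bimonom \<alpha> \<beta>)"
  using bihom_mult[OF bihom_prod_coord[OF finite, of \<alpha> UNIV] bihom_prod_cnj_coord[OF finite, of \<beta> UNIV]]
  by (simp add: bimonom_def[abs_def])

lemma d_z_coord_power: "d_z j (\<lambda>z. (z $ l) ^ k) = (\<lambda>z. if l = j then of_nat k * (z $ l) ^ (k - 1) else 0)"
proof (induction k)
  case (Suc k)
  have "d_z j (\<lambda>z. (z $ l) ^ Suc k) = (\<lambda>z. (if l = j then 1 else 0) * (z $ l) ^ k + z $ l * (if l = j then of_nat k * (z $ l) ^ (k - 1) else 0))"
    using d_z_coord_mult[OF bihom_coord_power[of k l], of j l] by (simp only: Suc power_Suc)
  also have "\<dots> = (\<lambda>z. if l = j then of_nat (Suc k) * (z $ l) ^ k else 0)"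
    by (cases k) (auto simp: fun_eq_iff algebra_simps)
  finally show ?case by (simp only: diff_Suc_1)
qed (simp add: fun_eq_iff)

lemma d_z_prod_coord: "finite A \<Longrightarrow> j \<notin> A \<Longrightarrow> d_z j (\<lambda>z. \<Prod>l\<in>A. (z $ l) ^ \<alpha> l) = (\<lambda>z. 0)"
proof (induction A rule: finite_induct)
  case (insert l A)
  then show ?case
    using d_z_bihom_mult[OF bihom_coord_power[of "\<alpha> l" l] bihom_prod_coord[OF insert(1), of \<alpha>], of j]
    by (auto simp: d_z_coord_power)
qed simp

lemma d_z_bimonom:
  "d_z j (bimonom \<alpha> \<beta>) = (\<lambda>z. of_nat (\<alpha> j) * bimonom (\<alpha>(j := \<alpha> j - 1)) \<beta> z)"
proof -
  \<comment> \<open>split off the factor with the variable \<open>z\<^sub>j\<close>\<close>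
  let ?R = "\<lambda>z::complex^'a. \<Prod>l\<in>UNIV - {j}. (z $ l) ^ \<alpha> l"
  let ?C = "\<lambda>z::complex^'a. \<Prod>l\<in>UNIV. cnj (z $ l) ^ \<beta> l"
  have split: "bimonom \<alpha>' \<beta> z = (z $ j) ^ \<alpha>' j * (?R z * ?C z)" if "\<And>l. l \<noteq> j \<Longrightarrow> \<alpha>' l = \<alpha> l" for \<alpha>' z
  proof -
    have "(\<Prod>l\<in>UNIV. (z $ l) ^ \<alpha>' l) = (z $ j) ^ \<alpha>' j * (\<Prod>l\<in>UNIV - {j}. (z $ l) ^ \<alpha>' l)"
      by (rule prod.remove) auto
    also have "(\<Prod>l\<in>UNIV - {j}. (z $ l) ^ \<alpha>' l) = ?R z"
      using that by (intro prod.cong) auto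
    finally show ?thesis by (simp add: bimonom_def)
  qed
  have bR: "bihom (sum \<alpha> (UNIV - {j})) 0 ?R" by (rule bihom_prod_coord) simp
  have bC: "bihom 0 (sum \<beta> UNIV) ?C" by (rule bihom_prod_cnj_coord) simp
  have 0: "d_z j (\<lambda>z. ?R z * ?C z) = (\<lambda>z. 0)"
    unfolding d_z_bihom_mult[OF bR bC] d_z_bihom_0[OF bC] by (simp add: d_z_prod_coord)
  have "d_z j (bimonom \<alpha> \<beta>) = d_z j (\<lambda>z. (z $ j) ^ \<alpha> j * (?R z * ?C z))"
    by (rule arg_cong[where f="d_z j"], rule ext, rule split) simp
  also have "\<dots> = (\<lambda>z. of_nat (\<alpha> j) * (z $ j) ^ (\<alpha> j - 1) * (?R z * ?C z))"
    unfolding d_z_bihom_mult[OF bihom_coord_power bihom_mult[OF bR bC]] 0 d_z_coord_power by simp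
  also have "\<dots> = (\<lambda>z. of_nat (\<alpha> j) * bimonom (\<alpha>(j := \<alpha> j - 1)) \<beta> z)"
    using split[of "\<alpha>(j := \<alpha> j - 1)"] by (simp add: mult.assoc)
  finally show ?thesis .
qed

lemma cnj_bimonom: "cnj (bimonom \<alpha> \<beta> z) = bimonom \<beta> \<alpha> z"
  by (simp add: bimonom_def mult.commute)

text \<open>
  \<open>K\<close> is a product of falling factorials. Together with the criterion for \<open>K \<noteq> 0\<close> this isolates a single
  coefficient of a polynomial in the lemmas that follow.
\<close>

lemma fold_d_z_bimonom:
  "\<exists>K::nat. (\<forall>\<beta>. fold d_z w (bimonom \<alpha> \<beta>) = (\<lambda>z. of_nat K * bimonom (\<lambda>l. \<alpha> l - count_list w l) \<beta> z))
     \<and> (K \<noteq> 0 \<longleftrightarrow> (\<forall>l. count_list w l \<le> \<alpha> l))"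
proof (induction w arbitrary: \<alpha>)
  case Nil
  show ?case by (intro exI[of _ 1]) simp
next
  case (Cons j w)
  let ?\<alpha> = "\<alpha>(j := \<alpha> j - 1)"
  obtain K where K: "\<And>\<beta>. fold d_z w (bimonom ?\<alpha> \<beta>) = (\<lambda>z. of_nat K * bimonom (\<lambda>l. ?\<alpha> l - count_list w l) \<beta> z)"
    "K \<noteq> 0 \<longleftrightarrow> (\<forall>l. count_list w l \<le> ?\<alpha> l)" using Cons.IH[of ?\<alpha>] by blast
  have e: "(\<lambda>l. ?\<alpha> l - count_list w l) = (\<lambda>l. \<alpha> l - count_list (j # w) l)" by auto
  have "fold d_z (j # w) (bimonom \<alpha> \<beta>) = (\<lambda>z. of_nat (\<alpha> j * K) * bimonom (\<lambda>l. \<alpha> l - count_list (j # w) l) \<beta> z)" for \<beta>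
  proof -
    have "fold d_z (j # w) (bimonom \<alpha> \<beta>) = (\<lambda>z. of_nat (\<alpha> j) * fold d_z w (bimonom ?\<alpha> \<beta>) z)"
      by (simp only: fold_simps d_z_bimonom fold_d_z_cmult[OF bihom_bimonom])
    then show ?thesis by (simp only: K(1) e of_nat_mult mult.assoc)
  qed
  moreover have "\<alpha> j * K \<noteq> 0 \<longleftrightarrow> (\<forall>l. count_list (j # w) l \<le> \<alpha> l)"
  proof -
    have "\<alpha> j * K \<noteq> 0 \<longleftrightarrow> \<alpha> j \<noteq> 0 \<and> (\<forall>l. count_list w l \<le> ?\<alpha> l)" using K(2) by simp
    also have "\<dots> \<longleftrightarrow> (\<forall>l. \<alpha> j \<noteq> 0 \<and> count_list w l \<le> ?\<alpha> l)" by auto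
    also have "\<dots> \<longleftrightarrow> (\<forall>l. \<alpha> j \<noteq> 0 \<and> count_list (j # w) l \<le> \<alpha> l)"
      by (intro arg_cong[where f=All] ext) auto
    also have "\<dots> \<longleftrightarrow> (\<forall>l. count_list (j # w) l \<le> \<alpha> l)"
    proof -
      have "\<alpha> j \<noteq> 0" if "\<forall>l. count_list (j # w) l \<le> \<alpha> l" using that[rule_format, of j] by auto
      then show ?thesis by blast
    qed
    finally show ?thesis .
  qed
  ultimately show ?case by blast
qed

lemma sum_eq_le_imp_eq:
  fixes f g :: "'a::finite \<Rightarrow> nat"
  assumes "sum f UNIV = sum g UNIV" "\<And>l. f l \<le> g l"
  shows "f = g"
proof (rule ext, rule ccontr)
  fix l assume "f l \<noteq> g l"
  then have "f l < g l" using assms(2)[of l] by simp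
  then have "sum f UNIV < sum g UNIV" using assms(2) by (intro sum_strict_mono_ex1) auto
  then show False using assms(1) by simp
qed

lemma bihom_bipoly: "bihom p q (bipoly p q c)"
proof -
  have "bihom p q (\<lambda>z. c \<alpha> \<beta> * bimonom \<alpha> \<beta> z)" if "\<alpha> \<in> midx p" "\<beta> \<in> midx q" for \<alpha> \<beta>
    using bihom_cmult[OF bihom_bimonom[of \<alpha> \<beta>]] that by (simp add: midx_def)
  then show ?thesis unfolding bipoly_def by (intro bihom_sum) auto
qed

lemma finite_midx: "finite (midx p :: ('n::finite \<Rightarrow> nat) set)"
proof (rule finite_subset)
  show "midx p \<subseteq> (PiE UNIV (\<lambda>_. {..p}) :: ('n \<Rightarrow> nat) set)"
    by (auto simp: midx_def PiE_UNIV_domain intro: member_le_sum)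
qed (rule finite_PiE, auto)

text \<open>
  Among the monomials of the same degree, every other one lacks a variable that is differentiated.
\<close>

lemma fold_d_z_midx_sum:
  fixes w :: "'n::finite list"
  assumes w: "count_list w = \<alpha>" and \<alpha>: "\<alpha> \<in> midx p"
  shows "\<exists>K>0. \<forall>g \<beta>. fold d_z w (\<lambda>z. \<Sum>\<alpha>'\<in>midx p. g \<alpha>' * bimonom \<alpha>' \<beta> z)
     = (\<lambda>z. of_nat K * g \<alpha> * bimonom (\<lambda>_. 0) \<beta> z)"
proof -
  obtain K where K: "\<And>\<beta>. fold d_z w (bimonom \<alpha> \<beta>) = (\<lambda>z. of_nat K * bimonom (\<lambda>l. 0) \<beta> z)" "K \<noteq> 0"
    using fold_d_z_bimonom[of w \<alpha>] w by auto
  have zero: "fold d_z w (bimonom \<alpha>' \<beta>) = (\<lambda>z. 0)" if "\<alpha>' \<in> midx p" "\<alpha>' \<noteq> \<alpha>" for \<alpha>' \<beta>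
  proof -
    have "\<not> (\<forall>l. count_list w l \<le> \<alpha>' l)"
      using that \<alpha> sum_eq_le_imp_eq[of \<alpha> \<alpha>'] w by (auto simp: midx_def)
    then show ?thesis using fold_d_z_bimonom[of w \<alpha>'] by auto
  qed
  have "fold d_z w (\<lambda>z. \<Sum>\<alpha>'\<in>midx p. g \<alpha>' * bimonom \<alpha>' \<beta> z) = (\<lambda>z. of_nat K * g \<alpha> * bimonom (\<lambda>_. 0) \<beta> z)" for g \<beta>
  proof -
    have b: "bihom p (sum \<beta> UNIV) (bimonom \<alpha>' \<beta>)" if "\<alpha>' \<in> midx p" for \<alpha>'
      using bihom_bimonom[of \<alpha>' \<beta>] that by (simp add: midx_def)
    have "fold d_z w (\<lambda>z. \<Sum>\<alpha>'\<in>midx p. g \<alpha>' * bimonom \<alpha>' \<beta> z)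
        = (\<lambda>z. \<Sum>\<alpha>'\<in>midx p. fold d_z w (\<lambda>z. g \<alpha>' * bimonom \<alpha>' \<beta> z) z)"
      by (rule fold_d_z_sum[OF finite_midx bihom_cmult[OF b]])
    also have "\<dots> = (\<lambda>z. \<Sum>\<alpha>'\<in>midx p. if \<alpha>' = \<alpha> then of_nat K * g \<alpha> * bimonom (\<lambda>_. 0) \<beta> z else 0)"
      using zero by (intro ext sum.cong refl) (auto simp: fold_d_z_cmult[OF bihom_bimonom] K(1))
    finally show ?thesis using \<alpha> by (simp add: finite_midx)
  qed
  then show ?thesis using K(2) by blast
qed

lemma fold_d_bipoly:
  fixes w1 w2 :: "'n::finite list"
  assumes w1: "count_list w1 = \<alpha>" and w2: "count_list w2 = \<beta>"
    and \<alpha>: "\<alpha> \<in> midx p" and \<beta>: "\<beta> \<in> midx q"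
  shows "\<exists>K>0. fold d_zbar w2 (fold d_z w1 (bipoly p q c)) 0 = of_nat K * c \<alpha> \<beta>"
proof -
  obtain K1 where K1: "K1 > 0" "\<And>g \<beta>. fold d_z w1 (\<lambda>z. \<Sum>\<alpha>'\<in>midx p. g \<alpha>' * bimonom \<alpha>' \<beta> z)
     = (\<lambda>z. of_nat K1 * g \<alpha> * bimonom (\<lambda>_. 0) \<beta> z)"
    using fold_d_z_midx_sum[OF w1 \<alpha>] by blast
  obtain K2 where K2: "K2 > 0" "\<And>g \<beta>'. fold d_z w2 (\<lambda>z. \<Sum>\<alpha>'\<in>midx q. g \<alpha>' * bimonom \<alpha>' \<beta>' z)
     = (\<lambda>z. of_nat K2 * g \<beta> * bimonom (\<lambda>_. 0) \<beta>' z)"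
    using fold_d_z_midx_sum[OF w2 \<beta>] by blast
  define Q where "Q = fold d_z w1 (bipoly p q c)"
  have b: "bihom p q (\<lambda>z. \<Sum>\<alpha>'\<in>midx p. c \<alpha>' \<beta>' * bimonom \<alpha>' \<beta>' z)" if "\<beta>' \<in> midx q" for \<beta>'
  proof (rule bihom_sum)
    fix \<alpha>' :: "'n \<Rightarrow> nat" assume "\<alpha>' \<in> midx p"
    then show "bihom p q (\<lambda>z. c \<alpha>' \<beta>' * bimonom \<alpha>' \<beta>' z)"
      using bihom_cmult[OF bihom_bimonom[of \<alpha>' \<beta>']] that by (simp add: midx_def)
  qed
  have "bipoly p q c = (\<lambda>z. \<Sum>\<beta>'\<in>midx q. \<Sum>\<alpha>'\<in>midx p. c \<alpha>' \<beta>' * bimonom \<alpha>' \<beta>' z)"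
    unfolding bipoly_def by (intro ext sum.swap)
  then have Q: "Q = (\<lambda>z. \<Sum>\<beta>'\<in>midx q. of_nat K1 * c \<alpha> \<beta>' * bimonom (\<lambda>_. 0) \<beta>' z)"
    unfolding Q_def by (simp only: fold_d_z_sum[OF finite_midx b] K1(2))
  have bQ: "bihom 0 q Q"
    unfolding Q
  proof (rule bihom_sum)
    fix \<beta>' :: "'n \<Rightarrow> nat" assume "\<beta>' \<in> midx q"
    then show "bihom 0 q (\<lambda>z. of_nat K1 * c \<alpha> \<beta>' * bimonom (\<lambda>_. 0) \<beta>' z)"
      using bihom_cmult[OF bihom_bimonom[of "\<lambda>_. 0" \<beta>']] by (simp add: midx_def)
  qed
  have "(\<lambda>z. cnj (fold d_zbar w2 Q z)) = fold d_z w2 (\<lambda>z. cnj (Q z))"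
    by (rule fold_d_z_cnj[OF bQ, symmetric])
  also have "(\<lambda>z. cnj (Q z)) = (\<lambda>z. \<Sum>\<beta>'\<in>midx q. cnj (of_nat K1 * c \<alpha> \<beta>') * bimonom \<beta>' (\<lambda>_. 0) z)"
    unfolding Q by (simp only: cnj_sum complex_cnj_mult cnj_bimonom)
  also have "fold d_z w2 \<dots> = (\<lambda>z. of_nat K2 * cnj (of_nat K1 * c \<alpha> \<beta>) * bimonom (\<lambda>_. 0) (\<lambda>_. 0) z)"
    by (rule K2(2))
  finally have "cnj (fold d_zbar w2 Q 0) = of_nat K2 * cnj (of_nat K1 * c \<alpha> \<beta>)"
    by (simp add: bimonom_def fun_eq_iff)
  then have "cnj (cnj (fold d_zbar w2 Q 0)) = cnj (of_nat K2 * cnj (of_nat K1 * c \<alpha> \<beta>))" by (rule arg_cong)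
  then have "fold d_zbar w2 Q 0 = of_nat (K1 * K2) * c \<alpha> \<beta>" by simp
  then show ?thesis using K1(1) K2(1) unfolding Q_def by (intro exI[of _ "K1 * K2"]) simp
qed

lemma length_eq_sum_count:
  fixes w :: "'n::finite list"
  shows "length w = (\<Sum>l\<in>UNIV. count_list w l)"
proof (induction w)
  case (Cons j w)
  have "(\<Sum>l\<in>UNIV. count_list (j # w) l) = (\<Sum>l\<in>UNIV. count_list w l + (if l = j then 1 else 0))"
    by (intro sum.cong) auto
  then show ?case using Cons by (simp add: sum.distrib)
qed simp

text \<open>
  Here the chosen monomial enters: the mean is a positive multiple of its coefficient in \<open>P\<close>. It will
  be the leading coefficient of the differential equation.
\<close>

lemma sphere_mean_monomial_nonzero:
  fixes w1 w2 :: "'n::finite list"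
  assumes P: "harmonic p q P" and occ: "monom_occurs p q P (count_list w1, count_list w2)"
  shows "sphere_mean (\<lambda>z. P z * (wmon_cnj w1 z * wmon w2 z)) \<noteq> 0"
proof -
  obtain c where c: "P = bipoly p q c" "c (count_list w1) (count_list w2) \<noteq> 0"
    and m: "count_list w1 \<in> midx p" "count_list w2 \<in> midx q"
    using occ by (auto simp: monom_occurs_def)
  have "harmonic (length w1) (length w2) P" using P m by (simp add: length_eq_sum_count midx_def)
  then obtain K where K: "K > 0" "sphere_mean (\<lambda>z. P z * (wmon_cnj w1 z * wmon w2 z))
    = complex_of_real K * fold d_zbar w2 (fold d_z w1 P) 0" using sphere_mean_wmon by blast
  then show ?thesis using fold_d_bipoly[OF refl refl m, of c] c by auto
qed

section \<open>Coefficients of polynomials and spherical harmonics\<close>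

lemma P_space_bihom: "P \<in> P_space p q \<Longrightarrow> bihom p q P"
  by (auto simp: P_space_def bihom_bipoly)

lemma P_space_add: "P \<in> P_space p q \<Longrightarrow> Q \<in> P_space p q \<Longrightarrow> (\<lambda>z. P z + Q z) \<in> P_space p q"
proof -
  have "(\<lambda>z. bipoly p q c z + bipoly p q d z) = bipoly p q (\<lambda>\<alpha> \<beta>. c \<alpha> \<beta> + d \<alpha> \<beta>)"
    for c d :: "('a \<Rightarrow> nat) \<Rightarrow> ('a \<Rightarrow> nat) \<Rightarrow> complex"
    by (auto simp: bipoly_def sum.distrib distrib_right)
  then show "P \<in> P_space p q \<Longrightarrow> Q \<in> P_space p q \<Longrightarrow> ?thesis"
    by (auto simp: P_space_def)
qed

lemma P_space_zero: "(\<lambda>z. 0) \<in> P_space p q"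
proof -
  have "(\<lambda>z. 0) = bipoly p q (\<lambda>_ _. 0)" by (auto simp: bipoly_def)
  then show ?thesis by (auto simp: P_space_def)
qed

lemma P_space_sum: "(\<And>i. i \<in> A \<Longrightarrow> P i \<in> P_space p q) \<Longrightarrow> (\<lambda>z. \<Sum>i\<in>A. P i z) \<in> P_space p q"
  by (induction A rule: infinite_finite_induct) (auto intro: P_space_add P_space_zero)

lemma P_space_bimonom:
  assumes "\<alpha> \<in> midx p" "\<beta> \<in> midx q"
  shows "(\<lambda>z. c * bimonom \<alpha> \<beta> z) \<in> P_space p q"
proof -
  have "(\<lambda>z. c * bimonom \<alpha> \<beta> z) = bipoly p q (\<lambda>\<alpha>' \<beta>'. if \<alpha>' = \<alpha> \<and> \<beta>' = \<beta> then c else 0)"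
  proof
    fix z
    have "bipoly p q (\<lambda>\<alpha>' \<beta>'. if \<alpha>' = \<alpha> \<and> \<beta>' = \<beta> then c else 0) z
      = (\<Sum>\<alpha>'\<in>midx p. if \<alpha>' = \<alpha> then (\<Sum>\<beta>'\<in>midx q. if \<beta>' = \<beta> then c * bimonom \<alpha> \<beta> z else 0) else 0)"
      unfolding bipoly_def by (intro sum.cong refl) (auto intro: sum.cong)
    then show "c * bimonom \<alpha> \<beta> z = bipoly p q (\<lambda>\<alpha>' \<beta>'. if \<alpha>' = \<alpha> \<and> \<beta>' = \<beta> then c else 0) z"
      using assms by (simp add: finite_midx)
  qed
  then show ?thesis by (auto simp: P_space_def)
qed

lemma bimonom_coord:
  "z $ l * bimonom \<alpha> \<beta> z = bimonom (\<alpha>(l := Suc (\<alpha> l))) \<beta> z"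
proof -
  have "(\<Prod>i\<in>UNIV. (z $ i) ^ (\<alpha>(l := Suc (\<alpha> l))) i) = (z $ l) ^ Suc (\<alpha> l) * (\<Prod>i\<in>UNIV - {l}. (z $ i) ^ \<alpha> i)"
    by (subst prod.remove[of UNIV l]) (auto intro!: prod.cong)
  moreover have "(\<Prod>i\<in>UNIV. (z $ i) ^ \<alpha> i) = (z $ l) ^ \<alpha> l * (\<Prod>i\<in>UNIV - {l}. (z $ i) ^ \<alpha> i)"
    by (subst prod.remove[of UNIV l]) auto
  ultimately show ?thesis by (simp add: bimonom_def)
qed

lemma midx_upd: "\<alpha> \<in> midx p \<Longrightarrow> \<alpha>(l := Suc (\<alpha> l)) \<in> midx (Suc p)"
proof -
  have "(\<Sum>i\<in>UNIV. (\<alpha>(l := Suc (\<alpha> l))) i) = Suc (\<alpha> l) + (\<Sum>i\<in>UNIV - {l}. \<alpha> i)"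
    by (subst sum.remove[of UNIV l]) auto
  moreover have "(\<Sum>i\<in>UNIV. \<alpha> i) = \<alpha> l + (\<Sum>i\<in>UNIV - {l}. \<alpha> i)"
    by (subst sum.remove[of UNIV l]) auto
  ultimately show "\<alpha> \<in> midx p \<Longrightarrow> ?thesis" by (simp add: midx_def)
qed

lemma P_space_cnj: "P \<in> P_space p q \<Longrightarrow> (\<lambda>z. cnj (P z)) \<in> P_space q p"
proof -
  assume "P \<in> P_space p q"
  then obtain c where "P = bipoly p q c" by (auto simp: P_space_def)
  then have "(\<lambda>z. cnj (P z)) = bipoly q p (\<lambda>\<beta> \<alpha>. cnj (c \<alpha> \<beta>))"
    unfolding bipoly_def by (simp only: cnj_sum complex_cnj_mult cnj_bimonom sum.swap[of _ "midx q" "midx p"])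
  then show ?thesis by (auto simp: P_space_def)
qed

lemma P_space_coord: "P \<in> P_space p q \<Longrightarrow> (\<lambda>z. z $ l * P z) \<in> P_space (Suc p) q"
proof -
  assume "P \<in> P_space p q"
  then obtain c where "P = bipoly p q c" by (auto simp: P_space_def)
  then have "(\<lambda>z. z $ l * P z) = (\<lambda>z. \<Sum>\<alpha>\<in>midx p. \<Sum>\<beta>\<in>midx q. c \<alpha> \<beta> * bimonom (\<alpha>(l := Suc (\<alpha> l))) \<beta> z)"
    by (simp add: bipoly_def sum_distrib_left bimonom_coord[symmetric] mult.left_commute)
  then show ?thesis by (auto intro!: P_space_sum P_space_bimonom midx_upd)
qed

text \<open>
  Every generator of \<open>bihom\<close> preserves the description by coefficients.
\<close>

lemma bihom_P_space: "bihom a b M \<Longrightarrow> M \<in> P_space a b"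
proof (induction rule: bihom.induct)
  case (bihom_const c)
  have "(\<lambda>_. 0) \<in> midx 0" by (simp add: midx_def)
  from P_space_bimonom[OF this this, of c] show ?case by (simp add: bimonom_def)
next
  case (bihom_cnj_coord a b M l)
  then show ?case using P_space_cnj[OF P_space_coord[OF P_space_cnj], of M a b l] by simp
qed (auto intro: P_space_zero P_space_add P_space_coord)

lemma Basis_complex_vec: "(Basis :: (complex ^ 'n::finite) set) = (\<lambda>(l, c). axis l c) ` (UNIV \<times> {1, \<i>})"
  by (auto simp: Basis_vec_def Basis_complex_def)

lemma sum_Basis_complex_vec:
  "(\<Sum>b\<in>(Basis :: (complex ^ 'n::finite) set). f b) = (\<Sum>l\<in>UNIV. f (axis l 1) + f (axis l \<i>))"
proof -
  have "inj_on (\<lambda>(l, c). axis l c :: complex ^ 'n) (UNIV \<times> {1, \<i>})"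
    by (auto simp: inj_on_def axis_eq_axis)
  then have "(\<Sum>b\<in>(Basis :: (complex ^ 'n) set). f b) = (\<Sum>x\<in>UNIV \<times> {1, \<i>}. f (case x of (l, c) \<Rightarrow> axis l c))"
    unfolding Basis_complex_vec by (rule sum.reindex[unfolded o_def])
  also have "\<dots> = (\<Sum>l\<in>UNIV. \<Sum>c\<in>{1, \<i>}. f (axis l c))"
    by (subst sum.cartesian_product) (auto intro: sum.cong)
  finally show ?thesis by (simp add: complex_eq_iff)
qed

text \<open>
  In the second derivative along \<open>axis l c\<close> the pure terms carry \<open>c\<^sup>2\<close> and \<open>(cnj c)\<^sup>2\<close> and cancel between
  \<open>c = 1\<close> and \<open>c = \<i>\<close>, the mixed term carries \<open>c cnj c = 1\<close>.
\<close>

lemma laplacian_bihom: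
  assumes M: "bihom a b M"
  shows "laplacian M z = 4 * (\<Sum>j\<in>UNIV. d_z j (d_zbar j M) z)"
proof -
  have dir: "frechet_derivative F (at y) (axis l c) = d_z l F y * c + d_zbar l F y * cnj c"
    if "F differentiable at y" for F :: "complex ^ 'a \<Rightarrow> complex" and y l c
  proof -
    have "frechet_derivative F (at y) (axis l c)
       = (\<Sum>j\<in>UNIV. if j = l then d_z l F y * c + d_zbar l F y * cnj c else 0)"
      unfolding frechet_derivative_wirtinger[OF that] by (intro sum.cong) (auto simp: axis_def)
    then show ?thesis by simp
  qed
  have second: "frechet_derivative (\<lambda>y. frechet_derivative M (at y) (axis l c)) (at z) (axis l c)
      = d_z l (d_z l M) z * c\<^sup>2 + 2 * (d_z l (d_zbar l M) z * (c * cnj c)) + d_zbar l (d_zbar l M) z * (cnj c)\<^sup>2" for l c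
  proof -
    have e: "(\<lambda>y. frechet_derivative M (at y) (axis l c)) = (\<lambda>y. c * d_z l M y + cnj c * d_zbar l M y)"
      by (simp add: dir[OF bihom_differentiable[OF M]] mult.commute)
    note b = bihom_cmult[OF bihom_d_z[OF M], of c l] bihom_cmult[OF bihom_d_zbar[OF M], of "cnj c" l]
    have "(\<lambda>y. c * d_z l M y + cnj c * d_zbar l M y) differentiable at z"
      by (intro differentiable_add bihom_differentiable[OF b(1)] bihom_differentiable[OF b(2)])
    then show ?thesis
      unfolding e using d_z_d_zbar_commute[OF M, of l l]
      by (simp add: dir d_z_bihom_add[OF b] d_zbar_bihom_add[OF b] d_z_bihom_cmult[OF bihom_d_z[OF M]]
        d_z_bihom_cmult[OF bihom_d_zbar[OF M]] d_zbar_bihom_cmult[OF bihom_d_z[OF M]]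
        d_zbar_bihom_cmult[OF bihom_d_zbar[OF M]] power2_eq_square algebra_simps)
  qed
  have "laplacian M z = (\<Sum>l\<in>UNIV. 4 * d_z l (d_zbar l M) z)"
    unfolding laplacian_def sum_Basis_complex_vec second by (intro sum.cong) auto
  then show ?thesis by (simp add: sum_distrib_left)
qed

lemma H_space_harmonic: "P \<in> H_space p q \<longleftrightarrow> harmonic p q P"
proof
  assume P: "P \<in> H_space p q"
  then have "bihom p q P" by (auto simp: H_space_def P_space_bihom)
  then show "harmonic p q P" using P laplacian_bihom[of p q P] by (auto simp: H_space_def harmonic_def)
next
  assume P: "harmonic p q P"
  then show "P \<in> H_space p q"
    using bihom_P_space laplacian_bihom[OF harmonic_bihom[OF P]] by (auto simp: H_space_def harmonic_def)
qed

section \<open>Smooth functions of a real variable\<close>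

text \<open>
  A function together with all its derivatives on \<open>J\<close>. On towers a constant coefficient operator is a
  linear combination of shifts of the index, which turns its calculus into polynomial algebra.
\<close>

definition deriv_tower :: "real set \<Rightarrow> (nat \<Rightarrow> real \<Rightarrow> complex) \<Rightarrow> bool" where
  "deriv_tower J bs \<longleftrightarrow> (\<forall>k. \<forall>t\<in>J. (bs k has_vector_derivative bs (Suc k) t) (at t))"

fun has_derivs :: "nat \<Rightarrow> real set \<Rightarrow> (real \<Rightarrow> complex) \<Rightarrow> bool" where
  "has_derivs 0 J g = True"
| "has_derivs (Suc k) J g = (\<exists>g'. (\<forall>t\<in>J. (g has_vector_derivative g' t) (at t)) \<and> has_derivs k J g')"

lemma has_derivs_SucE:
  assumes "has_derivs (Suc k) J g"
  obtains g' where "\<And>t. t \<in> J \<Longrightarrow> (g has_vector_derivative g' t) (at t)" "has_derivs k J g'"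
  using assms by auto

definition smooth_curve :: "real set \<Rightarrow> (real \<Rightarrow> complex) \<Rightarrow> bool" where
  "smooth_curve J g \<longleftrightarrow> (\<forall>k. has_derivs k J g)"

lemma has_derivs_cong:
  assumes "open J" "\<And>t. t \<in> J \<Longrightarrow> g t = h t" "has_derivs k J g"
  shows "has_derivs k J h"
proof (cases k)
  case (Suc k')
  then obtain g' where g': "\<And>t. t \<in> J \<Longrightarrow> (g has_vector_derivative g' t) (at t)" "has_derivs k' J g'"
    using assms(3) by auto
  have "(h has_vector_derivative g' t) (at t)" if "t \<in> J" for t
    by (rule has_vector_derivative_transform_within_open[OF g'(1)[OF that] assms(1) that assms(2)])
  then show ?thesis using Suc g'(2) by auto
qed simp

lemma has_derivs_Suc: "has_derivs (Suc k) J g \<Longrightarrow> has_derivs k J g"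
proof (induction k arbitrary: g)
  case (Suc k)
  then show ?case by (metis has_derivs.simps(2))
qed simp

lemma has_derivs_add: "has_derivs k J g \<Longrightarrow> has_derivs k J h \<Longrightarrow> has_derivs k J (\<lambda>t. g t + h t)"
proof (induction k arbitrary: g h)
  case (Suc k)
  obtain g' where 1: "\<And>t. t \<in> J \<Longrightarrow> (g has_vector_derivative g' t) (at t)" "has_derivs k J g'"
    using has_derivs_SucE[OF Suc.prems(1)] by blast
  obtain h' where 2: "\<And>t. t \<in> J \<Longrightarrow> (h has_vector_derivative h' t) (at t)" "has_derivs k J h'"
    using has_derivs_SucE[OF Suc.prems(2)] by blast
  note * = 1 2
  show ?case unfolding has_derivs.simps
    by (intro exI[of _ "\<lambda>t. g' t + h' t"] conjI ballI has_vector_derivative_add * Suc.IH)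
qed simp

lemma has_derivs_mult: "has_derivs k J g \<Longrightarrow> has_derivs k J h \<Longrightarrow> has_derivs k J (\<lambda>t. g t * h t)"
proof (induction k arbitrary: g h)
  case (Suc k)
  obtain g' where 1: "\<And>t. t \<in> J \<Longrightarrow> (g has_vector_derivative g' t) (at t)" "has_derivs k J g'"
    using has_derivs_SucE[OF Suc.prems(1)] by blast
  obtain h' where 2: "\<And>t. t \<in> J \<Longrightarrow> (h has_vector_derivative h' t) (at t)" "has_derivs k J h'"
    using has_derivs_SucE[OF Suc.prems(2)] by blast
  note * = 1 2
  have "has_derivs k J (\<lambda>t. g t * h' t + g' t * h t)"
    by (rule has_derivs_add[OF Suc.IH[OF has_derivs_Suc[OF Suc.prems(1)] 2(2)] Suc.IH[OF 1(2) has_derivs_Suc[OF Suc.prems(2)]]])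
  then show ?case unfolding has_derivs.simps
    by (intro exI[of _ "\<lambda>t. g t * h' t + g' t * h t"] conjI ballI has_vector_derivative_mult *)
qed simp

lemma has_derivs_const: "has_derivs k J (\<lambda>t. c)"
proof (induction k arbitrary: c)
  case (Suc k)
  then show ?case by (auto intro!: exI[of _ "\<lambda>t. 0"])
qed simp

lemma has_derivs_powr:
  assumes "J \<subseteq> {0<..}"
  shows "has_derivs k J (\<lambda>t. complex_of_real (t powr x))"
proof (induction k arbitrary: x)
  case (Suc k)
  have "((\<lambda>t. complex_of_real (t powr x)) has_vector_derivative of_real x * complex_of_real (t powr (x - 1))) (at t)"
    if "t \<in> J" for t
  proof -
    have "((\<lambda>t. t powr x) has_real_derivative x * t powr (x - 1)) (at t)"
      using that assms by (intro has_real_derivative_powr) auto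
    from has_vector_derivative_of_real[OF this] show ?thesis by simp
  qed
  then show ?case unfolding has_derivs.simps
    by (intro exI[of _ "\<lambda>t. of_real x * complex_of_real (t powr (x - 1))"] conjI ballI has_derivs_mult
        has_derivs_const Suc.IH)
qed simp

lemma has_derivs_compose:
  assumes "has_derivs k I g" "\<And>t. t \<in> J \<Longrightarrow> \<phi> t \<in> I"
    and "\<And>t. t \<in> J \<Longrightarrow> (\<phi> has_real_derivative \<phi>' t) (at t)"
    and "\<And>k. has_derivs k J (\<lambda>t. complex_of_real (\<phi>' t))"
  shows "has_derivs k J (\<lambda>t. g (\<phi> t))"
  using assms(1)
proof (induction k arbitrary: g)
  case (Suc k)
  then obtain g' where g': "\<And>t. t \<in> I \<Longrightarrow> (g has_vector_derivative g' t) (at t)" "has_derivs k I g'"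
    by auto
  have "((\<lambda>t. g (\<phi> t)) has_vector_derivative complex_of_real (\<phi>' t) * g' (\<phi> t)) (at t)" if "t \<in> J" for t
  proof -
    have "((g \<circ> \<phi>) has_vector_derivative (\<phi>' t *\<^sub>R g' (\<phi> t))) (at t)"
      using assms(3)[OF that] g'(1)[OF assms(2)[OF that]]
      by (intro vector_diff_chain_at) (auto simp: has_real_derivative_iff_has_vector_derivative)
    then show ?thesis by (simp add: o_def scaleR_conv_of_real)
  qed
  then show ?case unfolding has_derivs.simps
    by (intro exI[of _ "\<lambda>t. complex_of_real (\<phi>' t) * g' (\<phi> t)"] conjI ballI has_derivs_mult assms(4)
        Suc.IH[OF g'(2)])
qed simp

lemma smooth_curve_tower:
  assumes "open J" "smooth_curve J g"
  obtains bs where "deriv_tower J bs" "bs 0 = g"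
proof -
  define vd where "vd = (\<lambda>(g :: real \<Rightarrow> complex) t. vector_derivative g (at t))"
  have step: "smooth_curve J (vd h) \<and> (\<forall>t\<in>J. (h has_vector_derivative vd h t) (at t))"
    if h: "smooth_curve J h" for h
  proof -
    have "has_derivs 1 J h" using h by (simp add: smooth_curve_def)
    then have der: "(h has_vector_derivative vd h t) (at t)" if "t \<in> J" for t
      unfolding vd_def using that by (auto simp: vector_derivative_works[symmetric] intro: differentiableI_vector)
    have "has_derivs k J (vd h)" for k
    proof -
      have "has_derivs (Suc k) J h" using h by (simp add: smooth_curve_def del: has_derivs.simps)
      then obtain h' where h': "\<And>t. t \<in> J \<Longrightarrow> (h has_vector_derivative h' t) (at t)" "has_derivs k J h'" by auto
      have "h' t = vd h t" if "t \<in> J" for t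
        using vector_derivative_unique_at[OF h'(1)[OF that] der[OF that]] .
      then show ?thesis using has_derivs_cong[OF assms(1) _ h'(2)] by blast
    qed
    then show ?thesis using der by (simp add: smooth_curve_def)
  qed
  define bs where "bs = (\<lambda>k. (vd ^^ k) g)"
  have "smooth_curve J (bs k)" for k
    by (induction k) (use assms step in \<open>auto simp: bs_def\<close>)
  then have "deriv_tower J bs" unfolding deriv_tower_def using step by (simp add: bs_def)
  then show ?thesis using that[of bs] by (simp add: bs_def)
qed

lemma tower_smooth_curve:
  assumes "deriv_tower J bs" shows "smooth_curve J (bs k)"
proof -
  have "has_derivs m J (bs k)" for m
    by (induction m arbitrary: k) (use assms in \<open>auto simp: deriv_tower_def\<close>)
  then show ?thesis by (simp add: smooth_curve_def)
qed

text \<open>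
  The derivative of \<open>f\<close> in the fixed direction \<open>w\<close> is again a function on \<open>S\<close>, one degree less smooth, and
  its restriction to the ray is the derivative of the restriction.
\<close>

lemma Ck_on_line:
  assumes "Ck_on k S f" "\<And>\<rho>. \<rho> \<in> I \<Longrightarrow> \<rho> *\<^sub>R w \<in> S"
  shows "has_derivs k I (\<lambda>\<rho>. f (\<rho> *\<^sub>R w))"
  using assms(1)
proof (induction k arbitrary: f)
  case (Suc k)
  have "((\<lambda>\<rho>. f (\<rho> *\<^sub>R w)) has_vector_derivative frechet_derivative f (at (\<rho> *\<^sub>R w)) w) (at \<rho>)" if "\<rho> \<in> I" for \<rho>
  proof -
    have d: "f differentiable at (\<rho> *\<^sub>R w)" using Suc.prems assms(2)[OF that] by auto
    have "((\<lambda>\<rho>. \<rho> *\<^sub>R w) has_derivative (\<lambda>h. h *\<^sub>R w)) (at \<rho>)" by (auto intro!: derivative_eq_intros)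
    from diff_chain_at[OF this, of f "frechet_derivative f (at (\<rho> *\<^sub>R w))"] d
    have "((\<lambda>\<rho>. f (\<rho> *\<^sub>R w)) has_derivative (\<lambda>h. frechet_derivative f (at (\<rho> *\<^sub>R w)) (h *\<^sub>R w))) (at \<rho>)"
      by (simp add: o_def frechet_derivative_works)
    then show ?thesis
      using linear_frechet_derivative[OF d] by (simp add: has_vector_derivative_def linear_cmul)
  qed
  then show ?case using Suc by (auto intro!: exI[of _ "\<lambda>\<rho>. frechet_derivative f (at (\<rho> *\<^sub>R w)) w"])
qed simp

section \<open>Radial functions times polynomials\<close>

text \<open>
  \<open>I\<close> is a set of radii; \<open>J\<close> below is the corresponding set of values of \<open>t = |z|\<^sup>2\<close>.
\<close>

locale radial_domain =
  fixes I :: "real set"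
  assumes open_I: "open I" and pos_I: "I \<subseteq> {0<..}"
begin

definition J :: "real set" where "J = {t. 0 < t \<and> sqrt t \<in> I}"

lemma open_J: "open J"
proof -
  have "J = {0<..} \<inter> sqrt -` I" by (auto simp: J_def)
  then show ?thesis
    using continuous_open_preimage[of "{0<..}" sqrt I] open_I continuous_on_real_sqrt[OF continuous_on_id]
    by auto
qed

lemma pos_J: "J \<subseteq> {0<..}" by (auto simp: J_def)

lemma norm_sq_J: "norm z \<in> I \<Longrightarrow> (norm z)\<^sup>2 \<in> J"
  using pos_I by (auto simp: J_def)

lemma open_shell: "open {z :: complex ^ 'n::finite. norm z \<in> I}"
proof -
  have "{z :: complex ^ 'n. norm z \<in> I} = norm -` I" by auto
  then show ?thesis using open_I by (simp add: continuous_open_vimage)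
qed

text \<open>
  The functions that the operators produce from a radial function times a polynomial. They are known
  explicitly enough to differentiate their means in \<open>t\<close>. The rule \<open>radpoly_cong\<close> says that only the
  values on the shell matter.
\<close>

inductive radpoly :: "(complex ^ 'n::finite \<Rightarrow> complex) \<Rightarrow> bool" where
  radpoly_base: "smooth_curve J b \<Longrightarrow> bihom a c M \<Longrightarrow> radpoly (\<lambda>z. b ((norm z)\<^sup>2) * M z)"
| radpoly_add: "radpoly F \<Longrightarrow> radpoly G \<Longrightarrow> radpoly (\<lambda>z. F z + G z)"
| radpoly_cong: "radpoly F \<Longrightarrow> (\<And>z. norm z \<in> I \<Longrightarrow> G z = F z) \<Longrightarrow> radpoly G"

lemma smooth_curve_derivative:
  assumes "smooth_curve J b"
  obtains b' where "smooth_curve J b'" "\<And>t. t \<in> J \<Longrightarrow> (b has_vector_derivative b' t) (at t)"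
proof -
  obtain bs where bs: "deriv_tower J bs" "bs 0 = b" using smooth_curve_tower[OF open_J assms] .
  show ?thesis using that[of "bs 1"] bs tower_smooth_curve[OF bs(1), of 1] by (auto simp: deriv_tower_def)
qed

lemma radial_differentiable:
  fixes z :: "'a::real_inner" and b :: "real \<Rightarrow> complex"
  assumes "(b has_vector_derivative b') (at ((norm z)\<^sup>2))"
  shows "(\<lambda>z. b ((norm z)\<^sup>2)) differentiable at z"
  using has_derivative_radial[OF assms] by (auto simp: differentiable_def)

lemma radpoly_differentiable: "radpoly F \<Longrightarrow> norm z \<in> I \<Longrightarrow> F differentiable at z"
proof (induction rule: radpoly.induct)
  case (radpoly_base b a c M)
  obtain b' where "\<And>t. t \<in> J \<Longrightarrow> (b has_vector_derivative b' t) (at t)"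
    using smooth_curve_derivative[OF radpoly_base(1)] by blast
  then have "(\<lambda>z. b ((norm z)\<^sup>2)) differentiable at z"
    using norm_sq_J[OF radpoly_base(3)] by (intro radial_differentiable)
  then show ?case using bihom_differentiable[OF radpoly_base(2)] by (rule differentiable_mult)
next
  case (radpoly_cong F G)
  obtain D where D: "(F has_derivative D) (at z)" using radpoly_cong by (auto simp: differentiable_def)
  have "(G has_derivative D) (at z)"
    by (rule has_derivative_transform_within_open[OF D open_shell]) (use radpoly_cong in auto)
  then show ?case by (auto simp: differentiable_def)
qed (auto intro: differentiable_add)

lemma d_z_base:
  assumes b': "\<And>t. t \<in> J \<Longrightarrow> (b has_vector_derivative b' t) (at t)" and M: "bihom a c M" and z: "norm z \<in> I"
  shows "d_z j (\<lambda>z. b ((norm z)\<^sup>2) * M z) z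
    = b' ((norm z)\<^sup>2) * (cnj (z $ j) * M z) + b ((norm z)\<^sup>2) * d_z j M z"
proof -
  note d = b'[OF norm_sq_J[OF z]]
  show ?thesis
    by (simp add: d_z_mult[OF radial_differentiable[OF d] bihom_differentiable[OF M]] d_z_radial[OF d])
qed

lemma radpoly_d_z: "radpoly F \<Longrightarrow> radpoly (d_z j F)"
proof (induction rule: radpoly.induct)
  case (radpoly_base b a c M)
  obtain b' where b': "smooth_curve J b'" "\<And>t. t \<in> J \<Longrightarrow> (b has_vector_derivative b' t) (at t)"
    using smooth_curve_derivative[OF radpoly_base(1)] by blast
  have "radpoly (\<lambda>z. b' ((norm z)\<^sup>2) * (cnj (z $ j) * M z) + b ((norm z)\<^sup>2) * d_z j M z)"
    using radpoly_base b'(1)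
    by (intro radpoly.radpoly_add radpoly.radpoly_base[OF _ bihom_cnj_coord] radpoly.radpoly_base[OF _ bihom_d_z])
  then show ?case
    by (rule radpoly.radpoly_cong) (rule d_z_base[OF b'(2) radpoly_base(2)])
next
  case (radpoly_add F G)
  from radpoly.radpoly_add[OF radpoly_add(3,4)] show ?case
    by (rule radpoly.radpoly_cong) (intro d_z_add radpoly_differentiable radpoly_add)
next
  case (radpoly_cong F G)
  from radpoly_cong(3) show ?case
    by (rule radpoly.radpoly_cong) (rule d_z_cong(1)[OF open_shell], use radpoly_cong in auto)
qed

lemma radpoly_mult_bihom: "radpoly F \<Longrightarrow> bihom s k N \<Longrightarrow> radpoly (\<lambda>z. N z * F z)"
proof (induction rule: radpoly.induct)
  case (radpoly_base b a c M)
  from radpoly.radpoly_base[OF radpoly_base(1) bihom_mult[OF radpoly_base(3,2)]]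
  show ?case by (simp add: mult.left_commute)
next
  case (radpoly_add F G)
  then show ?case by (simp add: distrib_left radpoly.radpoly_add)
next
  case (radpoly_cong F G)
  from radpoly_cong(3)[OF radpoly_cong(4)] show ?case
    by (rule radpoly.radpoly_cong) (simp add: radpoly_cong)
qed

lemma radpoly_cmult: "radpoly F \<Longrightarrow> radpoly (\<lambda>z. c * F z)"
  by (rule radpoly_mult_bihom[OF _ bihom_const])

lemma radpoly_zero: "radpoly (\<lambda>z. 0)"
  using radpoly_base[of "\<lambda>_. 0" 0 0 "\<lambda>_. 0"]
  by (simp add: smooth_curve_def has_derivs_const bihom_zero)

lemma radpoly_sum: "(\<And>i. i \<in> A \<Longrightarrow> radpoly (F i)) \<Longrightarrow> radpoly (\<lambda>z. \<Sum>i\<in>A. F i z)"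
  by (induction A rule: infinite_finite_induct) (auto intro: radpoly_add radpoly_zero)

lemma radpoly_sphere_continuous:
  assumes "radpoly F" "\<rho> \<in> I"
  shows "continuous_on (sphere 0 1) (\<lambda>w. F (\<rho> *\<^sub>R w))"
proof -
  have "continuous_on {z. norm z \<in> I} F"
    using radpoly_differentiable[OF assms(1)]
    by (auto intro!: continuous_at_imp_continuous_on differentiable_imp_continuous_within)
  then show ?thesis
    using assms(2) pos_I by (auto intro!: continuous_intros elim!: continuous_on_compose2)
qed

section \<open>Pairing with polynomials and the divergence theorem\<close>

text \<open>
  The volume of \<open>\<complex>\<^sup>n\<close> is proportional to \<open>t\<^sup>n\<^sup>-\<^sup>1 dt d\<sigma>\<close> for \<open>t = |z|\<^sup>2\<close>. With the factor \<open>t\<^sup>n\<^sup>-\<^sup>1\<close> this is therefore, up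
  to a constant, the density of the image of the measure \<open>F H dz\<close> under \<open>t\<close>, and integration by
  parts in \<open>\<complex>\<^sup>n\<close> takes a simple form.
\<close>

definition rmean :: "(complex ^ 'n::finite \<Rightarrow> complex) \<Rightarrow> (complex ^ 'n \<Rightarrow> complex) \<Rightarrow> real \<Rightarrow> complex" where
  "rmean H F t = complex_of_real (t ^ (CARD('n) - 1)) * sphere_mean (\<lambda>w. F (sqrt t *\<^sub>R w) * H (sqrt t *\<^sub>R w))"

lemma rmean_cong:
  assumes "t \<in> J" "\<And>z. norm z \<in> I \<Longrightarrow> F z = G z"
  shows "rmean H F t = rmean H G t"
proof -
  have "sphere_mean (\<lambda>w. F (sqrt t *\<^sub>R w) * H (sqrt t *\<^sub>R w)) = sphere_mean (\<lambda>w. G (sqrt t *\<^sub>R w) * H (sqrt t *\<^sub>R w))"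
    using assms by (intro sphere_mean_cong) (auto simp: J_def)
  then show ?thesis by (simp add: rmean_def)
qed

lemma pairing_continuous:
  assumes "radpoly F" "bihom s k H" "t \<in> J"
  shows "continuous_on (sphere 0 1) (\<lambda>w. F (sqrt t *\<^sub>R w) * H (sqrt t *\<^sub>R w))"
  using radpoly_sphere_continuous[OF radpoly_mult_bihom[OF assms(1,2)], of "sqrt t"] assms(3)
  by (simp add: J_def mult.commute)

lemma rmean_add:
  assumes "radpoly F" "radpoly G" "bihom s k H" "t \<in> J"
  shows "rmean H (\<lambda>z. F z + G z) t = rmean H F t + rmean H G t"
  using sphere_mean_add[OF pairing_continuous[OF assms(1,3,4)] pairing_continuous[OF assms(2,3,4)]]
  by (simp add: rmean_def distrib_right distrib_left)

lemma rmean_mult_right: "rmean H (\<lambda>z. N z * F z) t = rmean (\<lambda>z. N z * H z) F t"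
  by (simp add: rmean_def mult_ac)

lemma rmean_cmult: "rmean H (\<lambda>z. c * F z) t = c * rmean H F t"
  by (simp add: rmean_def mult.assoc sphere_mean_cmult)

lemma rmean_sum:
  assumes "finite A" "\<And>i. i \<in> A \<Longrightarrow> radpoly (F i)" "bihom s k H" "t \<in> J"
  shows "rmean H (\<lambda>z. \<Sum>i\<in>A. F i z) t = (\<Sum>i\<in>A. rmean H (F i) t)"
  using assms(1,2)
proof (induction A rule: finite_induct)
  case empty
  then show ?case by (simp add: rmean_def)
next
  case (insert i A)
  then show ?case using rmean_add[OF _ _ assms(3,4), of "F i" "\<lambda>z. \<Sum>i\<in>A. F i z"] by (simp add: radpoly_sum)
qed

lemma sphere_mean_scale:
  "bihom a c X \<Longrightarrow> sphere_mean (\<lambda>w. X (s *\<^sub>R w)) = complex_of_real s ^ (a + c) * sphere_mean X"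
  by (simp add: bihom_scale sphere_mean_cmult)

lemma rmean_base:
  fixes M H :: "complex ^ 'n::finite \<Rightarrow> complex"
  assumes "0 < t" "bihom A B (\<lambda>z. M z * H z)"
  shows "rmean H (\<lambda>z. b ((norm z)\<^sup>2) * M z) t
    = complex_of_real (t ^ (CARD('n) - 1)) * b t * complex_of_real (sqrt t) ^ (A + B) * sphere_mean (\<lambda>w. M w * H w)"
proof -
  have "sphere_mean (\<lambda>w. b ((norm (sqrt t *\<^sub>R w))\<^sup>2) * M (sqrt t *\<^sub>R w) * H (sqrt t *\<^sub>R w))
      = sphere_mean (\<lambda>w. b t * (M (sqrt t *\<^sub>R w) * H (sqrt t *\<^sub>R w)))"
    using assms(1) by (intro sphere_mean_cong) simp
  then show ?thesis using sphere_mean_scale[OF assms(2), of "sqrt t"]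
    by (simp add: rmean_def sphere_mean_cmult mult.assoc)
qed

lemma sqrt_power_even: "0 \<le> t \<Longrightarrow> complex_of_real (sqrt t) ^ (2 * e) = complex_of_real (t ^ e)"
  by (simp add: power_mult flip: of_real_power)

text \<open>
  If \<open>cnj z\<^sub>j M H\<close> is not balanced all terms vanish. Otherwise its bidegree is \<open>(e+1, e+1)\<close> with
  \<open>e = c + k\<close>, so that the left hand mean is a multiple of \<open>t\<^sup>n\<^sup>+\<^sup>e b(t)\<close>, and the factor \<open>n + e\<close> which its
  derivative produces is the one in Green's identity for \<open>M H\<close>.
\<close>

lemma rmean_adjoint_base:
  fixes M H :: "complex ^ 'n::finite \<Rightarrow> complex"
  assumes b: "smooth_curve J b" and M: "bihom a c M" and H: "bihom s k H" and t: "t \<in> J"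
  shows "(rmean (\<lambda>z. cnj (z $ j) * H z) (\<lambda>z. b ((norm z)\<^sup>2) * M z) has_vector_derivative
      rmean H (d_z j (\<lambda>z. b ((norm z)\<^sup>2) * M z)) t + rmean (d_z j H) (\<lambda>z. b ((norm z)\<^sup>2) * M z) t) (at t)"
proof -
  obtain b' where b': "smooth_curve J b'" "\<And>t. t \<in> J \<Longrightarrow> (b has_vector_derivative b' t) (at t)"
    using smooth_curve_derivative[OF b] by blast
  define n where "n = CARD('n)"
  have n: "n > 0" by (simp add: n_def)
  have t0: "t > 0" using t pos_J by auto
  let ?A = "a + s" and ?B = "c + k"
  have MH: "bihom ?A ?B (\<lambda>z. M z * H z)" by (rule bihom_mult[OF M H])
  have zMH: "bihom ?A (Suc ?B) (\<lambda>z. M z * (cnj (z $ j) * H z))"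
    using bihom_cnj_coord[OF MH] by (simp add: mult.left_commute)
  have zMH': "bihom ?A (Suc ?B) (\<lambda>z. (cnj (z $ j) * M z) * H z)"
    using bihom_cnj_coord[OF MH] by (simp add: mult.assoc)
  define L where "L = sphere_mean (\<lambda>w. M w * (cnj (w $ j) * H w))"
  have L': "sphere_mean (\<lambda>w. (cnj (w $ j) * M w) * H w) = L" by (simp add: L_def mult_ac)
  have green: "sphere_mean (d_z j (\<lambda>z. M z * H z)) = of_nat (n + ?B) * L"
    using sphere_mean_green[OF MH, of j] by (simp add: n_def L_def mult_ac)
  have lhs: "rmean (\<lambda>z. cnj (z $ j) * H z) (\<lambda>z. b ((norm z)\<^sup>2) * M z) t'
      = of_real (t' ^ (n - 1)) * b t' * complex_of_real (sqrt t') ^ (?A + Suc ?B) * L" if "0 < t'" for t'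
    unfolding rmean_base[OF that zMH] n_def L_def ..
  have r1: "rmean H (d_z j (\<lambda>z. b ((norm z)\<^sup>2) * M z)) t
     = rmean H (\<lambda>z. b' ((norm z)\<^sup>2) * (cnj (z $ j) * M z)) t + rmean H (\<lambda>z. b ((norm z)\<^sup>2) * d_z j M z) t"
    using rmean_cong[OF t, of "d_z j (\<lambda>z. b ((norm z)\<^sup>2) * M z)" _ H, OF d_z_base[OF b'(2) M]]
      rmean_add[OF radpoly_base[OF b'(1) bihom_cnj_coord[OF M]] radpoly_base[OF b bihom_d_z[OF M]] H t, of j j]
    by simp
  have r2: "rmean H (\<lambda>z. b ((norm z)\<^sup>2) * d_z j M z) t + rmean (d_z j H) (\<lambda>z. b ((norm z)\<^sup>2) * M z) t
      = of_real (t ^ (n - 1)) * b t * complex_of_real (sqrt t) ^ (?A - 1 + ?B) * (of_nat (n + ?B) * L)"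
  proof -
    have c1: "continuous_on (sphere 0 1) (\<lambda>w. d_z j M (sqrt t *\<^sub>R w) * H (sqrt t *\<^sub>R w))"
      and c2: "continuous_on (sphere 0 1) (\<lambda>w. M (sqrt t *\<^sub>R w) * d_z j H (sqrt t *\<^sub>R w))"
      using M H by (auto intro!: continuous_intros bihom_continuous[OF M, THEN continuous_on_compose2]
        bihom_continuous[OF H, THEN continuous_on_compose2] bihom_continuous[OF bihom_d_z[OF M], THEN continuous_on_compose2]
        bihom_continuous[OF bihom_d_z[OF H], THEN continuous_on_compose2])
    have e: "rmean H' (\<lambda>z. b ((norm z)\<^sup>2) * M' z) t = of_real (t ^ (n - 1)) * b t * sphere_mean (\<lambda>w. M' (sqrt t *\<^sub>R w) * H' (sqrt t *\<^sub>R w))"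
      for M' H' :: "complex ^ 'n \<Rightarrow> complex"
    proof -
      have "sphere_mean (\<lambda>w. b ((norm (sqrt t *\<^sub>R w))\<^sup>2) * M' (sqrt t *\<^sub>R w) * H' (sqrt t *\<^sub>R w))
         = sphere_mean (\<lambda>w. b t * (M' (sqrt t *\<^sub>R w) * H' (sqrt t *\<^sub>R w)))"
        using t0 by (intro sphere_mean_cong) simp
      then show ?thesis by (simp add: rmean_def n_def sphere_mean_cmult mult.assoc)
    qed
    have "sphere_mean (\<lambda>w. d_z j M (sqrt t *\<^sub>R w) * H (sqrt t *\<^sub>R w)) + sphere_mean (\<lambda>w. M (sqrt t *\<^sub>R w) * d_z j H (sqrt t *\<^sub>R w))
       = sphere_mean (\<lambda>w. d_z j (\<lambda>z. M z * H z) (sqrt t *\<^sub>R w))"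
      unfolding sphere_mean_add[OF c1 c2, symmetric] d_z_bihom_mult[OF M H] ..
    also have "\<dots> = complex_of_real (sqrt t) ^ (?A - 1 + ?B) * (of_nat (n + ?B) * L)"
      unfolding sphere_mean_scale[OF bihom_d_z[OF MH]] green ..
    finally show ?thesis unfolding e by (simp only: distrib_left[symmetric] mult.assoc)
  qed
  have r3: "rmean H (\<lambda>z. b' ((norm z)\<^sup>2) * (cnj (z $ j) * M z)) t
      = of_real (t ^ (n - 1)) * b' t * complex_of_real (sqrt t) ^ (?A + Suc ?B) * L"
    unfolding rmean_base[OF t0 zMH'] n_def L' ..
  show ?thesis
  proof (cases "?A = Suc ?B")
    case False
    then have L: "L = 0" unfolding L_def by (rule sphere_mean_unbalanced[OF zMH])
    have "((\<lambda>t. 0) has_vector_derivative (0::complex)) (at t)" by (rule has_vector_derivative_const)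
    then have "(rmean (\<lambda>z. cnj (z $ j) * H z) (\<lambda>z. b ((norm z)\<^sup>2) * M z) has_vector_derivative 0) (at t)"
      by (rule has_vector_derivative_transform_within_open[OF _ open_greaterThan[of 0]]) (use t0 lhs L in auto)
    then show ?thesis using r1 r2 r3 L by simp
  next
    case True
    define m where "m = n + ?B"
    have m: "m > 0" using n by (simp add: m_def)
    have pw: "complex_of_real (t' ^ (n - 1)) * complex_of_real (sqrt t') ^ (?A + Suc ?B) = complex_of_real (t' ^ m)" if "0 < t'" for t'
    proof -
      have "complex_of_real (sqrt t') ^ (?A + Suc ?B) = complex_of_real (t' ^ Suc ?B)"
      proof -
        have e: "?A + Suc ?B = 2 * Suc ?B" using True by simp
        show ?thesis unfolding e using that by (intro sqrt_power_even) simp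
      qed
      moreover have "t' ^ (n - 1) * t' ^ Suc ?B = t' ^ m"
        unfolding power_add[symmetric] m_def using n by (intro arg_cong2[where f="(^)"]) auto
      ultimately show ?thesis by (simp only: of_real_mult[symmetric])
    qed
    have pw2: "complex_of_real (t ^ (n - 1)) * complex_of_real (sqrt t) ^ (?A - 1 + ?B) = complex_of_real (t ^ (m - 1))"
    proof -
      have "complex_of_real (sqrt t) ^ (?A - 1 + ?B) = complex_of_real (t ^ ?B)"
      proof -
        have e: "?A - 1 + ?B = 2 * ?B" using True by simp
        show ?thesis unfolding e using t0 by (intro sqrt_power_even) simp
      qed
      moreover have "t ^ (n - 1) * t ^ ?B = t ^ (m - 1)"
        unfolding power_add[symmetric] m_def using n by (intro arg_cong2[where f="(^)"]) auto
      ultimately show ?thesis by (simp only: of_real_mult[symmetric])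
    qed
    have "((\<lambda>t. complex_of_real (t ^ m)) has_vector_derivative complex_of_real (of_nat m * t ^ (m - 1))) (at t)"
      using DERIV_pow[of m t] by (intro has_vector_derivative_of_real) simp
    from has_vector_derivative_mult[OF this b'(2)[OF t]]
    have "((\<lambda>t. complex_of_real (t ^ m) * b t * L) has_vector_derivative
        (complex_of_real (t ^ m) * b' t + complex_of_real (of_nat m * t ^ (m - 1)) * b t) * L) (at t)"
      by (rule has_vector_derivative_mult_left)
    then have "(rmean (\<lambda>z. cnj (z $ j) * H z) (\<lambda>z. b ((norm z)\<^sup>2) * M z) has_vector_derivative
        (complex_of_real (t ^ m) * b' t + complex_of_real (of_nat m * t ^ (m - 1)) * b t) * L) (at t)"
    proof (rule has_vector_derivative_transform_within_open[OF _ open_greaterThan[of 0]])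
      fix t' :: real assume "t' \<in> {0<..}"
      then have t': "t' > 0" by simp
      show "complex_of_real (t' ^ m) * b t' * L = rmean (\<lambda>z. cnj (z $ j) * H z) (\<lambda>z. b ((norm z)\<^sup>2) * M z) t'"
        unfolding lhs[OF t'] pw[OF t', symmetric] by (simp only: mult_ac)
    qed (use t0 in simp)
    moreover have "rmean H (\<lambda>z. b' ((norm z)\<^sup>2) * (cnj (z $ j) * M z)) t = complex_of_real (t ^ m) * b' t * L"
      unfolding r3 pw[OF t0, symmetric] by (simp only: mult_ac)
    moreover have "rmean H (\<lambda>z. b ((norm z)\<^sup>2) * d_z j M z) t + rmean (d_z j H) (\<lambda>z. b ((norm z)\<^sup>2) * M z) t
      = complex_of_real (of_nat m * t ^ (m - 1)) * b t * L"
      unfolding r2 of_real_mult pw2[symmetric] by (simp only: m_def mult_ac of_real_of_nat_eq)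
    ultimately show ?thesis unfolding r1 by (simp add: add.assoc distrib_right)
  qed
qed

text \<open>
  The divergence theorem for \<open>\<partial>\<^sub>j (F H)\<close> on balls, differentiated in \<open>t\<close>: in the pairing, \<open>\<partial>\<^sub>j\<close> on \<open>F\<close>
  becomes multiplication of \<open>H\<close> by \<open>cnj z\<^sub>j\<close> followed by \<open>d/dt\<close>, up to a term with \<open>\<partial>\<^sub>j H\<close>.
\<close>

lemma rmean_adjoint:
  fixes H :: "complex ^ 'n::finite \<Rightarrow> complex"
  assumes "radpoly F" and H: "bihom s k H" and t: "t \<in> J"
  shows "(rmean (\<lambda>z. cnj (z $ j) * H z) F has_vector_derivative rmean H (d_z j F) t + rmean (d_z j H) F t) (at t)"
  using assms(1)
proof (induction rule: radpoly.induct)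
  case (radpoly_base b a c M)
  then show ?case by (rule rmean_adjoint_base[OF _ _ H t])
next
  case (radpoly_add F G)
  have "rmean H (d_z j (\<lambda>z. F z + G z)) t = rmean H (\<lambda>z. d_z j F z + d_z j G z) t"
    by (rule rmean_cong[OF t]) (intro d_z_add radpoly_differentiable radpoly_add)
  then have e1: "rmean H (d_z j (\<lambda>z. F z + G z)) t = rmean H (d_z j F) t + rmean H (d_z j G) t"
    using rmean_add[OF radpoly_d_z[OF radpoly_add(1)] radpoly_d_z[OF radpoly_add(2)] H t] by simp
  have e2: "rmean (d_z j H) (\<lambda>z. F z + G z) t = rmean (d_z j H) F t + rmean (d_z j H) G t"
    by (rule rmean_add[OF radpoly_add(1,2) bihom_d_z[OF H] t])
  have "((\<lambda>t. rmean (\<lambda>z. cnj (z $ j) * H z) F t + rmean (\<lambda>z. cnj (z $ j) * H z) G t) has_vector_derivative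
     (rmean H (d_z j F) t + rmean (d_z j H) F t) + (rmean H (d_z j G) t + rmean (d_z j H) G t)) (at t)"
    by (rule has_vector_derivative_add[OF radpoly_add(3,4)])
  then have "(rmean (\<lambda>z. cnj (z $ j) * H z) (\<lambda>z. F z + G z) has_vector_derivative
     (rmean H (d_z j F) t + rmean (d_z j H) F t) + (rmean H (d_z j G) t + rmean (d_z j H) G t)) (at t)"
    by (rule has_vector_derivative_transform_within_open[OF _ open_J t])
      (rule rmean_add[OF radpoly_add(1,2) bihom_cnj_coord[OF H], symmetric])
  then show ?case unfolding e1 e2 by (simp only: add_ac)
next
  case (radpoly_cong F G)
  have "rmean H (d_z j G) t = rmean H (d_z j F) t"
    by (rule rmean_cong[OF t], rule d_z_cong(1)[OF open_shell]) (use radpoly_cong in auto)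
  moreover have "rmean X G t' = rmean X F t'" if "t' \<in> J" for X t'
    by (rule rmean_cong[OF that radpoly_cong(2)])
  ultimately show ?case
    using has_vector_derivative_transform_within_open[OF radpoly_cong(3) open_J t] t by simp
qed

end

section \<open>Iterating the twisted operators\<close>

text \<open>
  The common form of \<open>Z\<^sub>j\<close> and, after complex conjugation, of its conjugate operator.
\<close>

definition twisted_d_z :: "('n::finite \<Rightarrow> 'n \<Rightarrow> complex) \<Rightarrow> ('n \<Rightarrow> 'n \<Rightarrow> complex) \<Rightarrow> 'n \<Rightarrow>
    (complex ^ 'n \<Rightarrow> complex) \<Rightarrow> complex ^ 'n \<Rightarrow> complex" where
  "twisted_d_z e v j F z = d_z j F z + (\<Sum>l\<in>UNIV. e j l * z $ l + v j l * cnj (z $ l)) * F z"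

text \<open>
  The product of the linear forms \<open>s cnj z\<^sub>j + \<Sum>\<^sub>l v\<^sub>j\<^sub>l cnj z\<^sub>l\<close> along the word, as a polynomial in \<open>s\<close>. The variable
  \<open>s\<close> stands for \<open>d/dt\<close>.
\<close>

definition symbol_poly :: "('n::finite \<Rightarrow> 'n \<Rightarrow> complex) \<Rightarrow> 'n list \<Rightarrow> complex ^ 'n \<Rightarrow> complex poly" where
  "symbol_poly v w z = prod_list (map (\<lambda>j. [:\<Sum>l\<in>UNIV. v j l * cnj (z $ l), cnj (z $ j):]) w)"

lemma coeff_linear_mult_Suc: "coeff ([:x, y:] * p) (Suc k) = x * coeff p (Suc k) + y * coeff p k"
  for x y :: complex
  by simp

lemma coeff_linear_mult_0: "coeff ([:x, y:] * p) 0 = x * coeff p 0"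
  for x y :: complex
  by simp

lemma symbol_poly_Cons:
  "symbol_poly v (j # w) z = [:\<Sum>l\<in>UNIV. v j l * cnj (z $ l), cnj (z $ j):] * symbol_poly v w z"
  by (simp add: symbol_poly_def)

lemma bihom_linear_cnj: "bihom a b M \<Longrightarrow> bihom a (Suc b) (\<lambda>z. (\<Sum>l\<in>UNIV. c l * cnj (z $ l)) * M z)"
proof -
  assume M: "bihom a b M"
  have "bihom a (Suc b) (\<lambda>z. \<Sum>l\<in>UNIV. c l * (cnj (z $ l) * M z))"
    by (intro bihom_sum bihom_cmult bihom_cnj_coord M)
  then show ?thesis by (simp add: sum_distrib_right mult.assoc)
qed

lemma bihom_coeff_symbol_poly: "bihom 0 (length w) (\<lambda>z. coeff (symbol_poly v w z) k)"
proof (induction w arbitrary: k)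
  case Nil
  then show ?case by (cases k) (auto simp: symbol_poly_def bihom_const bihom_zero coeff_eq_0)
next
  case (Cons j w)
  show ?case
  proof (cases k)
    case 0
    then show ?thesis unfolding symbol_poly_Cons 0 coeff_linear_mult_0
      using bihom_linear_cnj[OF Cons.IH[of 0], of "v j"] by simp
  next
    case (Suc k')
    then show ?thesis unfolding symbol_poly_Cons Suc coeff_linear_mult_Suc
      using bihom_add[OF bihom_linear_cnj[OF Cons.IH[of "Suc k'"], of "v j"] bihom_cnj_coord[OF Cons.IH[of k'], of j]]
      by simp
  qed
qed

lemma coeff_symbol_poly_large: "length w < k \<Longrightarrow> coeff (symbol_poly v w z) k = 0"
proof (induction w arbitrary: k)
  case Nil
  then show ?case by (simp add: symbol_poly_def coeff_eq_0)
next
  case (Cons j w)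
  then obtain k' where "k = Suc k'" by (cases k) auto
  then show ?case using Cons by (simp only: symbol_poly_Cons coeff_linear_mult_Suc) simp
qed

lemma coeff_symbol_poly_lead: "coeff (symbol_poly v w z) (length w) = wmon_cnj w z"
proof (induction w)
  case Nil
  then show ?case by (simp add: symbol_poly_def)
next
  case (Cons j w)
  then show ?case using coeff_symbol_poly_large[of w "Suc (length w)" v z]
    by (simp only: symbol_poly_Cons list.size(4) add_Suc_right add_0_right One_nat_def coeff_linear_mult_Suc) simp
qed

context radial_domain
begin

lemma radpoly_linear: "radpoly F \<Longrightarrow> radpoly (\<lambda>z. (\<Sum>l\<in>UNIV. x l * z $ l + y l * cnj (z $ l)) * F z)"
proof -
  assume F: "radpoly F"
  have "radpoly (\<lambda>z. \<Sum>l\<in>UNIV. x l * (z $ l * F z) + y l * (cnj (z $ l) * F z))"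
    using bihom_coord[OF bihom_const[of 1]] bihom_cnj_coord[OF bihom_const[of 1]]
    by (intro radpoly_sum radpoly_add radpoly_cmult radpoly_mult_bihom[OF F]) auto
  then show ?thesis by (simp add: sum_distrib_right distrib_right mult.assoc)
qed

lemma radpoly_twisted: "radpoly F \<Longrightarrow> radpoly (twisted_d_z e v j F)"
  unfolding twisted_d_z_def[abs_def] by (intro radpoly_add radpoly_d_z radpoly_linear)

lemma radpoly_twisted_word: "radpoly F \<Longrightarrow> radpoly (foldr (twisted_d_z e v) w F)"
  by (induction w) (auto intro: radpoly_twisted)

lemma rmean_twisted:
  assumes F: "radpoly F" and H: "bihom s k H" and t: "t \<in> J"
  shows "rmean H (twisted_d_z e v j F) t = rmean H (d_z j F) t
    + (\<Sum>l\<in>UNIV. e j l * rmean (\<lambda>z. z $ l * H z) F t + v j l * rmean (\<lambda>z. cnj (z $ l) * H z) F t)"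
proof -
  have r1: "radpoly (\<lambda>z. z $ l * F z)" for l
    using radpoly_mult_bihom[OF F bihom_coord[OF bihom_const[of 1]]] by simp
  have r2: "radpoly (\<lambda>z. cnj (z $ l) * F z)" for l
    using radpoly_mult_bihom[OF F bihom_cnj_coord[OF bihom_const[of 1]]] by simp
  have r3: "radpoly (\<lambda>z. e j l * (z $ l * F z) + v j l * (cnj (z $ l) * F z))" for l
    by (intro radpoly_add radpoly_cmult r1 r2)
  have "rmean H (\<lambda>z. \<Sum>l\<in>UNIV. e j l * (z $ l * F z) + v j l * (cnj (z $ l) * F z)) t
     = (\<Sum>l\<in>UNIV. rmean H (\<lambda>z. e j l * (z $ l * F z) + v j l * (cnj (z $ l) * F z)) t)"
    by (rule rmean_sum[OF finite r3 H t])
  also have "\<dots> = (\<Sum>l\<in>UNIV. e j l * rmean (\<lambda>z. z $ l * H z) F t + v j l * rmean (\<lambda>z. cnj (z $ l) * H z) F t)"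
    by (simp add: rmean_add[OF radpoly_cmult[OF r1] radpoly_cmult[OF r2] H t] rmean_cmult rmean_mult_right)
  finally have "rmean H (\<lambda>z. (\<Sum>l\<in>UNIV. e j l * z $ l + v j l * cnj (z $ l)) * F z) t
     = (\<Sum>l\<in>UNIV. e j l * rmean (\<lambda>z. z $ l * H z) F t + v j l * rmean (\<lambda>z. cnj (z $ l) * H z) F t)"
    by (simp add: sum_distrib_right distrib_right mult.assoc)
  then show ?thesis
    unfolding twisted_d_z_def[abs_def] using rmean_add[OF radpoly_d_z[OF F] radpoly_linear[OF F] H t] by simp
qed

text \<open>
  The adjoint relation, read as a formula for the pairing of \<open>\<partial>\<^sub>j F\<close>.
\<close>

lemma rmean_unique_derivative:
  assumes F: "radpoly F" and H: "bihom s k H" and t: "t \<in> J"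
    and der: "(g has_vector_derivative g') (at t)"
    and eq: "\<And>t. t \<in> J \<Longrightarrow> rmean (\<lambda>z. cnj (z $ j) * H z) F t = g t"
  shows "rmean H (d_z j F) t + rmean (d_z j H) F t = g'"
proof -
  have "(rmean (\<lambda>z. cnj (z $ j) * H z) F has_vector_derivative g') (at t)"
    by (rule has_vector_derivative_transform_within_open[OF der open_J t]) (simp add: eq)
  then show ?thesis using vector_derivative_unique_at rmean_adjoint[OF F H t] by blast
qed

text \<open>
  The initial functions are sums of radial functions times harmonic polynomials of one bidegree \<open>(p, q)\<close>.
  With the normalization by the power of \<open>|z|\<close>, pairing with a test polynomial of bidegree \<open>(q, p)\<close> gives
  back \<open>bs i\<close> exactly: the weight \<open>t\<^sup>n\<^sup>-\<^sup>1\<close> and the homogeneity \<open>t\<^sup>p\<^sup>+\<^sup>q\<close> cancel it.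
\<close>

context
  fixes bs :: "nat \<Rightarrow> real \<Rightarrow> complex" and Q :: "nat \<Rightarrow> complex ^ 'n::finite \<Rightarrow> complex"
    and p q m :: nat and F0 :: "complex ^ 'n \<Rightarrow> complex"
  assumes tower: "deriv_tower J bs"
    and Q: "\<And>i. i \<le> m \<Longrightarrow> harmonic p q (Q i)"
    and F0: "\<And>z. norm z \<in> I \<Longrightarrow> F0 z = complex_of_real (1 / (norm z) ^ (2 * (CARD('n) - 1 + p + q)))
              * (\<Sum>i\<le>m. bs i ((norm z)\<^sup>2) * Q i z)"
begin

lemma F0_eq:
  "norm z \<in> I \<Longrightarrow> N = CARD('n) - 1 + p + q \<Longrightarrow>
    F0 z = complex_of_real (1 / ((norm z)\<^sup>2) ^ N) * (\<Sum>i\<le>m. bs i ((norm z)\<^sup>2) * Q i z)"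
  using F0 by (simp only: power_mult)

lemma radpoly_initial: "radpoly F0"
proof -
  define N where "N = CARD('n) - 1 + p + q"
  have "radpoly (\<lambda>z. (complex_of_real (((norm z)\<^sup>2) powr (- real N)) * bs i ((norm z)\<^sup>2)) * Q i z)" if "i \<le> m" for i
  proof (rule radpoly_base)
    show "smooth_curve J (\<lambda>t. complex_of_real (t powr (- real N)) * bs i t)"
      using tower_smooth_curve[OF tower, of i] has_derivs_powr[OF pos_J]
      by (auto simp: smooth_curve_def intro: has_derivs_mult)
    show "bihom p q (Q i)" using Q[OF that] by (rule harmonic_bihom)
  qed
  then have "radpoly (\<lambda>z. \<Sum>i\<le>m. (complex_of_real (((norm z)\<^sup>2) powr (- real N)) * bs i ((norm z)\<^sup>2)) * Q i z)"
    by (intro radpoly_sum) auto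
  then show ?thesis
  proof (rule radpoly_cong)
    fix z :: "complex ^ 'n" assume z: "norm z \<in> I"
    then have pos: "norm z > 0" using pos_I by auto
    have "((norm z)\<^sup>2) powr (- real N) = 1 / ((norm z)\<^sup>2) ^ N"
      using pos by (simp add: powr_minus_divide powr_realpow)
    then show "F0 z = (\<Sum>i\<le>m. (complex_of_real (((norm z)\<^sup>2) powr (- real N)) * bs i ((norm z)\<^sup>2)) * Q i z)"
      by (simp only: F0_eq[OF z N_def] sum_distrib_left mult.assoc)
  qed
qed

lemma rmean_initial:
  assumes H: "bihom s k H" and t: "t \<in> J"
  shows "rmean H F0 t = (\<Sum>i\<le>m. complex_of_real (t ^ (CARD('n) - 1) / t ^ (CARD('n) - 1 + p + q)) * bs i t *
            complex_of_real (sqrt t) ^ (p + s + (q + k)) * sphere_mean (\<lambda>z. Q i z * H z))"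
proof -
  have t0: "t > 0" using t pos_J by auto
  let ?N = "CARD('n) - 1 + p + q"
  have "rmean H F0 t = complex_of_real (t ^ (CARD('n) - 1)) * sphere_mean (\<lambda>w. \<Sum>i\<le>m. complex_of_real (1 / t ^ ?N) * bs i t *
      complex_of_real (sqrt t) ^ (p + s + (q + k)) * (Q i w * H w))"
    unfolding rmean_def
  proof (intro arg_cong2[where f="(*)"] refl sphere_mean_cong)
    fix w :: "complex ^ 'n" assume w: "norm w = 1"
    have "F0 (sqrt t *\<^sub>R w) = complex_of_real (1 / t ^ ?N) * (\<Sum>i\<le>m. bs i t * Q i (sqrt t *\<^sub>R w))"
    proof -
      have n: "norm (sqrt t *\<^sub>R w) \<in> I" "(norm (sqrt t *\<^sub>R w))\<^sup>2 = t" using t t0 w by (auto simp: J_def)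
      show ?thesis by (rule F0_eq[OF n(1) refl, unfolded n(2)])
    qed
    moreover have "Q i (sqrt t *\<^sub>R w) * H (sqrt t *\<^sub>R w) = complex_of_real (sqrt t) ^ (p + s + (q + k)) * (Q i w * H w)"
      if "i \<le> m" for i
      using bihom_scale[OF bihom_mult[OF harmonic_bihom[OF Q[OF that]] H], of "sqrt t" w] by simp
    ultimately show "F0 (sqrt t *\<^sub>R w) * H (sqrt t *\<^sub>R w) = (\<Sum>i\<le>m. complex_of_real (1 / t ^ ?N) * bs i t *
      complex_of_real (sqrt t) ^ (p + s + (q + k)) * (Q i w * H w))"
      by (simp add: sum_distrib_left sum_distrib_right mult.assoc)
  qed
  also have "sphere_mean (\<lambda>w. \<Sum>i\<le>m. complex_of_real (1 / t ^ ?N) * bs i t *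
      complex_of_real (sqrt t) ^ (p + s + (q + k)) * (Q i w * H w))
     = (\<Sum>i\<le>m. complex_of_real (1 / t ^ ?N) * bs i t *
      complex_of_real (sqrt t) ^ (p + s + (q + k)) * sphere_mean (\<lambda>w. Q i w * H w))"
    using Q by (subst sphere_mean_bihom_sum[OF finite_atMost bihom_cmult[OF bihom_mult[OF harmonic_bihom H]]])
      (auto simp: sphere_mean_cmult)
  finally show ?thesis by (simp add: sum_distrib_left mult.assoc)
qed

lemma sphere_mean_Q_zero:
  assumes "i \<le> m" "bihom s k H" "p + s \<noteq> q + k \<or> s + k < p + q"
  shows "sphere_mean (\<lambda>z. Q i z * H z) = 0"
  using assms(3)
proof
  assume "p + s \<noteq> q + k"
  then show ?thesis by (intro sphere_mean_unbalanced[OF bihom_mult[OF harmonic_bihom[OF Q[OF assms(1)]] assms(2)]])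
next
  assume "s + k < p + q"
  then show ?thesis by (intro sphere_mean_harmonic_lower[OF Q[OF assms(1)] assms(2)])
qed

text \<open>
  Passing an operator from \<open>F\<close> to the test polynomial \<open>H\<close> of bidegree \<open>(s, k)\<close> changes its bidegree to
  \<open>(s, k+1)\<close>, \<open>(s-1, k)\<close> or \<open>(s+1, k)\<close>, so \<open>k - s\<close> grows by at most \<open>1\<close>. A non-zero mean against
  \<open>Q i\<close> at the end requires \<open>k - s = p - q\<close>. In the first case this value cannot be reached. In the second
  case it is only reached if every step increases \<open>k - s\<close>, which never raises \<open>s\<close>; the final degree is
  then below \<open>p + q\<close>, and the harmonicity of \<open>Q i\<close> applies.
\<close>

lemma rmean_twisted_vanish:
  "length w + k + q < p + s \<or> length w + k + q = p + s \<and> s < q \<Longrightarrow> bihom s k H \<Longrightarrow> t \<in> J \<Longrightarrow>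
    rmean H (foldr (twisted_d_z e v) w F0) t = 0"
proof (induction w arbitrary: s k H t)
  case Nil
  then have "p + s \<noteq> q + k \<or> s + k < p + q" by auto
  then show ?case using Nil by (simp add: rmean_initial sphere_mean_Q_zero)
next
  case (Cons j w)
  let ?F = "foldr (twisted_d_z e v) w F0"
  note H = Cons.prems(2) and t = Cons.prems(3)
  have F: "radpoly ?F" by (rule radpoly_twisted_word[OF radpoly_initial])
  have 1: "rmean (\<lambda>z. cnj (z $ l) * H z) ?F t' = 0" if "t' \<in> J" for l t'
    using Cons.prems(1) by (intro Cons.IH[OF _ bihom_cnj_coord[OF H] that]) auto
  have 2: "rmean (\<lambda>z. z $ l * H z) ?F t = 0" for l
    using Cons.prems(1) by (intro Cons.IH[OF _ bihom_coord[OF H] t]) auto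
  have 3: "rmean (d_z j H) ?F t = 0"
  proof (cases "s = 0")
    case True
    then show ?thesis using H by (simp add: d_z_bihom_0 rmean_def)
  next
    case False
    then show ?thesis using Cons.prems(1) by (intro Cons.IH[OF _ bihom_d_z[OF H] t]) auto
  qed
  have "rmean H (d_z j ?F) t + rmean (d_z j H) ?F t = 0"
    by (rule rmean_unique_derivative[OF F H t has_vector_derivative_const]) (rule 1)
  then show ?case using 1[OF t] 2 3 by (simp add: rmean_twisted[OF F H t])
qed

text \<open>
  In the extremal case \<open>s = q\<close> only the steps to \<open>(s, k+1)\<close> survive: multiplication by \<open>cnj z\<^sub>j\<close> together with
  \<open>d/dt\<close>, and multiplication by \<open>\<Sum>\<^sub>l v\<^sub>j\<^sub>l cnj z\<^sub>l\<close>. Along the word they multiply out to the symbol polynomial.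
\<close>

lemma rmean_twisted_top:
  "length w + k = p \<Longrightarrow> bihom q k H \<Longrightarrow> t \<in> J \<Longrightarrow>
    rmean H (foldr (twisted_d_z e v) w F0) t
      = (\<Sum>i\<le>m. \<Sum>\<kappa>\<le>length w. bs (i + \<kappa>) t * sphere_mean (\<lambda>z. Q i z * (coeff (symbol_poly v w z) \<kappa> * H z)))"
proof (induction w arbitrary: k H t)
  case Nil
  then have k: "k = p" by simp
  have t0: "t > 0" using Nil pos_J by auto
  let ?N = "CARD('n) - 1 + p + q"
  have "complex_of_real (sqrt t) ^ (p + q + (q + k)) = complex_of_real (t ^ (p + q))"
  proof -
    have e: "p + q + (q + k) = 2 * (p + q)" using k by simp
    show ?thesis unfolding e using t0 by (intro sqrt_power_even) simp
  qed
  moreover have "t ^ c / t ^ (c + p + q) * t ^ (p + q) = 1" for c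
    using t0 by (simp add: power_add)
  ultimately have one: "complex_of_real (t ^ (CARD('n) - 1) / t ^ ?N) * complex_of_real (sqrt t) ^ (p + q + (q + k)) = 1"
    by (simp only: of_real_mult[symmetric] of_real_1)
  have "complex_of_real (t ^ (CARD('n) - 1) / t ^ ?N) * bs i t * complex_of_real (sqrt t) ^ (p + q + (q + k)) = bs i t" for i
    using arg_cong[OF one, of "\<lambda>x. x * bs i t"] by (simp only: mult_ac mult_1)
  then show ?case unfolding foldr.simps id_apply rmean_initial[OF Nil(2,3)]
    by (simp add: symbol_poly_def)
next
  case (Cons j w)
  let ?F = "foldr (twisted_d_z e v) w F0"
  note H = Cons.prems(2) and t = Cons.prems(3)
  have F: "radpoly ?F" by (rule radpoly_twisted_word[OF radpoly_initial])
  let ?N = "length w"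
  let ?L = "\<lambda>z. \<Sum>l\<in>UNIV. v j l * cnj (z $ l)"
  let ?V = "\<lambda>\<kappa> z. coeff (symbol_poly v w z) \<kappa>"
  have z1: "rmean (\<lambda>z. cnj (z $ l) * H z) ?F t' = (\<Sum>i\<le>m. \<Sum>\<kappa>\<le>?N. bs (i + \<kappa>) t' * sphere_mean (\<lambda>z. Q i z * (?V \<kappa> z * (cnj (z $ l) * H z))))"
    if "t' \<in> J" for l t'
    using Cons.prems(1) by (intro Cons.IH[OF _ bihom_cnj_coord[OF H] that]) simp
  have z2: "rmean (\<lambda>z. z $ l * H z) ?F t = 0" for l
    using Cons.prems(1) by (intro rmean_twisted_vanish[OF _ bihom_coord[OF H] t]) simp
  have z3: "rmean (d_z j H) ?F t = 0"
  proof (cases "q = 0")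
    case True
    then show ?thesis using H by (simp add: d_z_bihom_0 rmean_def)
  next
    case False
    then show ?thesis using Cons.prems(1) by (intro rmean_twisted_vanish[OF _ bihom_d_z[OF H] t]) (simp, arith)
  qed
  define C where "C = (\<lambda>i \<kappa>. sphere_mean (\<lambda>z. Q i z * (?V \<kappa> z * (cnj (z $ j) * H z))))"
  define E where "E = (\<lambda>i \<kappa>. sphere_mean (\<lambda>z. Q i z * (?V \<kappa> z * (?L z * H z))))"
  have bQ: "bihom p q (Q i)" if "i \<le> m" for i using Q[OF that] by (rule harmonic_bihom)
  have E: "E i \<kappa> = (\<Sum>l\<in>UNIV. v j l * sphere_mean (\<lambda>z. Q i z * (?V \<kappa> z * (cnj (z $ l) * H z))))" if "i \<le> m" for i \<kappa>
  proof -
    have b: "bihom (p + (0 + q)) (q + (?N + Suc k)) (\<lambda>z. v j l * (Q i z * (?V \<kappa> z * (cnj (z $ l) * H z))))" for l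
      by (intro bihom_cmult bihom_mult bQ that bihom_coeff_symbol_poly bihom_cnj_coord H)
    have "E i \<kappa> = sphere_mean (\<lambda>z. \<Sum>l\<in>UNIV. v j l * (Q i z * (?V \<kappa> z * (cnj (z $ l) * H z))))"
      unfolding E_def by (rule sphere_mean_cong) (simp add: sum_distrib_left sum_distrib_right mult_ac)
    also have "\<dots> = (\<Sum>l\<in>UNIV. sphere_mean (\<lambda>z. v j l * (Q i z * (?V \<kappa> z * (cnj (z $ l) * H z)))))"
      by (rule sphere_mean_bihom_sum[OF finite b])
    finally show ?thesis by (simp add: sphere_mean_cmult)
  qed
  have "((\<lambda>t. \<Sum>i\<le>m. \<Sum>\<kappa>\<le>?N. bs (i + \<kappa>) t * C i \<kappa>) has_vector_derivative
      (\<Sum>i\<le>m. \<Sum>\<kappa>\<le>?N. bs (Suc (i + \<kappa>)) t * C i \<kappa>)) (at t)"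
    using tower t unfolding deriv_tower_def
    by (intro has_vector_derivative_sum has_vector_derivative_mult_left) auto
  then have "rmean H (d_z j ?F) t + rmean (d_z j H) ?F t = (\<Sum>i\<le>m. \<Sum>\<kappa>\<le>?N. bs (Suc (i + \<kappa>)) t * C i \<kappa>)"
    by (rule rmean_unique_derivative[OF F H t]) (simp only: z1 C_def)
  then have d: "rmean H (d_z j ?F) t = (\<Sum>i\<le>m. \<Sum>\<kappa>\<le>?N. bs (Suc (i + \<kappa>)) t * C i \<kappa>)"
    unfolding z3 by simp
  have "(\<Sum>l\<in>UNIV. v j l * rmean (\<lambda>z. cnj (z $ l) * H z) ?F t) = (\<Sum>i\<le>m. \<Sum>\<kappa>\<le>?N. bs (i + \<kappa>) t * E i \<kappa>)"
  proof -
    have "(\<Sum>l\<in>UNIV. v j l * rmean (\<lambda>z. cnj (z $ l) * H z) ?F t)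
      = (\<Sum>l\<in>UNIV. \<Sum>i\<le>m. \<Sum>\<kappa>\<le>?N. bs (i + \<kappa>) t * (v j l * sphere_mean (\<lambda>z. Q i z * (?V \<kappa> z * (cnj (z $ l) * H z)))))"
      unfolding z1[OF t] by (simp add: sum_distrib_left mult.left_commute)
    also have "\<dots> = (\<Sum>i\<le>m. \<Sum>l\<in>UNIV. \<Sum>\<kappa>\<le>?N. bs (i + \<kappa>) t * (v j l * sphere_mean (\<lambda>z. Q i z * (?V \<kappa> z * (cnj (z $ l) * H z)))))"
      by (rule sum.swap)
    also have "\<dots> = (\<Sum>i\<le>m. \<Sum>\<kappa>\<le>?N. bs (i + \<kappa>) t * E i \<kappa>)"
    proof (rule sum.cong[OF refl])
      fix i assume "i \<in> {..m}"
      then show "(\<Sum>l\<in>UNIV. \<Sum>\<kappa>\<le>?N. bs (i + \<kappa>) t * (v j l * sphere_mean (\<lambda>z. Q i z * (?V \<kappa> z * (cnj (z $ l) * H z)))))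
         = (\<Sum>\<kappa>\<le>?N. bs (i + \<kappa>) t * E i \<kappa>)"
        by (subst sum.swap) (simp add: E sum_distrib_left)
    qed
    finally show ?thesis .
  qed
  then have s: "rmean H (twisted_d_z e v j ?F) t
     = (\<Sum>i\<le>m. (\<Sum>\<kappa>\<le>?N. bs (Suc (i + \<kappa>)) t * C i \<kappa>) + (\<Sum>\<kappa>\<le>?N. bs (i + \<kappa>) t * E i \<kappa>))"
    unfolding rmean_twisted[OF F H t] d by (simp add: z2 sum.distrib)
  have c0: "sphere_mean (\<lambda>z. Q i z * (coeff (symbol_poly v (j # w) z) 0 * H z)) = E i 0" for i
    unfolding E_def symbol_poly_Cons coeff_linear_mult_0 by (simp add: mult_ac)
  have c1: "sphere_mean (\<lambda>z. Q i z * (coeff (symbol_poly v (j # w) z) (Suc \<kappa>) * H z)) = E i (Suc \<kappa>) + C i \<kappa>" if "i \<le> m" for i \<kappa>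
  proof -
    have b1: "bihom (p + (0 + q)) (q + (?N + Suc k)) (\<lambda>z. Q i z * (?V (Suc \<kappa>) z * (?L z * H z)))"
      by (intro bihom_mult bQ that bihom_coeff_symbol_poly bihom_linear_cnj H)
    have b2: "bihom (p + (0 + q)) (q + (?N + Suc k)) (\<lambda>z. Q i z * (?V \<kappa> z * (cnj (z $ j) * H z)))"
      by (intro bihom_mult bQ that bihom_coeff_symbol_poly bihom_cnj_coord H)
    have "sphere_mean (\<lambda>z. Q i z * (coeff (symbol_poly v (j # w) z) (Suc \<kappa>) * H z))
      = sphere_mean (\<lambda>z. Q i z * (?V (Suc \<kappa>) z * (?L z * H z)) + Q i z * (?V \<kappa> z * (cnj (z $ j) * H z)))"
      unfolding symbol_poly_Cons coeff_linear_mult_Suc by (rule sphere_mean_cong) (simp add: algebra_simps)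
    then show ?thesis unfolding sphere_mean_bihom_add[OF b1 b2] E_def C_def .
  qed
  have E0: "E i (Suc ?N) = 0" for i
    unfolding E_def by (simp add: coeff_symbol_poly_large)
  have "(\<Sum>\<kappa>\<le>Suc ?N. bs (i + \<kappa>) t * sphere_mean (\<lambda>z. Q i z * (coeff (symbol_poly v (j # w) z) \<kappa> * H z)))
     = (\<Sum>\<kappa>\<le>?N. bs (Suc (i + \<kappa>)) t * C i \<kappa>) + (\<Sum>\<kappa>\<le>?N. bs (i + \<kappa>) t * E i \<kappa>)" if "i \<le> m" for i
  proof -
    have "(\<Sum>\<kappa>\<le>Suc ?N. bs (i + \<kappa>) t * sphere_mean (\<lambda>z. Q i z * (coeff (symbol_poly v (j # w) z) \<kappa> * H z)))
      = bs i t * E i 0 + (\<Sum>\<kappa>\<le>?N. bs (Suc (i + \<kappa>)) t * (E i (Suc \<kappa>) + C i \<kappa>))"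
      by (subst sum.atMost_Suc_shift) (simp add: c0 c1[OF that])
    also have "\<dots> = (bs i t * E i 0 + (\<Sum>\<kappa>\<le>?N. bs (Suc (i + \<kappa>)) t * E i (Suc \<kappa>))) + (\<Sum>\<kappa>\<le>?N. bs (Suc (i + \<kappa>)) t * C i \<kappa>)"
      by (simp add: distrib_left sum.distrib)
    also have "bs i t * E i 0 + (\<Sum>\<kappa>\<le>?N. bs (Suc (i + \<kappa>)) t * E i (Suc \<kappa>)) = (\<Sum>\<kappa>\<le>Suc ?N. bs (i + \<kappa>) t * E i \<kappa>)"
      by (subst sum.atMost_Suc_shift) simp
    also have "\<dots> = (\<Sum>\<kappa>\<le>?N. bs (i + \<kappa>) t * E i \<kappa>)" by (simp add: E0)
    finally show ?thesis by simp
  qed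
  then show ?case by (simp add: s)
qed

end

end

section \<open>Constant coefficient operators\<close>

text \<open>
  The operator \<open>A(d/dt)\<close> on a tower of derivatives.
\<close>

definition poly_act :: "complex poly \<Rightarrow> (nat \<Rightarrow> real \<Rightarrow> complex) \<Rightarrow> nat \<Rightarrow> real \<Rightarrow> complex" where
  "poly_act A bs i t = (\<Sum>k\<le>degree A. coeff A k * bs (k + i) t)"

lemma poly_act_bound: "degree A \<le> N \<Longrightarrow> poly_act A bs i t = (\<Sum>k\<le>N. coeff A k * bs (k + i) t)"
  unfolding poly_act_def by (rule sum.mono_neutral_left) (auto simp: coeff_eq_0)

lemma poly_act_add: "poly_act (A + B) bs i t = poly_act A bs i t + poly_act B bs i t"
proof -
  define N where "N = max (degree A) (degree B)"
  have "degree (A + B) \<le> N" by (simp add: N_def degree_add_le_max)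
  then show ?thesis
    using poly_act_bound[of A N bs i t] poly_act_bound[of B N bs i t] poly_act_bound[of "A + B" N bs i t]
    by (simp add: N_def sum.distrib distrib_right)
qed

lemma poly_act_smult: "poly_act (smult c A) bs i t = c * poly_act A bs i t"
  using poly_act_bound[of "smult c A" "degree A" bs i t]
  by (simp add: poly_act_def sum_distrib_left mult.assoc)

lemma poly_act_0 [simp]: "poly_act 0 bs i t = 0"
  by (simp add: poly_act_def)

lemma poly_act_1 [simp]: "poly_act 1 bs i t = bs i t"
  by (simp add: poly_act_def)

lemma poly_act_sum: "poly_act (\<Sum>x\<in>X. A x) bs i t = (\<Sum>x\<in>X. poly_act (A x) bs i t)"
  by (induction X rule: infinite_finite_induct) (auto simp: poly_act_add)

lemma poly_act_monom: "poly_act (monom c n) bs i t = c * bs (n + i) t"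
  using poly_act_bound[of "monom c n" n bs i t] by (simp add: degree_monom_le if_distrib[of "\<lambda>x. x * _"] cong: if_cong)

lemma poly_act_pCons: "poly_act (pCons a A) bs i t = a * bs i t + poly_act A bs (Suc i) t"
proof -
  have "pCons a A = monom a 0 + pCons 0 A" by (simp add: monom_0)
  moreover have "poly_act (pCons 0 A) bs i t = poly_act A bs (Suc i) t"
    unfolding poly_act_bound[OF degree_pCons_le] by (subst sum.atMost_Suc_shift) (simp add: poly_act_def)
  ultimately show ?thesis by (simp only: poly_act_add poly_act_monom) simp
qed

lemma poly_act_mult: "poly_act (A * B) bs i t = poly_act A (poly_act B bs) i t"
proof (induction A arbitrary: i)
  case (pCons a A)
  then show ?case by (simp add: mult_pCons_left poly_act_add poly_act_smult poly_act_pCons)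
qed simp

lemma poly_act_zero_arg:
  assumes "\<And>i. i \<le> degree A \<Longrightarrow> bs (i + k) t = 0" shows "poly_act A bs k t = 0"
  using assms by (simp add: poly_act_def)

lemma poly_act_tower: "deriv_tower J bs \<Longrightarrow> deriv_tower J (poly_act A bs)"
  unfolding deriv_tower_def poly_act_def[abs_def]
  by (auto intro!: has_vector_derivative_sum has_vector_derivative_mult_right)

lemma deriv_tower_zero:
  assumes "open J" "deriv_tower J cs" "\<And>t. t \<in> J \<Longrightarrow> cs 0 t = 0" "t \<in> J"
  shows "cs k t = 0"
  using assms(4)
proof (induction k arbitrary: t)
  case (Suc k)
  have "((\<lambda>t. 0) has_vector_derivative (0::complex)) (at t)" by simp
  then have "(cs k has_vector_derivative 0) (at t)"
    by (rule has_vector_derivative_transform_within_open[OF _ assms(1) Suc.prems]) (simp add: Suc.IH)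
  moreover have "(cs k has_vector_derivative cs (Suc k) t) (at t)"
    using assms(2) Suc.prems by (simp add: deriv_tower_def)
  ultimately show ?case by (rule vector_derivative_unique_at[symmetric])
qed (simp add: assms(3))

lemma split_complex_poly:
  assumes "degree (C :: complex poly) = p + q" "C \<noteq> 0"
  obtains A B where "C = A * B" "degree A = p" "degree B = q" "A \<noteq> 0" "B \<noteq> 0"
proof -
  have "\<exists>A B. C = A * B \<and> degree A = p" using assms
  proof (induction p arbitrary: C)
    case 0
    then show ?case by (intro exI[of _ 1] exI[of _ C]) simp
  next
    case (Suc p)
    have "\<not> constant (poly C)" using Suc.prems by (simp add: constant_degree)
    then obtain x where "poly C x = 0" using fundamental_theorem_of_algebra by blast
    then obtain D where D: "C = [:-x, 1:] * D" by (auto simp: poly_eq_0_iff_dvd elim: dvdE)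
    have D0: "D \<noteq> 0" using Suc.prems(2) D by auto
    then have "degree D = p + q" using Suc.prems(1) unfolding D by (subst (asm) degree_mult_eq) auto
    from Suc.IH[OF this D0] obtain A B where AB: "D = A * B" "degree A = p" by blast
    have "A \<noteq> 0" using AB D0 by auto
    then have "degree ([:-x, 1:] * A) = Suc p" using AB by (subst degree_mult_eq) auto
    then show ?case using D AB by (intro exI[of _ "[:-x, 1:] * A"] exI[of _ B]) (simp only: mult.assoc)
  qed
  then obtain A B where AB: "C = A * B" "degree A = p" by blast
  have nz: "A \<noteq> 0" "B \<noteq> 0" using AB assms(2) by auto
  then have "degree B = q" using AB assms(1) by (simp add: degree_mult_eq)
  then show ?thesis using that AB nz by blast
qed

lemma poly_shifted_expansion:
  fixes A :: "complex poly"
  assumes "degree A \<le> p"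
  shows "\<exists>c. A = (\<Sum>k\<le>p. smult (c k) ([:x, 1:] ^ k)) \<and> c p = coeff A p"
  using assms
proof (induction p arbitrary: A)
  case 0
  then obtain a where "A = [:a:]" by (auto elim: degree_eq_zeroE)
  then show ?case by (intro exI[of _ "\<lambda>_. a"]) simp
next
  case (Suc p)
  define L where "L = ([:x, 1:] :: complex poly) ^ Suc p"
  have L: "degree L = Suc p" "coeff L (Suc p) = 1"
    unfolding L_def using degree_linear_power[of x "Suc p"] coeff_linear_power[of x "Suc p"] by blast+
  let ?B = "A - smult (coeff A (Suc p)) L"
  have "degree ?B \<le> p"
  proof (rule degree_le, intro allI impI)
    fix i assume "p < i"
    then show "coeff ?B i = 0"
      using L Suc.prems by (cases "i = Suc p") (auto simp: coeff_eq_0)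
  qed
  from Suc.IH[OF this] obtain c where c: "?B = (\<Sum>k\<le>p. smult (c k) ([:x, 1:] ^ k))" by blast
  have "A = ?B + smult (coeff A (Suc p)) L" by simp
  also have "\<dots> = (\<Sum>k\<le>Suc p. smult ((c(Suc p := coeff A (Suc p))) k) ([:x, 1:] ^ k))"
  proof -
    have "(\<Sum>k\<le>p. smult ((c(Suc p := coeff A (Suc p))) k) ([:x, 1:] ^ k)) = ?B"
      unfolding c by (intro sum.cong) auto
    then show ?thesis unfolding sum.atMost_Suc fun_upd_same L_def by simp
  qed
  finally show ?case by (intro exI[of _ "c(Suc p := coeff A (Suc p))"]) simp
qed

section \<open>The radial operators as operators in the squared radius\<close>

context radial_domain
begin

lemma I_sq: "\<rho> \<in> I \<Longrightarrow> \<rho>\<^sup>2 \<in> J" "\<rho> \<in> I \<Longrightarrow> \<rho> > 0"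
  using pos_I by (auto simp: J_def)

text \<open>
  The factor \<open>\<kappa> D + 2\<close> is \<open>d/dt + \<epsilon>\<close> in disguise: with \<open>\<kappa> = 1/m\<close> the power \<open>\<rho>\<^sup>-\<^sup>2\<^sup>m\<close> spans the kernel of
  \<open>\<kappa> \<rho> d/d\<rho> + 2\<close>, and \<open>\<rho> d/d\<rho>\<close> of a function \<open>x(\<rho>\<^sup>2)\<close> is \<open>2 \<rho>\<^sup>2 x'(\<rho>\<^sup>2)\<close>.
\<close>

lemma shifted_step:
  assumes m: "m > 0" and x: "\<And>t. t \<in> J \<Longrightarrow> (x has_vector_derivative x' t) (at t)"
    and h: "\<And>\<rho>. \<rho> \<in> I \<Longrightarrow> h \<rho> = C * complex_of_real (1 / \<rho> ^ (2 * m)) * x (\<rho>\<^sup>2)"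
    and T: "T h \<rho> = complex_of_real \<rho> * vector_derivative h (at \<rho>) + 2 * \<epsilon> * complex_of_real (\<rho>\<^sup>2) * h \<rho>"
    and \<rho>: "\<rho> \<in> I"
  shows "complex_of_real (1 / m) * T h \<rho> + 2 * h \<rho>
    = (2 * C / of_nat m) * complex_of_real (1 / \<rho> ^ (2 * (m - 1))) * (x' (\<rho>\<^sup>2) + \<epsilon> * x (\<rho>\<^sup>2))"
proof -
  have pos: "\<rho> > 0" using I_sq(2)[OF \<rho>] .
  have d1: "((\<lambda>\<rho>. 1 / \<rho> ^ (2 * m)) has_real_derivative - real (2 * m) / \<rho> ^ (2 * m + 1)) (at \<rho>)"
  proof -
    have "((\<lambda>\<rho>. 1 / \<rho> ^ (2 * m)) has_real_derivative - (real (2 * m) * \<rho> ^ (2 * m - 1)) / (\<rho> ^ (2 * m) * \<rho> ^ (2 * m))) (at \<rho>)"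
      using pos by (auto intro!: derivative_eq_intros simp: power2_eq_square)
    moreover have "\<rho> ^ (2 * m) * \<rho> ^ (2 * m) = \<rho> ^ (2 * m - 1) * \<rho> ^ (2 * m + 1)"
      unfolding power_add[symmetric] using m by (intro arg_cong2[where f="(^)"]) auto
    ultimately show ?thesis using pos by simp
  qed
  have d2: "((\<lambda>\<rho>. x (\<rho>\<^sup>2)) has_vector_derivative complex_of_real (2 * \<rho>) * x' (\<rho>\<^sup>2)) (at \<rho>)"
  proof -
    have "((\<lambda>\<rho>. \<rho>\<^sup>2) has_vector_derivative 2 * \<rho>) (at \<rho>)"
      by (auto intro!: derivative_eq_intros simp flip: has_real_derivative_iff_has_vector_derivative)
    from vector_diff_chain_at[OF this x[OF I_sq(1)[OF \<rho>]]] show ?thesis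
      by (simp add: o_def scaleR_conv_of_real)
  qed
  have "((\<lambda>\<rho>. C * complex_of_real (1 / \<rho> ^ (2 * m)) * x (\<rho>\<^sup>2)) has_vector_derivative
      C * complex_of_real (1 / \<rho> ^ (2 * m)) * (complex_of_real (2 * \<rho>) * x' (\<rho>\<^sup>2))
      + C * complex_of_real (- real (2 * m) / \<rho> ^ (2 * m + 1)) * x (\<rho>\<^sup>2)) (at \<rho>)"
    by (intro has_vector_derivative_mult has_vector_derivative_mult_right has_vector_derivative_of_real d1 d2)
  then have "(h has_vector_derivative
      C * complex_of_real (1 / \<rho> ^ (2 * m)) * (complex_of_real (2 * \<rho>) * x' (\<rho>\<^sup>2))
      + C * complex_of_real (- real (2 * m) / \<rho> ^ (2 * m + 1)) * x (\<rho>\<^sup>2)) (at \<rho>)"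
    by (rule has_vector_derivative_transform_within_open[OF _ open_I \<rho>]) (simp add: h)
  then have vd: "vector_derivative h (at \<rho>) = C * complex_of_real (1 / \<rho> ^ (2 * m)) * (complex_of_real (2 * \<rho>) * x' (\<rho>\<^sup>2))
      + C * complex_of_real (- real (2 * m) / \<rho> ^ (2 * m + 1)) * x (\<rho>\<^sup>2)"
    by (rule vector_derivative_at)
  define u where "u = complex_of_real (1 / \<rho> ^ (2 * m))"
  define w where "w = complex_of_real (1 / \<rho> ^ (2 * (m - 1)))"
  define rr where "rr = complex_of_real \<rho>"
  have rr0: "rr \<noteq> 0" using pos by (simp add: rr_def)
  have uw: "u * rr\<^sup>2 = w"
  proof -
    have "2 * m = 2 * (m - 1) + 2" using m by simp
    then have "\<rho> ^ (2 * m) = \<rho> ^ (2 * (m - 1)) * \<rho>\<^sup>2" by (metis power_add)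
    then have "1 / \<rho> ^ (2 * m) * \<rho>\<^sup>2 = 1 / \<rho> ^ (2 * (m - 1))" using pos by simp
    then show ?thesis unfolding u_def w_def rr_def by (simp only: of_real_power[symmetric] of_real_mult[symmetric])
  qed
  have neg: "complex_of_real (- real (2 * m) / \<rho> ^ (2 * m + 1)) = - of_nat (2 * m) * u / rr"
    using pos by (simp add: u_def rr_def field_simps)
  have mm: "of_nat m \<noteq> (0::complex)" using m by simp
  have "complex_of_real (1 / m) * T h \<rho> + 2 * h \<rho> = 1 / of_nat m * (rr * (C * u * (2 * rr * x' (\<rho>\<^sup>2)) + C * (- of_nat (2 * m) * u / rr) * x (\<rho>\<^sup>2))
      + 2 * \<epsilon> * rr\<^sup>2 * (C * u * x (\<rho>\<^sup>2))) + 2 * (C * u * x (\<rho>\<^sup>2))"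
    unfolding T vd neg h[OF \<rho>] by (simp add: u_def rr_def)
  also have "\<dots> = 2 * C / of_nat m * (u * rr\<^sup>2) * (x' (\<rho>\<^sup>2) + \<epsilon> * x (\<rho>\<^sup>2))"
    using rr0 mm by (simp add: field_simps power2_eq_square)
  finally show ?thesis unfolding uw w_def .
qed

text \<open>
  Each factor lowers \<open>m\<close> by one. As the factor with the largest index acts first, the constants are
  \<open>1/m, 1/(m-1), \<dots>\<close> in the order of action.
\<close>

lemma shifted_iterate:
  assumes km: "k \<le> m" and cs: "deriv_tower J cs"
    and g: "\<And>\<rho>. \<rho> \<in> I \<Longrightarrow> g \<rho> = complex_of_real (1 / \<rho> ^ (2 * m)) * cs 0 (\<rho>\<^sup>2)"
    and T: "\<And>h \<rho>. T h \<rho> = complex_of_real \<rho> * vector_derivative h (at \<rho>) + 2 * \<epsilon> * complex_of_real (\<rho>\<^sup>2) * h \<rho>"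
    and \<kappa>: "\<And>i. 1 \<le> i \<Longrightarrow> i \<le> k \<Longrightarrow> \<kappa> i = 1 / real (m - k + i)"
    and j: "j \<le> k" and \<rho>: "\<rho> \<in> I"
  shows "foldr (\<lambda>i h \<rho>. complex_of_real (\<kappa> i) * T h \<rho> + 2 * h \<rho>) [Suc (k - j)..<Suc k] g \<rho>
    = (\<Prod>i<j. 2 / of_nat (m - i)) * complex_of_real (1 / \<rho> ^ (2 * (m - j))) * poly_act ([:\<epsilon>, 1:] ^ j) cs 0 (\<rho>\<^sup>2)"
  using j \<rho>
proof (induction j arbitrary: \<rho>)
  case 0
  then show ?case by (simp add: g)
next
  case (Suc j)
  let ?step = "\<lambda>i h \<rho>. complex_of_real (\<kappa> i) * T h \<rho> + 2 * h \<rho>"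
  let ?h = "foldr ?step [Suc (k - j)..<Suc k] g"
  let ?L = "[:\<epsilon>, 1:] :: complex poly"
  have e: "Suc (k - Suc j) = k - j" using Suc.prems by simp
  have "[k - j..<Suc k] = (k - j) # [Suc (k - j)..<Suc k]" by (rule upt_conv_Cons) simp
  then have "foldr ?step [Suc (k - Suc j)..<Suc k] g \<rho> = ?step (k - j) ?h \<rho>" unfolding e by simp
  also have "\<kappa> (k - j) = 1 / real (m - j)"
  proof -
    have "m - k + (k - j) = m - j" using km Suc.prems by simp
    then show ?thesis using \<kappa>[of "k - j"] Suc.prems by simp
  qed
  also have "complex_of_real (1 / real (m - j)) * T ?h \<rho> + 2 * ?h \<rho>
     = (2 * (\<Prod>i<j. 2 / of_nat (m - i)) / of_nat (m - j)) * complex_of_real (1 / \<rho> ^ (2 * (m - j - 1)))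
        * (poly_act (?L ^ j) cs (Suc 0) (\<rho>\<^sup>2) + \<epsilon> * poly_act (?L ^ j) cs 0 (\<rho>\<^sup>2))"
  proof (rule shifted_step[where x = "poly_act (?L ^ j) cs 0" and x' = "poly_act (?L ^ j) cs (Suc 0)"])
    show "0 < m - j" using km Suc.prems by simp
    show "(poly_act (?L ^ j) cs 0 has_vector_derivative poly_act (?L ^ j) cs (Suc 0) t) (at t)" if "t \<in> J" for t
      using poly_act_tower[OF cs, of "?L ^ j"] that by (simp add: deriv_tower_def)
    show "?h \<rho> = (\<Prod>i<j. 2 / of_nat (m - i)) * complex_of_real (1 / \<rho> ^ (2 * (m - j))) * poly_act (?L ^ j) cs 0 (\<rho>\<^sup>2)"
      if "\<rho> \<in> I" for \<rho> using Suc.IH[OF _ that] Suc.prems by simp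
  qed (rule T, rule Suc.prems)
  also have "poly_act (?L ^ j) cs (Suc 0) (\<rho>\<^sup>2) + \<epsilon> * poly_act (?L ^ j) cs 0 (\<rho>\<^sup>2) = poly_act (?L ^ Suc j) cs 0 (\<rho>\<^sup>2)"
  proof -
    have "poly_act (?L ^ Suc j) cs 0 (\<rho>\<^sup>2) = poly_act ?L (poly_act (?L ^ j) cs) 0 (\<rho>\<^sup>2)"
      by (simp only: power_Suc poly_act_mult)
    then show ?thesis by (simp add: poly_act_pCons)
  qed
  finally show ?case by (simp add: mult_ac)
qed

lemma foldr_single:
  assumes "distinct xs" "l0 \<in> set xs" "\<And>l. l \<noteq> l0 \<Longrightarrow> G l = id"
  shows "foldr G xs g = G l0 g"
proof -
  have none: "foldr G xs g = g" if "l0 \<notin> set xs" for xs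
    using that by (induction xs) (auto simp: assms(3))
  show ?thesis using assms(1,2)
  proof (induction xs)
    case (Cons y xs)
    then show ?case by (cases "y = l0") (auto simp: none assms(3))
  qed simp
qed

lemma finite_weights: "finite {(\<alpha> :: 'n::finite \<Rightarrow> nat, l). (\<Sum>i\<in>UNIV. \<alpha> i) + l = p}"
proof (rule finite_subset)
  show "{(\<alpha> :: 'n \<Rightarrow> nat, l). (\<Sum>i\<in>UNIV. \<alpha> i) + l = p} \<subseteq> (\<Union>k\<in>{..p}. (midx k :: ('n \<Rightarrow> nat) set)) \<times> {..p}"
    by (auto simp: midx_def)
  show "finite ((\<Union>k\<in>{..p}. (midx k :: ('n \<Rightarrow> nat) set)) \<times> {..p})"
    by (auto simp: finite_midx)
qed

text \<open>
  Multi-indices concentrated at a single index \<open>l0\<close> suffice: they realize the powers of \<open>d/dt + \<epsilon>\<close>, which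
  span all polynomials in \<open>d/dt\<close>. The factor \<open>\<rho>\<^sup>2\<^sup>l\<close> makes up for the lower order, so that all terms have
  the same power of \<open>\<rho>\<close> in front.
\<close>

lemma ode_factor_realize:
  fixes T :: "'n::{finite,linorder} \<Rightarrow> (real \<Rightarrow> complex) \<Rightarrow> real \<Rightarrow> complex"
  assumes pm: "p \<le> m" and cs: "deriv_tower J cs"
    and g: "\<And>\<rho>. \<rho> \<in> I \<Longrightarrow> g \<rho> = complex_of_real (1 / \<rho> ^ (2 * m)) * cs 0 (\<rho>\<^sup>2)"
    and T: "\<And>l h \<rho>. T l h \<rho> = complex_of_real \<rho> * vector_derivative h (at \<rho>) + 2 * \<epsilon> l * complex_of_real (\<rho>\<^sup>2) * h \<rho>"
    and A: "degree A = p" "A \<noteq> 0"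
    and \<kappa>: "\<kappa> = (\<lambda>\<alpha> l i. 1 / real (m - \<alpha> l + i))"
  obtains c where "ode_lead p \<kappa> c \<noteq> 0"
    and "\<And>\<rho>. \<rho> \<in> I \<Longrightarrow> ode_factor T p \<kappa> c g \<rho> = complex_of_real (1 / \<rho> ^ (2 * (m - p))) * poly_act A cs 0 (\<rho>\<^sup>2)"
proof -
  \<comment> \<open>an arbitrary index of the non-empty type\<close>
  define l0 :: 'n where "l0 = undefined"
  define al where "al = (\<lambda>k l. if l = l0 then k else 0 :: nat)"
  have sum_al: "(\<Sum>i\<in>UNIV. al k i) = k" for k by (simp add: al_def)
  have inj_al: "al k = al k' \<longleftrightarrow> k = k'" for k k' by (metis sum_al)
  define K where "K = (\<lambda>k. \<Prod>i<k. (2::complex) / of_nat (m - i))"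
  have K: "K k \<noteq> 0" if "k \<le> p" for k using that pm by (auto simp: K_def)
  obtain c0 where c0: "A = (\<Sum>k\<le>p. smult (c0 k) ([:\<epsilon> l0, 1:] ^ k))" "c0 p = coeff A p"
    using poly_shifted_expansion[of A p "\<epsilon> l0"] A by auto
  \<comment> \<open>the constant \<open>K k\<close> that \<open>k\<close> factors produce is divided out\<close>
  define c where "c = (\<lambda>\<alpha> l. if \<alpha> = al (p - l) then c0 (p - l) / K (p - l) else 0)"
  have sp: "shifted_power T (\<kappa> (al k)) (al k) g \<rho>
      = K k * complex_of_real (1 / \<rho> ^ (2 * (m - k))) * poly_act ([:\<epsilon> l0, 1:] ^ k) cs 0 (\<rho>\<^sup>2)"
    if k: "k \<le> p" and \<rho>: "\<rho> \<in> I" for k \<rho>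
  proof -
    let ?G = "\<lambda>l. foldr (\<lambda>i h \<rho>. complex_of_real (\<kappa> (al k) l i) * T l h \<rho> + 2 * h \<rho>) [1..<Suc (al k l)]"
    have 1: "shifted_power T (\<kappa> (al k)) (al k) g = ?G l0 g"
      unfolding shifted_power_def by (rule foldr_single) (auto simp: al_def)
    have 2: "?G l0 g \<rho> = K k * complex_of_real (1 / \<rho> ^ (2 * (m - k))) * poly_act ([:\<epsilon> l0, 1:] ^ k) cs 0 (\<rho>\<^sup>2)"
      using shifted_iterate[OF order_trans[OF k pm] cs g T[of l0], where \<kappa>="\<kappa> (al k) l0" and j=k and \<rho>=\<rho>] k pm \<rho>
      by (simp add: al_def K_def \<kappa>)
    show ?thesis unfolding 1 by (rule 2)
  qed
  show ?thesis
  proof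
    have "ode_lead p \<kappa> c = (\<Sum>\<alpha>\<in>midx p. if \<alpha> = al p then c (al p) 0 * (\<Prod>l\<in>UNIV. \<Prod>i=1..al p l. complex_of_real (\<kappa> (al p) l i)) else 0)"
      unfolding ode_lead_def by (rule sum.cong) (auto simp: c_def)
    also have "\<dots> = c (al p) 0 * (\<Prod>l\<in>UNIV. \<Prod>i=1..al p l. complex_of_real (\<kappa> (al p) l i))"
      by (simp add: finite_midx) (simp add: midx_def sum_al)
    finally have "ode_lead p \<kappa> c = c0 p / K p * (\<Prod>l\<in>UNIV. \<Prod>i=1..al p l. complex_of_real (\<kappa> (al p) l i))"
      by (simp add: c_def)
    moreover have "c0 p \<noteq> 0" using A c0(2) by auto
    moreover have "complex_of_real (\<kappa> (al p) l i) \<noteq> 0" if "i \<in> {1..al p l}" for l i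
    proof -
      have "m - al p l + i \<noteq> 0" using that by simp
      then have "real (m - al p l + i) \<noteq> 0" by (simp only: of_nat_eq_0_iff not_False_eq_True)
      then show ?thesis unfolding \<kappa> of_real_eq_0_iff by (simp only: divide_eq_0_iff one_neq_zero simp_thms)
    qed
    ultimately show "ode_lead p \<kappa> c \<noteq> 0" using K[of p] by simp
  next
    fix \<rho> assume \<rho>: "\<rho> \<in> I"
    have pos: "\<rho> > 0" using I_sq(2)[OF \<rho>] .
    let ?t = "\<lambda>(\<alpha>, l). c \<alpha> l * complex_of_real (\<rho> ^ (2 * l)) * shifted_power T (\<kappa> \<alpha>) \<alpha> g \<rho>"
    let ?S = "{(\<alpha> :: 'n \<Rightarrow> nat, l). (\<Sum>i\<in>UNIV. \<alpha> i) + l = p}"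
    have "ode_factor T p \<kappa> c g \<rho> = (\<Sum>x\<in>?S. ?t x)" by (simp add: ode_factor_def)
    also have "\<dots> = (\<Sum>x\<in>(\<lambda>k. (al k, p - k)) ` {..p}. ?t x)"
    proof (rule sum.mono_neutral_right)
      show "finite ?S" by (rule finite_weights)
      show "(\<lambda>k. (al k, p - k)) ` {..p} \<subseteq> ?S" by (auto simp: sum_al)
      show "\<forall>x\<in>?S - (\<lambda>k. (al k, p - k)) ` {..p}. ?t x = 0"
      proof
        fix x assume x: "x \<in> ?S - (\<lambda>k. (al k, p - k)) ` {..p}"
        obtain \<alpha> l where xl: "x = (\<alpha>, l)" by (cases x)
        have "\<alpha> \<noteq> al (p - l)"
        proof
          assume eq: "\<alpha> = al (p - l)"
          have "l \<le> p" using x xl by auto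
          then have "x = (\<lambda>k. (al k, p - k)) (p - l)" using eq xl by simp
          moreover have "(\<lambda>k. (al k, p - k)) (p - l) \<in> (\<lambda>k. (al k, p - k)) ` {..p}" by (rule imageI) simp
          ultimately show False using x by (simp only: Diff_iff simp_thms)
        qed
        then show "?t x = 0" by (simp add: xl c_def)
      qed
    qed
    also have "\<dots> = (\<Sum>k\<le>p. ?t (al k, p - k))"
      by (subst sum.reindex) (auto simp: inj_on_def inj_al)
    also have "\<dots> = (\<Sum>k\<le>p. complex_of_real (1 / \<rho> ^ (2 * (m - p))) * (c0 k * poly_act ([:\<epsilon> l0, 1:] ^ k) cs 0 (\<rho>\<^sup>2)))"
    proof (rule sum.cong[OF refl])
      fix k assume "k \<in> {..p}"
      then have k: "k \<le> p" by simp
      have "2 * (m - k) = 2 * (p - k) + 2 * (m - p)" using k pm by simp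
      then have "\<rho> ^ (2 * (m - k)) = \<rho> ^ (2 * (p - k)) * \<rho> ^ (2 * (m - p))" by (simp only: power_add)
      then have "\<rho> ^ (2 * (p - k)) * (1 / \<rho> ^ (2 * (m - k))) = 1 / \<rho> ^ (2 * (m - p))"
        using pos by simp
      then have e: "complex_of_real (\<rho> ^ (2 * (p - k))) * complex_of_real (1 / \<rho> ^ (2 * (m - k))) = complex_of_real (1 / \<rho> ^ (2 * (m - p)))"
        by (simp only: of_real_mult[symmetric])
      have "?t (al k, p - k) = c0 k / K k * complex_of_real (\<rho> ^ (2 * (p - k)))
          * (K k * complex_of_real (1 / \<rho> ^ (2 * (m - k))) * poly_act ([:\<epsilon> l0, 1:] ^ k) cs 0 (\<rho>\<^sup>2))"
        using k by (simp only: case_prod_conv sp[OF k \<rho>]) (simp add: c_def)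
      also have "\<dots> = (c0 k / K k * K k) * (complex_of_real (\<rho> ^ (2 * (p - k))) * complex_of_real (1 / \<rho> ^ (2 * (m - k))))
          * poly_act ([:\<epsilon> l0, 1:] ^ k) cs 0 (\<rho>\<^sup>2)"
        by (simp only: mult_ac)
      finally show "?t (al k, p - k) = complex_of_real (1 / \<rho> ^ (2 * (m - p))) * (c0 k * poly_act ([:\<epsilon> l0, 1:] ^ k) cs 0 (\<rho>\<^sup>2))"
        unfolding e using K[OF k] by simp
    qed
    also have "\<dots> = complex_of_real (1 / \<rho> ^ (2 * (m - p))) * poly_act A cs 0 (\<rho>\<^sup>2)"
      by (subst c0(1)) (simp only: poly_act_sum poly_act_smult sum_distrib_left)
    finally show "ode_factor T p \<kappa> c g \<rho> = complex_of_real (1 / \<rho> ^ (2 * (m - p))) * poly_act A cs 0 (\<rho>\<^sup>2)" .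
  qed
qed

end

section \<open>Solutions by exponential polynomials\<close>

lemma single_root_solution:
  assumes J: "open J" "convex J" and cs: "deriv_tower J cs"
    and zero: "\<And>t. t \<in> J \<Longrightarrow> poly_act ([:-x, 1:] ^ p) cs 0 t = 0"
  shows "\<exists>A. \<forall>t\<in>J. cs 0 t = (\<Sum>i<p. A i * complex_of_real t ^ i) * exp (x * complex_of_real t)"
  using cs zero
proof (induction p arbitrary: cs)
  case 0
  then show ?case by simp
next
  case (Suc p)
  let ?D = "poly_act [:-x, 1:] cs"
  have "poly_act ([:-x, 1:] ^ p) ?D 0 t = 0" if "t \<in> J" for t
    using Suc.prems(2)[OF that] by (simp only: power_Suc2 poly_act_mult)
  from Suc.IH[OF poly_act_tower[OF Suc.prems(1)] this]
  obtain A where A: "\<And>t. t \<in> J \<Longrightarrow> ?D 0 t = (\<Sum>i<p. A i * complex_of_real t ^ i) * exp (x * complex_of_real t)"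
    by blast
  \<comment> \<open>an antiderivative of the polynomial coefficient on the right hand side of the first order equation\<close>
  define S where "S = (\<lambda>t. \<Sum>i<p. A i / of_nat (Suc i) * complex_of_real t ^ Suc i)"
  have S': "(S has_vector_derivative (\<Sum>i<p. A i * complex_of_real t ^ i)) (at t)" for t
    unfolding S_def
  proof (rule has_vector_derivative_sum)
    fix i
    have "((\<lambda>t. complex_of_real (t ^ Suc i)) has_vector_derivative complex_of_real (real (Suc i) * t ^ i)) (at t)"
      using DERIV_pow[of "Suc i" t] by (intro has_vector_derivative_of_real) simp
    from has_vector_derivative_mult_right[OF this, of "A i / of_nat (Suc i)"]
    show "((\<lambda>t. A i / of_nat (Suc i) * complex_of_real t ^ Suc i) has_vector_derivative A i * complex_of_real t ^ i) (at t)"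
      by (simp add: of_real_power del: of_nat_Suc power_Suc)
  qed
  have E': "((\<lambda>t. exp (- x * complex_of_real t)) has_vector_derivative - x * exp (- x * complex_of_real t)) (at t)" for t
    by (rule has_vector_derivative_real_field) (auto intro!: derivative_eq_intros)
  have "((\<lambda>t. exp (- x * complex_of_real t) * cs 0 t - S t) has_vector_derivative 0) (at t)" if "t \<in> J" for t
  proof -
    have c: "(cs 0 has_vector_derivative cs (Suc 0) t) (at t)" using Suc.prems(1) that by (simp add: deriv_tower_def)
    have "exp (- x * complex_of_real t) * exp (x * complex_of_real t) = 1" by (simp flip: exp_add)
    moreover have "cs (Suc 0) t - x * cs 0 t = ?D 0 t" by (simp add: poly_act_pCons)
    ultimately have "exp (- x * complex_of_real t) * (cs (Suc 0) t - x * cs 0 t) = (\<Sum>i<p. A i * complex_of_real t ^ i)"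
      using A[OF that] by (simp add: mult_ac)
    then show ?thesis
      using has_vector_derivative_diff[OF has_vector_derivative_mult[OF E' c] S'] by (simp add: algebra_simps)
  qed
  then have "((\<lambda>t. exp (- x * complex_of_real t) * cs 0 t - S t) has_vector_derivative 0) (at t within J)" if "t \<in> J" for t
    using has_vector_derivative_at_within that by blast
  from has_vector_derivative_zero_constant[OF J(2) this]
  obtain k where k: "\<And>t. t \<in> J \<Longrightarrow> exp (- x * complex_of_real t) * cs 0 t - S t = k"
    by blast
  have "\<forall>t\<in>J. cs 0 t = (\<Sum>i<Suc p. (if i = 0 then k else A (i - 1) / of_nat i) * complex_of_real t ^ i) * exp (x * complex_of_real t)"
  proof
    fix t assume "t \<in> J"
    note that = this
    have "(\<Sum>i<Suc p. (if i = 0 then k else A (i - 1) / of_nat i) * complex_of_real t ^ i) = k + S t"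
      by (subst sum.lessThan_Suc_shift) (simp add: S_def)
    also have "\<dots> = exp (- x * complex_of_real t) * cs 0 t" unfolding k[OF that, symmetric] by simp
    finally have e: "(\<Sum>i<Suc p. (if i = 0 then k else A (i - 1) / of_nat i) * complex_of_real t ^ i)
        = exp (- x * complex_of_real t) * cs 0 t" .
    have "exp (- x * complex_of_real t) * exp (x * complex_of_real t) = 1" by (simp flip: exp_add)
    then have "(exp (- x * complex_of_real t) * exp (x * complex_of_real t)) * cs 0 t = cs 0 t" by simp
    then show "cs 0 t = (\<Sum>i<Suc p. (if i = 0 then k else A (i - 1) / of_nat i) * complex_of_real t ^ i) * exp (x * complex_of_real t)"
      unfolding e by (simp only: mult_ac)
  qed
  then show ?case by (rule exI[of _ "\<lambda>i. if i = 0 then k else A (i - 1) / of_nat i"])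
qed

text \<open>
  The difference of the two linear polynomials is a non-zero constant, and comaximality is inherited by
  powers.
\<close>

lemma linear_powers_comaximal:
  assumes "x \<noteq> (y::complex)"
  shows "\<exists>u v. u * [:-x, 1:] ^ p + v * [:-y, 1:] ^ q = 1"
proof -
  have prod: "\<exists>u v. u * (a * a') + v * b = 1" if "u1 * a + v1 * b = 1" "u2 * a' + v2 * b = 1"
    for a a' b u1 v1 u2 v2 :: "complex poly"
  proof -
    have "(u1 * u2) * (a * a') + (v1 * u2 * a' + v1 * v2 * b + u1 * a * v2) * b = (u1 * a + v1 * b) * (u2 * a' + v2 * b)"
      by (simp add: algebra_simps)
    then show ?thesis using that by (metis mult_1)
  qed
  have pow: "\<exists>u v. u * a ^ n + v * b = 1" if "\<exists>u v. u * a + v * b = 1" for a b :: "complex poly" and n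
  proof (induction n)
    case 0
    show ?case by (intro exI[of _ 1] exI[of _ 0]) simp
  next
    case (Suc n)
    then show ?case using that prod by (metis power_Suc)
  qed
  have "[:1 / (y - x):] * [:-x, 1:] + [:- 1 / (y - x):] * [:-y, 1:] = 1"
  proof -
    have "- x / (y - x) + y / (y - x) = 1" using assms by (simp add: diff_divide_distrib[symmetric])
    then show ?thesis by (simp add: one_pCons algebra_simps)
  qed
  then have "\<exists>u v. u * [:-x, 1:] ^ p + v * [:-y, 1:] = 1" by (intro pow) blast
  then have "\<exists>u v. u * [:-y, 1:] + v * [:-x, 1:] ^ p = 1" by (metis add.commute)
  then have "\<exists>u v. u * [:-y, 1:] ^ q + v * [:-x, 1:] ^ p = 1" by (rule pow)
  then show ?thesis by (metis add.commute)
qed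

text \<open>
  A Bezout identity for the two powers splits the solution into one part for each root.
\<close>

lemma two_root_solution:
  assumes J: "open J" "convex J" and bs: "deriv_tower J bs" and xy: "p = 0 \<or> q = 0 \<or> x \<noteq> y"
    and zero: "\<And>t. t \<in> J \<Longrightarrow> poly_act ([:-x, 1:] ^ p * [:-y, 1:] ^ q) bs 0 t = 0"
  shows "\<exists>A B. \<forall>t\<in>J. bs 0 t = (\<Sum>i<p. A i * complex_of_real t ^ i) * exp (x * complex_of_real t)
    + (\<Sum>i<q. B i * complex_of_real t ^ i) * exp (y * complex_of_real t)"
proof -
  let ?X = "[:-x, 1:] ^ p" and ?Y = "[:-y, 1:] ^ q"
  have "\<exists>u v. u * ?X + v * ?Y = 1"
  proof (cases "p = 0 \<or> q = 0")
    case True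
    then show ?thesis
    proof
      assume "p = 0" then show ?thesis by (intro exI[of _ 1] exI[of _ 0]) simp
    next
      assume "q = 0" then show ?thesis by (intro exI[of _ 0] exI[of _ 1]) simp
    qed
  next
    case False
    then show ?thesis using xy linear_powers_comaximal by blast
  qed
  then obtain u v where uv: "u * ?X + v * ?Y = 1" by blast
  have vanish: "poly_act (W * (?X * ?Y)) bs 0 t = 0" if "t \<in> J" for W t
  proof -
    have "poly_act (?X * ?Y) bs k t = 0" for k
      by (rule deriv_tower_zero[OF J(1) poly_act_tower[OF bs] zero that])
    then show ?thesis unfolding poly_act_mult[of W] by (simp add: poly_act_zero_arg)
  qed
  have "poly_act ?X (poly_act (v * ?Y) bs) 0 t = 0" if "t \<in> J" for t
    using vanish[OF that, of v] by (simp only: poly_act_mult[symmetric] mult_ac)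
  from single_root_solution[OF J poly_act_tower[OF bs] this]
  obtain A where A: "\<And>t. t \<in> J \<Longrightarrow> poly_act (v * ?Y) bs 0 t = (\<Sum>i<p. A i * complex_of_real t ^ i) * exp (x * complex_of_real t)"
    by blast
  have "poly_act ?Y (poly_act (u * ?X) bs) 0 t = 0" if "t \<in> J" for t
    using vanish[OF that, of u] by (simp only: poly_act_mult[symmetric] mult_ac)
  from single_root_solution[OF J poly_act_tower[OF bs] this]
  obtain B where B: "\<And>t. t \<in> J \<Longrightarrow> poly_act (u * ?X) bs 0 t = (\<Sum>i<q. B i * complex_of_real t ^ i) * exp (y * complex_of_real t)"
    by blast
  have "bs 0 t = poly_act (u * ?X) bs 0 t + poly_act (v * ?Y) bs 0 t" for t
    unfolding poly_act_add[symmetric] uv by simp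
  then show ?thesis using A B by (intro exI[of _ A] exI[of _ B]) simp
qed

section \<open>The two groups of operators\<close>

definition index_word :: "('n::{finite,linorder} \<Rightarrow> nat) \<Rightarrow> 'n list" where
  "index_word \<alpha> = concat (map (\<lambda>l. replicate (\<alpha> l) l) (sorted_list_of_set UNIV))"

lemma op_power_word: "op_power T \<alpha> f = foldr T (index_word \<alpha>) f"
proof -
  have "foldr (\<lambda>l. T l ^^ \<alpha> l) xs f = foldr T (concat (map (\<lambda>l. replicate (\<alpha> l) l) xs)) f" for xs
    by (induction xs) (auto simp: foldr_replicate)
  then show ?thesis by (simp add: op_power_def index_word_def)
qed

lemma count_index_word:
  fixes \<alpha> :: "'n::{finite,linorder} \<Rightarrow> nat"
  shows "count_list (index_word \<alpha>) = \<alpha>"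
proof
  fix l
  have r: "count_list (replicate k y) l = (if y = l then k else 0)" for k and y :: 'n
    by (induction k) auto
  have "count_list (concat (map (\<lambda>l. replicate (\<alpha> l) l) xs)) l = (if l \<in> set xs then \<alpha> l else 0)"
    if "distinct xs" for xs :: "'n list"
    using that by (induction xs) (auto simp: r)
  then show "count_list (index_word \<alpha>) l = \<alpha> l" by (simp add: index_word_def)
qed

lemma Z_op_twisted:
  "Z_op U lam = twisted_d_z (\<lambda>j l. eta U lam j l / 4) (\<lambda>j l. nu U lam j l / 4)"
  by (intro ext) (simp add: Z_op_def twisted_d_z_def sum_distrib_left add_divide_distrib)

context radial_domain
begin

text \<open>
  Complex conjugation turns the conjugate operators into operators of the form \<open>twisted_d_z\<close> with the
  opposite coefficients \<open>-\<eta>/4\<close> and \<open>-\<nu>/4\<close>.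
\<close>

lemma Zbar_word:
  assumes F: "radpoly (\<lambda>z. cnj (F z))" and z: "norm z \<in> I"
  shows "foldr (Zbar_op U lam) w F z =
    cnj (foldr (twisted_d_z (\<lambda>j l. - eta U lam j l / 4) (\<lambda>j l. - nu U lam j l / 4)) w (\<lambda>z. cnj (F z)) z)"
  using z
proof (induction w arbitrary: z)
  case (Cons j w)
  let ?tw = "twisted_d_z (\<lambda>j l. - eta U lam j l / 4) (\<lambda>j l. - nu U lam j l / 4)"
  let ?X = "foldr (Zbar_op U lam) w F" and ?G = "foldr ?tw w (\<lambda>z. cnj (F z))"
  have d: "?G differentiable at z"
    by (rule radpoly_differentiable[OF radpoly_twisted_word[OF F] Cons.prems])
  have X: "?X z = cnj (?G z)" by (rule Cons.IH[OF Cons.prems])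
  have "d_zbar j ?X z = d_zbar j (\<lambda>z. cnj (?G z)) z"
    by (rule d_z_cong(2)[OF open_shell]) (use Cons in auto)
  also have "\<dots> = cnj (d_z j ?G z)"
    using d_zbar_cnj[OF differentiable_cnj[OF d]] by simp
  finally have dX: "d_zbar j ?X z = cnj (d_z j ?G z)" .
  have "Zbar_op U lam j ?X z = cnj (d_z j ?G z)
      - 1/4 * (\<Sum>l\<in>UNIV. cnj (nu U lam j l) * z $ l + cnj (eta U lam j l) * cnj (z $ l)) * cnj (?G z)"
    unfolding Zbar_op_def dX X ..
  also have "\<dots> = cnj (?tw j ?G z)"
  proof -
    have "cnj (\<Sum>l\<in>UNIV. - eta U lam j l / 4 * z $ l + - nu U lam j l / 4 * cnj (z $ l))
       = (\<Sum>l\<in>UNIV. - (1/4) * (cnj (nu U lam j l) * z $ l + cnj (eta U lam j l) * cnj (z $ l)))"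
      unfolding cnj_sum by (intro sum.cong) (simp_all add: algebra_simps)
    then have "cnj (\<Sum>l\<in>UNIV. - eta U lam j l / 4 * z $ l + - nu U lam j l / 4 * cnj (z $ l))
       = - (1/4) * (\<Sum>l\<in>UNIV. cnj (nu U lam j l) * z $ l + cnj (eta U lam j l) * cnj (z $ l))"
      by (simp only: sum_distrib_left)
    then show ?thesis unfolding twisted_d_z_def complex_cnj_add complex_cnj_mult[of "sum _ _"] by simp
  qed
  finally show ?case by simp
qed simp

text \<open>
  The powers of \<open>|z|\<close> come from the homogeneity of the \<open>Y\<^sub>j\<close>, of degree \<open>q\<close>, and from the weight in
  \<open>rmean\<close>. They are those of the initial functions considered above, so that the second group of
  operators can be treated like the first one.
\<close>

lemma harm_proj_rmean:
  fixes F :: "complex ^ 'n::finite \<Rightarrow> complex"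
  assumes Y: "\<And>j. j \<in> {1..d 0 q} \<Longrightarrow> bihom 0 q (Y 0 q j)" and z: "norm z \<in> I"
  shows "harm_proj d Y 0 q F z = complex_of_real (1 / (norm z) ^ (2 * (CARD('n) - 1 + q)))
    * (\<Sum>j=1..d 0 q. rmean (\<lambda>z. cnj (Y 0 q j z)) F ((norm z)\<^sup>2) * Y 0 q j z)"
proof -
  define \<rho> where "\<rho> = norm z"
  have pos: "\<rho> > 0" using z pos_I by (auto simp: \<rho>_def)
  have "harm_coeff Y 0 q j F \<rho> * Y 0 q j (z /\<^sub>R \<rho>)
     = complex_of_real (1 / \<rho> ^ (2 * (CARD('n) - 1 + q))) * (rmean (\<lambda>z. cnj (Y 0 q j z)) F (\<rho>\<^sup>2) * Y 0 q j z)"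
    if j: "j \<in> {1..d 0 q}" for j
  proof -
    have 1: "Y 0 q j (z /\<^sub>R \<rho>) = complex_of_real (1 / \<rho> ^ q) * Y 0 q j z"
      unfolding bihom_scale[OF Y[OF j], of "inverse \<rho>" z] by (simp add: inverse_eq_divide power_one_over)
    have s: "sqrt (\<rho>\<^sup>2) = \<rho>" using pos by simp
    have "sphere_mean (\<lambda>w. F (\<rho> *\<^sub>R w) * cnj (Y 0 q j (\<rho> *\<^sub>R w))) = sphere_mean (\<lambda>w. complex_of_real (\<rho> ^ q) * (F (\<rho> *\<^sub>R w) * cnj (Y 0 q j w)))"
      using bihom_scale[OF Y[OF j], of \<rho>] by (simp add: mult_ac)
    then have 2: "rmean (\<lambda>z. cnj (Y 0 q j z)) F (\<rho>\<^sup>2) = complex_of_real ((\<rho>\<^sup>2) ^ (CARD('n) - 1)) * (complex_of_real (\<rho> ^ q) * harm_coeff Y 0 q j F \<rho>)"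
      unfolding rmean_def s harm_coeff_def by (simp only: sphere_mean_cmult)
    define c where "c = CARD('n) - 1"
    have "1 / \<rho> ^ (2 * (c + q)) * ((\<rho>\<^sup>2) ^ c * \<rho> ^ q) = 1 / \<rho> ^ q"
    proof -
      have "\<rho> ^ (2 * (c + q)) = ((\<rho>\<^sup>2) ^ c * \<rho> ^ q) * \<rho> ^ q"
        by (simp only: distrib_left power_add power_mult[of \<rho> 2 c] mult_2[of q] mult.assoc)
      then show ?thesis using pos by simp
    qed
    then have 3: "complex_of_real (1 / \<rho> ^ (2 * (c + q))) * (complex_of_real ((\<rho>\<^sup>2) ^ c) * complex_of_real (\<rho> ^ q)) = complex_of_real (1 / \<rho> ^ q)"
      by (simp only: of_real_mult[symmetric])
    show ?thesis unfolding 1 2 c_def[symmetric] 3[symmetric] by (simp only: mult_ac)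
  qed
  then show ?thesis unfolding harm_proj_def \<rho>_def[symmetric] sum_distrib_left by (intro sum.cong) auto
qed

text \<open>
  The first group of operators followed by the projection to bidegree \<open>(0, q)\<close> turns \<open>a P\<close> into a sum of
  the \<open>bs i\<close> times antiholomorphic polynomials \<open>g i\<close>. Their conjugates are holomorphic, hence harmonic,
  and form initial data for the conjugated second group. Since \<open>g i\<close> is the projection of \<open>P\<close> times a
  coefficient of the first symbol, and the coefficients of the second symbol have bidegree \<open>(0, q)\<close>,
  \<open>g i\<close> may be replaced by that product in the final mean.
\<close>

lemma two_stage_identity:
  fixes P G :: "complex ^ 'n::{finite,linorder} \<Rightarrow> complex" and a :: "real \<Rightarrow> complex"
  assumes Y: "harmonic_basis d Y" and P: "harmonic p q P" and bs: "deriv_tower J bs"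
    and a: "\<And>\<rho>. \<rho> \<in> I \<Longrightarrow> a \<rho> = complex_of_real (1 / \<rho> ^ (2 * (CARD('n) - 1 + p + q))) * bs 0 (\<rho>\<^sup>2)"
    and G: "\<And>z. norm z \<in> I \<Longrightarrow> G z = a (norm z) * P z"
    and w: "length w1 = p" "length w2 = q"
    and zero: "\<And>\<rho>. \<rho> \<in> I \<Longrightarrow>
      sphere_mean (\<lambda>w. foldr (Zbar_op U lam) w2 (harm_proj d Y 0 q (foldr (Z_op U lam) w1 G)) (\<rho> *\<^sub>R w)) = 0"
    and t: "t \<in> J"
  shows "(\<Sum>i\<le>p. \<Sum>k\<le>q. sphere_mean (\<lambda>z. P z * (coeff (symbol_poly (\<lambda>j l. nu U lam j l / 4) w1 z) i
      * cnj (coeff (symbol_poly (\<lambda>j l. - nu U lam j l / 4) w2 z) k))) * bs (i + k) t) = 0"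
proof -
  let ?v = "\<lambda>j l. nu U lam j l / 4" and ?v' = "\<lambda>j l. - nu U lam j l / 4"
  let ?e = "\<lambda>j l. eta U lam j l / 4" and ?e' = "\<lambda>j l. - eta U lam j l / 4"
  let ?V = "\<lambda>i z. coeff (symbol_poly ?v w1 z) i" and ?W = "\<lambda>k z. coeff (symbol_poly ?v' w2 z) k"
  have Yh: "harmonic 0 q (Y 0 q j)" if "j \<in> {1..d 0 q}" for j
    using Y that by (auto simp: harmonic_basis_def H_space_harmonic)
  have Yb: "bihom 0 q (Y 0 q j)" if "j \<in> {1..d 0 q}" for j
    using Yh[OF that] by (rule harmonic_bihom)
  have V: "bihom 0 p (?V i)" for i using bihom_coeff_symbol_poly[of w1 ?v i] w by simp
  have W: "bihom 0 q (?W k)" for k using bihom_coeff_symbol_poly[of w2 ?v' k] w by simp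
  have bP: "bihom p q P" using P by (rule harmonic_bihom)
  have G0: "G z = complex_of_real (1 / (norm z) ^ (2 * (CARD('n) - 1 + p + q))) * (\<Sum>i\<le>(0::nat). bs i ((norm z)\<^sup>2) * P z)"
    if "norm z \<in> I" for z
    by (simp add: G[OF that] a[OF that])
  define g where "g = (\<lambda>i z. \<Sum>j=1..d 0 q. sphere_mean (\<lambda>z. P z * (?V i z * cnj (Y 0 q j z))) * Y 0 q j z)"
  define F1 where "F1 = harm_proj d Y 0 q (foldr (Z_op U lam) w1 G)"
  have F1: "F1 z = complex_of_real (1 / (norm z) ^ (2 * (CARD('n) - 1 + q))) * (\<Sum>i\<le>p. bs i ((norm z)\<^sup>2) * g i z)"
    if z: "norm z \<in> I" for z
  proof -
    have "rmean (\<lambda>z. cnj (Y 0 q j z)) (foldr (Z_op U lam) w1 G) ((norm z)\<^sup>2)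
        = (\<Sum>i\<le>p. bs i ((norm z)\<^sup>2) * sphere_mean (\<lambda>z. P z * (?V i z * cnj (Y 0 q j z))))"
      if "j \<in> {1..d 0 q}" for j
      using rmean_twisted_top[where Q="\<lambda>_. P" and m=0 and k=0, OF bs P G0 _ bihom_cnj[OF Yb[OF that]] norm_sq_J[OF z], of w1 ?e ?v] w
      by (simp add: Z_op_twisted)
    then have "(\<Sum>j=1..d 0 q. rmean (\<lambda>z. cnj (Y 0 q j z)) (foldr (Z_op U lam) w1 G) ((norm z)\<^sup>2) * Y 0 q j z)
      = (\<Sum>j=1..d 0 q. \<Sum>i\<le>p. bs i ((norm z)\<^sup>2) * (sphere_mean (\<lambda>z. P z * (?V i z * cnj (Y 0 q j z))) * Y 0 q j z))"
      by (intro sum.cong refl) (simp add: sum_distrib_right mult.assoc)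
    also have "\<dots> = (\<Sum>i\<le>p. bs i ((norm z)\<^sup>2) * g i z)"
      by (subst sum.swap) (simp add: g_def sum_distrib_left)
    finally have s: "(\<Sum>j=1..d 0 q. rmean (\<lambda>z. cnj (Y 0 q j z)) (foldr (Z_op U lam) w1 G) ((norm z)\<^sup>2) * Y 0 q j z)
      = (\<Sum>i\<le>p. bs i ((norm z)\<^sup>2) * g i z)" .
    show ?thesis unfolding F1_def s[symmetric] by (rule harm_proj_rmean[OF _ z]) (rule Yb)
  qed
  have g: "bihom 0 q (g i)" for i
    unfolding g_def by (intro bihom_sum bihom_cmult Yb)
  have bs': "deriv_tower J (\<lambda>k t. cnj (bs k t))"
    using bs by (auto simp: deriv_tower_def intro: has_vector_derivative_cnj)
  have gh: "harmonic q 0 (\<lambda>z. cnj (g i z))" for i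
    by (rule harmonic_holomorphic[OF bihom_cnj[OF g]])
  have F1': "cnj (F1 z) = complex_of_real (1 / (norm z) ^ (2 * (CARD('n) - 1 + q + 0))) * (\<Sum>i\<le>p. cnj (bs i ((norm z)\<^sup>2)) * cnj (g i z))"
    if "norm z \<in> I" for z by (simp add: F1[OF that])
  let ?F2 = "foldr (twisted_d_z ?e' ?v') w2 (\<lambda>z. cnj (F1 z))"
  have r: "radpoly (\<lambda>z. cnj (F1 z))"
    by (rule radpoly_initial[where Q="\<lambda>i z. cnj (g i z)" and m=p, OF bs' gh F1'])
  have "rmean (\<lambda>z. 1) ?F2 t = (\<Sum>i\<le>p. \<Sum>k\<le>q. cnj (bs (i + k) t) * sphere_mean (\<lambda>z. cnj (g i z) * (?W k z * 1)))"
    using rmean_twisted_top[where Q="\<lambda>i z. cnj (g i z)" and m=p and k=0, OF bs' gh F1' _ bihom_const t, of w2 1 ?e' ?v'] w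
    by simp
  moreover have "rmean (\<lambda>z. 1) ?F2 t = 0"
  proof -
    have tI: "sqrt t \<in> I" using t by (simp add: J_def)
    have "sphere_mean (\<lambda>w. ?F2 (sqrt t *\<^sub>R w)) = sphere_mean (\<lambda>w. cnj (foldr (Zbar_op U lam) w2 F1 (sqrt t *\<^sub>R w)))"
      using Zbar_word[OF r, of _ U lam w2] tI pos_I by (intro sphere_mean_cong) auto
    also have "\<dots> = 0" using zero[OF tI] by (simp add: sphere_mean_cnj F1_def)
    finally show ?thesis by (simp add: rmean_def)
  qed
  ultimately have "cnj (\<Sum>i\<le>p. \<Sum>k\<le>q. cnj (bs (i + k) t) * sphere_mean (\<lambda>z. cnj (g i z) * (?W k z * 1))) = cnj 0"
    by simp
  moreover have "cnj (sphere_mean (\<lambda>z. cnj (g i z) * (?W k z * 1))) = sphere_mean (\<lambda>z. P z * (?V i z * cnj (?W k z)))" for i k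
  proof -
    have "cnj (sphere_mean (\<lambda>z. cnj (g i z) * (?W k z * 1))) = sphere_mean (\<lambda>z. g i z * cnj (?W k z))"
      by (simp flip: sphere_mean_cnj)
    also have "\<dots> = sphere_mean (\<lambda>z. P z * (?V i z * cnj (?W k z)))"
    proof -
      \<comment> \<open>expand the coefficient of the second symbol in the basis, so that the projection acts as the identity on it\<close>
      have "?W k \<in> H_space 0 q"
        unfolding H_space_harmonic by (rule harmonic_antiholomorphic[OF W])
      then obtain c where c: "?W k = (\<lambda>z. \<Sum>j=1..d 0 q. c j * Y 0 q j z)"
        using Y unfolding harmonic_basis_def by blast
      then have cz: "?W k z = (\<Sum>j=1..d 0 q. c j * Y 0 q j z)" for z by (rule fun_cong)
      have b1: "bihom q q (\<lambda>z. sphere_mean (\<lambda>z. P z * (?V i z * cnj (Y 0 q j z))) * (Y 0 q j z * cnj (?W k z)))"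
        if "j \<in> {1..d 0 q}" for j
        using bihom_cmult[OF bihom_mult[OF Yb[OF that] bihom_cnj[OF W[of k]]]] by simp
      have b2: "bihom (p + (0 + q)) (q + (p + 0)) (\<lambda>z. cnj (c j) * (P z * (?V i z * cnj (Y 0 q j z))))"
        if "j \<in> {1..d 0 q}" for j
        by (intro bihom_cmult bihom_mult bP V bihom_cnj Yb that)
      have orth: "sphere_mean (\<lambda>z. Y 0 q j z * cnj (?W k z)) = cnj (c j)" if j: "j \<in> {1..d 0 q}" for j
      proof -
        have b3: "bihom q q (\<lambda>z. cnj (c i) * (Y 0 q j z * cnj (Y 0 q i z)))" if "i \<in> {1..d 0 q}" for i
          using bihom_cmult[OF bihom_mult[OF Yb[OF j] bihom_cnj[OF Yb[OF that]]]] by simp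
        have "sphere_mean (\<lambda>z. Y 0 q j z * cnj (?W k z)) = sphere_mean (\<lambda>z. \<Sum>i=1..d 0 q. cnj (c i) * (Y 0 q j z * cnj (Y 0 q i z)))"
          unfolding cz by (simp add: sum_distrib_left mult_ac)
        also have "\<dots> = (\<Sum>i=1..d 0 q. cnj (c i) * sphere_mean (\<lambda>z. Y 0 q j z * cnj (Y 0 q i z)))"
          by (subst sphere_mean_bihom_sum[OF finite_atLeastAtMost b3]) (simp_all only: sphere_mean_cmult)
        also have "\<dots> = (\<Sum>i=1..d 0 q. if i = j then cnj (c i) else 0)"
          using Y j by (intro sum.cong refl) (auto simp: harmonic_basis_def)
        finally show ?thesis using j by simp
      qed
      have "sphere_mean (\<lambda>z. g i z * cnj (?W k z)) = sphere_mean (\<lambda>z. \<Sum>j=1..d 0 q. sphere_mean (\<lambda>z. P z * (?V i z * cnj (Y 0 q j z))) * (Y 0 q j z * cnj (?W k z)))"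
        by (simp add: g_def sum_distrib_right mult.assoc)
      also have "\<dots> = (\<Sum>j=1..d 0 q. sphere_mean (\<lambda>z. P z * (?V i z * cnj (Y 0 q j z))) * sphere_mean (\<lambda>z. Y 0 q j z * cnj (?W k z)))"
        by (subst sphere_mean_bihom_sum[OF finite_atLeastAtMost b1]) (simp_all only: sphere_mean_cmult)
      also have "\<dots> = (\<Sum>j=1..d 0 q. cnj (c j) * sphere_mean (\<lambda>z. P z * (?V i z * cnj (Y 0 q j z))))"
        by (intro sum.cong refl) (simp only: orth mult.commute)
      also have "\<dots> = (\<Sum>j=1..d 0 q. sphere_mean (\<lambda>z. cnj (c j) * (P z * (?V i z * cnj (Y 0 q j z)))))"
        by (simp only: sphere_mean_cmult)
      also have "\<dots> = sphere_mean (\<lambda>z. \<Sum>j=1..d 0 q. cnj (c j) * (P z * (?V i z * cnj (Y 0 q j z))))"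
        by (rule sphere_mean_bihom_sum[OF finite_atLeastAtMost b2, symmetric])
      also have "\<dots> = sphere_mean (\<lambda>z. P z * (?V i z * cnj (?W k z)))"
        unfolding cz by (simp add: sum_distrib_left mult_ac)
      finally show ?thesis .
    qed
    finally show ?thesis .
  qed
  ultimately show ?thesis by (simp add: mult.commute)
qed

end

section \<open>Symbols for monomials\<close>

lemma sphere_mean_missing_variable:
  assumes P: "harmonic p q P" and X: "bihom q k X" "p = Suc k" and d: "d_z l P = (\<lambda>z. 0)"
  shows "sphere_mean (\<lambda>z. P z * (cnj (z $ l) * X z)) = 0"
  using sphere_mean_green_harmonic[OF P X(1), of l] X(2) d by (simp del: of_nat_add)

text \<open>
  If \<open>P\<close> contains no unconjugated variable but \<open>z\<^bsub>l1\<^esub>\<close>, only the part \<open>(s + v) cnj z\<^bsub>l1\<^esub>\<close> of each linear form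
  contributes to the mean.
\<close>

lemma sphere_mean_symbol_poly_single:
  assumes P: "harmonic p q P" and d: "\<And>l. l \<noteq> l1 \<Longrightarrow> d_z l P = (\<lambda>z. 0)"
    and "bihom q k X" "a + k = p"
  shows "sphere_mean (\<lambda>z. P z * (coeff (symbol_poly v (replicate a l1) z) i * X z))
    = coeff ([:v l1 l1, 1:] ^ a) i * sphere_mean (\<lambda>z. P z * (wmon_cnj (replicate a l1) z * X z))"
  using assms(3,4)
proof (induction a arbitrary: i k X)
  case 0
  then show ?case by (cases i) (simp_all add: symbol_poly_def coeff_eq_0)
next
  case (Suc a)
  let ?w = "replicate a l1"
  let ?V = "\<lambda>i z. coeff (symbol_poly v ?w z) i" and ?c = "\<lambda>i. coeff ([:v l1 l1, 1:] ^ a) i"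
  let ?S = "sphere_mean (\<lambda>z. P z * (wmon_cnj (replicate (Suc a) l1) z * X z))"
  have IH: "sphere_mean (\<lambda>z. P z * (?V i z * (cnj (z $ l) * X z))) = (if l = l1 then ?c i * ?S else 0)" for i l
  proof -
    have e: "sphere_mean (\<lambda>z. P z * (?V i z * (cnj (z $ l) * X z)))
        = ?c i * sphere_mean (\<lambda>z. P z * (cnj (z $ l) * (wmon_cnj ?w z * X z)))"
      using Suc.IH[OF bihom_cnj_coord[OF Suc.prems(1), of l], of i] Suc.prems(2) by (simp add: mult.left_commute)
    show ?thesis
    proof (cases "l = l1")
      case True
      then show ?thesis unfolding e by (simp add: mult.assoc)
    next
      case False
      have "bihom q (a + k) (\<lambda>z. wmon_cnj ?w z * X z)"
        using bihom_mult[OF bihom_wmon_cnj[of ?w] Suc.prems(1)] by simp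
      then have "sphere_mean (\<lambda>z. P z * (cnj (z $ l) * (wmon_cnj ?w z * X z))) = 0"
        using Suc.prems(2) by (intro sphere_mean_missing_variable[OF P _ _ d[OF False]]) auto
      then show ?thesis using False by (simp add: e)
    qed
  qed
  have bP: "bihom p q P" using P by (rule harmonic_bihom)
  have b: "bihom (p + (0 + q)) (q + (length ?w + Suc k)) (\<lambda>z. c * (P z * (?V i z * (cnj (z $ l) * X z))))" for c i l
    by (intro bihom_cmult bihom_mult bP bihom_coeff_symbol_poly bihom_cnj_coord Suc.prems)
  have bs: "bihom (p + (0 + q)) (q + (length ?w + Suc k)) (\<lambda>z. \<Sum>l\<in>UNIV. v l1 l * (P z * (?V i z * (cnj (z $ l) * X z))))" for i
    by (intro bihom_sum b)
  have lin: "sphere_mean (\<lambda>z. \<Sum>l\<in>UNIV. v l1 l * (P z * (?V i z * (cnj (z $ l) * X z)))) = v l1 l1 * ?c i * ?S" for i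
  proof -
    have "sphere_mean (\<lambda>z. \<Sum>l\<in>UNIV. v l1 l * (P z * (?V i z * (cnj (z $ l) * X z))))
      = (\<Sum>l\<in>UNIV. v l1 l * sphere_mean (\<lambda>z. P z * (?V i z * (cnj (z $ l) * X z))))"
      by (subst sphere_mean_bihom_sum[OF finite b]) (simp_all only: sphere_mean_cmult)
    also have "\<dots> = (\<Sum>l\<in>UNIV. if l = l1 then v l1 l1 * ?c i * ?S else 0)"
      unfolding IH by (intro sum.cong) auto
    finally show ?thesis by simp
  qed
  show ?case
  proof (cases i)
    case 0
    have "sphere_mean (\<lambda>z. P z * (coeff (symbol_poly v (replicate (Suc a) l1) z) i * X z))
      = sphere_mean (\<lambda>z. \<Sum>l\<in>UNIV. v l1 l * (P z * (?V 0 z * (cnj (z $ l) * X z))))"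
      unfolding 0 replicate_Suc symbol_poly_Cons coeff_linear_mult_0
      by (simp add: sum_distrib_left sum_distrib_right mult_ac)
    then show ?thesis unfolding lin 0 power_Suc coeff_linear_mult_0 .
  next
    case (Suc i')
    have "sphere_mean (\<lambda>z. P z * (coeff (symbol_poly v (replicate (Suc a) l1) z) i * X z))
      = sphere_mean (\<lambda>z. (\<Sum>l\<in>UNIV. v l1 l * (P z * (?V (Suc i') z * (cnj (z $ l) * X z)))) + 1 * (P z * (?V i' z * (cnj (z $ l1) * X z))))"
      unfolding Suc replicate_Suc symbol_poly_Cons coeff_linear_mult_Suc
      by (simp add: sum_distrib_left sum_distrib_right distrib_left distrib_right mult_ac)
    also have "\<dots> = v l1 l1 * ?c (Suc i') * ?S + 1 * (?c i' * ?S)"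
      unfolding sphere_mean_bihom_add[OF bs b] lin sphere_mean_cmult IH by simp
    finally show ?thesis unfolding Suc power_Suc coeff_linear_mult_Suc by (simp only: distrib_right mult.assoc)
  qed
qed

lemma monomial_word:
  assumes P: "harmonic p q P" and d: "\<And>l. l \<noteq> l1 \<Longrightarrow> d_z l P = (\<lambda>z. 0)"
    and w: "length w1 = p" "length w2 = q"
    and nz: "sphere_mean (\<lambda>z. P z * (wmon_cnj w1 z * wmon w2 z)) \<noteq> 0"
  shows "w1 = replicate p l1"
proof -
  have "l = l1" if l: "l \<in> set w1" for l
  proof (rule ccontr)
    assume ne: "l \<noteq> l1"
    have len: "length w1 = Suc (length (remove1 l w1))"
      using l by (simp add: length_remove1) (metis Suc_pred length_pos_if_in_set)
    have b: "bihom q (length (remove1 l w1)) (\<lambda>z. wmon_cnj (remove1 l w1) z * wmon w2 z)"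
      using bihom_mult[OF bihom_wmon_cnj[of "remove1 l w1"] bihom_wmon[of w2]] w by simp
    have "wmon_cnj w1 z = cnj (z $ l) * wmon_cnj (remove1 l w1) z" for z
      using l by (induction w1) auto
    then show False
      using nz sphere_mean_missing_variable[OF P b _ d[OF ne]] len w by (simp add: mult.assoc)
  qed
  then show ?thesis using w by (intro replicate_eqI) auto
qed

lemma d_z_monomial:
  assumes "l \<noteq> l1" shows "d_z l (\<lambda>z. (z $ l1) ^ p * cnj (z $ l2) ^ q) = (\<lambda>z. 0)"
proof -
  have b: "bihom 0 q (\<lambda>z. cnj (z $ l2) ^ q)" using bihom_cnj[OF bihom_coord_power[of q l2]] by simp
  show ?thesis
    unfolding d_z_bihom_mult[OF bihom_coord_power b] d_z_coord_power d_z_bihom_0[OF b] using assms by simp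
qed

section \<open>The differential equation of the radial profile\<close>

text \<open>
  The diagonal entries of a skew-symmetric matrix vanish and the two mixed entries are opposite.
\<close>

lemma nu_diag_real:
  assumes "metivier_matrices U" shows "cnj (nu_diag U lam l) = nu_diag U lam l"
proof -
  have skew: "U k $ s $ t = - U k $ t $ s" for k s t
  proof -
    have "transpose (U k) $ t $ s = (- U k) $ t $ s" using assms by (simp add: metivier_matrices_def)
    then show ?thesis by (simp add: transpose_def)
  qed
  have diag: "U k $ s $ s = 0" for k s using skew[of k s s] by simp
  have "alpha_c U lam l l = - \<i> / 2 * complex_of_real (\<Sum>k\<in>UNIV. lam $ k * U k $ Inl l $ Inr l)"
    unfolding alpha_c_def by (simp add: diag sum_negf sum_distrib_left mult_ac)
  moreover have "beta_c U lam l l = - 1 / 2 * complex_of_real (\<Sum>k\<in>UNIV. lam $ k * U k $ Inl l $ Inr l)"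
    unfolding beta_c_def by (simp add: diag skew[of _ "Inr l" "Inl l"] sum_negf)
  ultimately show ?thesis by (simp add: nu_def)
qed

text \<open>
  For a sphere centred at the origin the exponential factor in the twisted mean is \<open>1\<close>. The projection to
  bidegree \<open>(0, 0)\<close> is radial, so its mean is its value on the sphere, which is a non-zero multiple of the
  mean of \<open>F\<close>.
\<close>

lemma Z_space_mean_zero:
  fixes F :: "complex ^ 'n::finite \<Rightarrow> complex"
  assumes Y: "harmonic_basis d Y" and r: "0 \<le> r" and Z: "harm_proj d Y 0 0 F \<in> Z_space U lam r R"
    and \<rho>: "r < \<rho>" "ereal \<rho> < R"
  shows "sphere_mean (\<lambda>w. F (\<rho> *\<^sub>R w)) = 0"
proof -
  define c where "c = (\<lambda>j. Y 0 0 j 0)"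
  define m where "m = sphere_mean (\<lambda>w. F (\<rho> *\<^sub>R w))"
  define K where "K = (\<Sum>j=1..d 0 0. (cmod (c j))\<^sup>2)"
  have Yc: "Y 0 0 j z = c j" if "j \<in> {1..d 0 0}" for j z
  proof -
    have "Y 0 0 j \<in> H_space 0 0" using Y that by (simp add: harmonic_basis_def)
    then have "bihom 0 0 (Y 0 0 j)" unfolding H_space_harmonic by (rule harmonic_bihom)
    then show ?thesis unfolding c_def by (rule bihom_00)
  qed
  have h: "harm_proj d Y 0 0 F z = m * complex_of_real K" if "norm z = \<rho>" for z
  proof -
    have "harm_coeff Y 0 0 j F \<rho> = cnj (c j) * m" if "j \<in> {1..d 0 0}" for j
      unfolding harm_coeff_def m_def Yc[OF that] mult.commute[of _ "cnj (c j)"] by (rule sphere_mean_cmult)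
    then have "harm_proj d Y 0 0 F z = (\<Sum>j=1..d 0 0. m * complex_of_real ((cmod (c j))\<^sup>2))"
      unfolding harm_proj_def that by (intro sum.cong refl) (simp add: Yc complex_norm_square mult_ac del: of_real_power)
    then show ?thesis by (simp only: K_def of_real_sum sum_distrib_left)
  qed
  have "K \<noteq> 0"
  proof
    assume "K = 0"
    then have z: "c j = 0" if "j \<in> {1..d 0 0}" for j
      using that by (simp add: K_def sum_nonneg_eq_0_iff)
    have "(\<lambda>z. 1) \<in> H_space 0 0" unfolding H_space_harmonic by (intro harmonic_holomorphic bihom_const)
    then obtain b where "(\<lambda>z. 1) = (\<lambda>z. \<Sum>j=1..d 0 0. b j * Y 0 0 j z)"
      using Y unfolding harmonic_basis_def by blast
    then have "1 = (\<Sum>j=1..d 0 0. b j * Y 0 0 j 0)" by (rule fun_cong)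
    then show False using z by (simp add: Yc)
  qed
  have pos: "\<rho> > 0" using r \<rho> by simp
  have "sphere 0 \<rho> \<subseteq> (shell r R :: (complex ^ 'n) set)" using \<rho> by (auto simp: shell_def)
  moreover have "cball 0 r \<subseteq> (cball 0 \<rho> :: (complex ^ 'n) set)" using \<rho> by (intro subset_cball) simp
  ultimately have "twisted_mean U lam (harm_proj d Y 0 0 F) \<rho> 0 = 0"
    using Z pos by (simp add: Z_space_def)
  moreover have "twisted_mean U lam (harm_proj d Y 0 0 F) \<rho> 0
      = (LINT w : sphere 0 \<rho> | (sphere_measure \<rho> :: (complex ^ 'n) measure). m * complex_of_real K)"
    unfolding twisted_mean_def by (rule set_lebesgue_integral_cong) (auto simp: h)
  ultimately have "m * complex_of_real K = 0" using sphere_mean_const[OF pos, where 'a="complex ^ 'n"] by simp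
  then show ?thesis using \<open>K \<noteq> 0\<close> by (simp add: m_def)
qed

lemma monom_occurs_cmult:
  assumes "monom_occurs p q P \<alpha>\<beta>" "c \<noteq> 0" shows "monom_occurs p q (\<lambda>z. c * P z) \<alpha>\<beta>"
proof -
  obtain \<alpha> \<beta> where ab: "\<alpha>\<beta> = (\<alpha>, \<beta>)" by (cases \<alpha>\<beta>)
  obtain c' where c': "P = bipoly p q c'" "c' \<alpha> \<beta> \<noteq> 0" "\<alpha> \<in> midx p" "\<beta> \<in> midx q"
    using assms(1) by (auto simp: monom_occurs_def ab)
  have "(\<lambda>z. c * P z) = bipoly p q (\<lambda>\<alpha> \<beta>. c * c' \<alpha> \<beta>)"
    unfolding c'(1) bipoly_def by (simp add: sum_distrib_left mult.assoc)
  then show ?thesis using c' assms(2) unfolding monom_occurs_def ab by (auto intro!: exI[of _ "\<lambda>\<alpha> \<beta>. c * c' \<alpha> \<beta>"])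
qed

lemma radial_domain_interval:
  assumes "0 \<le> r" shows "radial_domain {\<rho>. r < \<rho> \<and> ereal \<rho> < R}"
proof
  have "{\<rho>. r < \<rho> \<and> ereal \<rho> < R} = {r<..} \<inter> ereal -` {..<R}" by auto
  moreover have "open (ereal -` {..<R})" by (rule open_ereal_vimage) simp
  ultimately show "open {\<rho>. r < \<rho> \<and> ereal \<rho> < R}" by (simp add: open_Int)
  show "{\<rho>. r < \<rho> \<and> ereal \<rho> < R} \<subseteq> {0<..}" using assms by auto
qed

lemma (in radial_domain) convex_J:
  assumes "\<And>x y z. x \<in> I \<Longrightarrow> z \<in> I \<Longrightarrow> x \<le> y \<Longrightarrow> y \<le> z \<Longrightarrow> y \<in> I"
  shows "convex J"
proof -
  have "is_interval J" unfolding is_interval_1 J_def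
    using assms by (auto intro: real_sqrt_le_mono)
  then show ?thesis by (simp add: is_interval_convex_1)
qed

text \<open>
  Along the ray through a point \<open>w0\<close> with \<open>P w0 \<noteq> 0\<close> the profile \<open>a\<close> is \<open>f\<close> divided by a power of the
  radius, hence smooth.
\<close>

lemma (in radial_domain) radial_profile_tower:
  fixes f P :: "complex ^ 'n::finite \<Rightarrow> complex"
  assumes sm: "\<And>k. Ck_on k {z. norm z \<in> I} f" and f: "\<And>z. norm z \<in> I \<Longrightarrow> f z = a (norm z) * P z"
    and P: "bihom p q P" and w0: "norm w0 = 1" "P w0 \<noteq> 0"
  obtains bs where "deriv_tower J bs"
    and "\<And>\<rho>. \<rho> \<in> I \<Longrightarrow> a \<rho> = complex_of_real (1 / \<rho> ^ (2 * N)) * bs 0 (\<rho>\<^sup>2)"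
proof -
  \<comment> \<open>the second power removes the homogeneity \<open>\<rho>\<^sup>p\<^sup>+\<^sup>q\<close> of \<open>P\<close> along the ray\<close>
  define b where "b = (\<lambda>t. complex_of_real (t powr real N) * (complex_of_real (t powr (- real (p + q) / 2)) * (1 / P w0 * f (sqrt t *\<^sub>R w0))))"
  have "has_derivs k J (\<lambda>t. f (sqrt t *\<^sub>R w0))" for k
  proof (rule has_derivs_compose[where g="\<lambda>\<rho>. f (\<rho> *\<^sub>R w0)" and \<phi>'="\<lambda>t. 1/2 * t powr (-1/2)"])
    show "has_derivs k I (\<lambda>\<rho>. f (\<rho> *\<^sub>R w0))"
      by (rule Ck_on_line[OF sm]) (use w0 pos_I in auto)
    show "sqrt t \<in> I" if "t \<in> J" for t using that by (simp add: J_def)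
    show "(sqrt has_real_derivative 1/2 * t powr (-1/2)) (at t)" if "t \<in> J" for t
    proof -
      have t: "t > 0" using that pos_J by auto
      have "t powr (-1/2) = inverse (sqrt t)" using t by (simp add: powr_minus powr_half_sqrt)
      then show ?thesis using DERIV_real_sqrt[OF t] by simp
    qed
    show "has_derivs k J (\<lambda>t. complex_of_real (1/2 * t powr (-1/2)))" for k
      unfolding of_real_mult by (intro has_derivs_mult has_derivs_const has_derivs_powr pos_J)
  qed
  then have "smooth_curve J b"
    unfolding smooth_curve_def b_def by (intro allI has_derivs_mult has_derivs_const has_derivs_powr pos_J)
  then obtain bs where bs: "deriv_tower J bs" "bs 0 = b" using smooth_curve_tower[OF open_J] by blast
  have "a \<rho> = complex_of_real (1 / \<rho> ^ (2 * N)) * bs 0 (\<rho>\<^sup>2)" if "\<rho> \<in> I" for \<rho>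
  proof -
    have pos: "\<rho> > 0" using that pos_I by auto
    have 1: "(\<rho>\<^sup>2) powr real N = \<rho> ^ (2 * N)" using pos by (simp add: powr_realpow power_mult)
    have "(\<rho>\<^sup>2) powr (- real (p + q) / 2) = (\<rho> powr 2) powr (- real (p + q) / 2)" using pos by simp
    also have "\<dots> = 1 / \<rho> ^ (p + q)" using pos by (simp only: powr_powr) (simp add: powr_minus_divide powr_realpow flip: of_nat_add)
    finally have 2: "(\<rho>\<^sup>2) powr (- real (p + q) / 2) = 1 / \<rho> ^ (p + q)" .
    have 3: "f (\<rho> *\<^sub>R w0) = a \<rho> * (complex_of_real \<rho> ^ (p + q) * P w0)"
      using f[of "\<rho> *\<^sub>R w0"] bihom_scale[OF P, of \<rho> w0] that pos w0 by simp
    have "sqrt (\<rho>\<^sup>2) = \<rho>" using pos by simp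
    then have "bs 0 (\<rho>\<^sup>2) = complex_of_real (\<rho> ^ (2 * N)) * a \<rho>"
      unfolding bs(2) b_def 1 2 using 3 w0 pos by simp
    then show ?thesis using pos by simp
  qed
  then show ?thesis using that bs by blast
qed

text \<open>
  Over \<open>\<complex>\<close> the characteristic polynomial splits into factors of degrees \<open>p\<close> and \<open>q\<close>, and each of them is
  realized by an operator in \<open>\<rho>\<close>. The exponent \<open>m = n - 1 + p' + q'\<close> corresponds to the constant
  \<open>1/(n + p' + q' - 1)\<close>.
\<close>

lemma (in radial_domain) factored_ode:
  fixes a :: "real \<Rightarrow> complex" and U :: "'m::finite \<Rightarrow> real ^ ('n::{finite,linorder} + 'n) ^ ('n + 'n)"
  assumes N0: "N = CARD('n) - 1 + p + q" and bs: "deriv_tower J bs"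
    and a: "\<And>\<rho>. \<rho> \<in> I \<Longrightarrow> a \<rho> = complex_of_real (1 / \<rho> ^ (2 * N)) * bs 0 (\<rho>\<^sup>2)"
    and S: "degree S = p + q" "S \<noteq> 0" and act: "\<And>t. t \<in> J \<Longrightarrow> poly_act S bs 0 t = 0"
  obtains \<kappa> \<kappa>' c e where "kappas_in p \<kappa> (gammas CARD('n) p q)" "kappas_in q \<kappa>' (gammas CARD('n) p q)"
    "ode_lead p \<kappa> c \<noteq> 0" "ode_lead q \<kappa>' e \<noteq> 0"
    "\<And>\<rho>. \<rho> \<in> I \<Longrightarrow> ode_factor (Dbar_op U lam) q \<kappa>' e (ode_factor (D_op U lam) p \<kappa> c a) \<rho> = 0"
proof -
  define n where "n = CARD('n)"
  have n: "n \<ge> 1" by (simp add: n_def Suc_leI)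
  have N: "N = n - 1 + p + q" by (simp add: N0 n_def)
  obtain B A where BA: "S = B * A" "degree B = q" "degree A = p" "B \<noteq> 0" "A \<noteq> 0"
    using split_complex_poly[of S q p] S by (metis add.commute)
  define \<kappa> where "\<kappa> = (\<lambda>(\<alpha> :: 'n \<Rightarrow> nat) l i. 1 / real (N - \<alpha> l + i))"
  define \<kappa>' where "\<kappa>' = (\<lambda>(\<alpha> :: 'n \<Rightarrow> nat) l i. 1 / real (N - p - \<alpha> l + i))"
  obtain c1 where c1: "ode_lead p \<kappa> c1 \<noteq> 0" "\<And>\<rho>. \<rho> \<in> I \<Longrightarrow> ode_factor (D_op U lam) p \<kappa> c1 a \<rho>
      = complex_of_real (1 / \<rho> ^ (2 * (N - p))) * poly_act A bs 0 (\<rho>\<^sup>2)"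
    using ode_factor_realize[of p N bs a "D_op U lam" "\<lambda>l. nu_diag U lam l / 4" A \<kappa>] bs a BA
    by (auto simp: \<kappa>_def N D_op_def)
  obtain c2 where c2: "ode_lead q \<kappa>' c2 \<noteq> 0" "\<And>\<rho>. \<rho> \<in> I \<Longrightarrow> ode_factor (Dbar_op U lam) q \<kappa>' c2 (ode_factor (D_op U lam) p \<kappa> c1 a) \<rho>
      = complex_of_real (1 / \<rho> ^ (2 * (N - p - q))) * poly_act B (poly_act A bs) 0 (\<rho>\<^sup>2)"
    using ode_factor_realize[of q "N - p" "poly_act A bs" "ode_factor (D_op U lam) p \<kappa> c1 a" "Dbar_op U lam"
        "\<lambda>l. - cnj (nu_diag U lam l) / 4" B \<kappa>'] poly_act_tower[OF bs, of A] c1(2) BA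
    by (auto simp: \<kappa>'_def N Dbar_op_def)
  have le: "\<alpha> l \<le> (\<Sum>l\<in>UNIV. \<alpha> l)" for \<alpha> :: "'n \<Rightarrow> nat" and l by (rule member_le_sum) auto
  have k1: "kappas_in p \<kappa> (gammas CARD('n) p q)"
    unfolding kappas_in_def
  proof (intro allI impI ballI)
    fix \<alpha> :: "'n \<Rightarrow> nat" and l i assume s: "(\<Sum>l\<in>UNIV. \<alpha> l) \<le> p" and i: "i \<in> {1..\<alpha> l}"
    have al: "\<alpha> l \<le> p" using le[of \<alpha> l] s by simp
    have "real (N - \<alpha> l + i) = real n + real (p - \<alpha> l + i) + real q - 1"
      using n al i by (simp add: N of_nat_diff)
    then show "\<kappa> \<alpha> l i \<in> gammas CARD('n) p q"
      unfolding gammas_def \<kappa>_def n_def[symmetric] using n al i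
      by (intro CollectI exI[of _ "p - \<alpha> l + i"] exI[of _ q]) auto
  qed
  have k2: "kappas_in q \<kappa>' (gammas CARD('n) p q)"
    unfolding kappas_in_def
  proof (intro allI impI ballI)
    fix \<alpha> :: "'n \<Rightarrow> nat" and l i assume s: "(\<Sum>l\<in>UNIV. \<alpha> l) \<le> q" and i: "i \<in> {1..\<alpha> l}"
    have al: "\<alpha> l \<le> q" using le[of \<alpha> l] s by simp
    have "real (N - p - \<alpha> l + i) = real n + real 0 + real (q - \<alpha> l + i) - 1"
      using n al i by (simp add: N of_nat_diff)
    then show "\<kappa>' \<alpha> l i \<in> gammas CARD('n) p q"
      unfolding gammas_def \<kappa>'_def n_def[symmetric] using n al i
      by (intro CollectI exI[of _ 0] exI[of _ "q - \<alpha> l + i"]) auto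
  qed
  have "ode_factor (Dbar_op U lam) q \<kappa>' c2 (ode_factor (D_op U lam) p \<kappa> c1 a) \<rho> = 0" if \<rho>: "\<rho> \<in> I" for \<rho>
    using c2(2)[OF \<rho>] act[OF I_sq(1)[OF \<rho>]] unfolding BA(1) poly_act_mult by simp
  then show ?thesis using that k1 k2 c1(1) c2(1) by blast
qed

lemma cnj_coeff_linear_power: "cnj (coeff ([:x, 1:] ^ m) k) = coeff ([:cnj x, 1:] ^ m) k"
  by (induction m arbitrary: k) (auto simp: coeff_pCons split: nat.splits)

text \<open>
  Both symbol polynomials reduce to powers of a linear polynomial in \<open>s\<close>; for the second one the previous
  argument is applied to the conjugate of \<open>P\<close>.
\<close>

lemma sphere_mean_monomial_symbols:
  assumes P: "harmonic p q P" and d1: "\<And>l. l \<noteq> l1 \<Longrightarrow> d_z l P = (\<lambda>z. 0)"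
    and d2: "\<And>l. l \<noteq> l2 \<Longrightarrow> d_z l (\<lambda>z. cnj (P z)) = (\<lambda>z. 0)"
  shows "sphere_mean (\<lambda>z. P z * (coeff (symbol_poly v (replicate p l1) z) i * cnj (coeff (symbol_poly v' (replicate q l2) z) k)))
    = sphere_mean (\<lambda>z. P z * (wmon_cnj (replicate p l1) z * wmon (replicate q l2) z))
      * (coeff ([:v l1 l1, 1:] ^ p) i * coeff ([:cnj (v' l2 l2), 1:] ^ q) k)"
proof -
  let ?w1 = "replicate p l1" and ?w2 = "replicate q l2"
  have P': "harmonic q p (\<lambda>z. cnj (P z))" by (rule harmonic_cnj[OF P])
  have b: "bihom 0 q (\<lambda>z. coeff (symbol_poly v' ?w2 z) k)"
    using bihom_coeff_symbol_poly[of ?w2 v' k] by simp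
  have w: "bihom p 0 (wmon ?w1)" using bihom_wmon[of ?w1] by simp
  have "sphere_mean (\<lambda>z. P z * (coeff (symbol_poly v ?w1 z) i * cnj (coeff (symbol_poly v' ?w2 z) k)))
    = coeff ([:v l1 l1, 1:] ^ p) i * sphere_mean (\<lambda>z. P z * (wmon_cnj ?w1 z * cnj (coeff (symbol_poly v' ?w2 z) k)))"
    by (rule sphere_mean_symbol_poly_single[OF P d1 bihom_cnj[OF b]]) simp_all
  also have "sphere_mean (\<lambda>z. P z * (wmon_cnj ?w1 z * cnj (coeff (symbol_poly v' ?w2 z) k)))
    = cnj (sphere_mean (\<lambda>z. cnj (P z) * (coeff (symbol_poly v' ?w2 z) k * wmon ?w1 z)))"
    unfolding sphere_mean_cnj[symmetric] by (simp add: cnj_wmon mult.commute)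
  also have "sphere_mean (\<lambda>z. cnj (P z) * (coeff (symbol_poly v' ?w2 z) k * wmon ?w1 z))
    = coeff ([:v' l2 l2, 1:] ^ q) k * sphere_mean (\<lambda>z. cnj (P z) * (wmon_cnj ?w2 z * wmon ?w1 z))"
    by (rule sphere_mean_symbol_poly_single[OF P' d2 w]) simp_all
  also have "sphere_mean (\<lambda>z. cnj (P z) * (wmon_cnj ?w2 z * wmon ?w1 z))
    = cnj (sphere_mean (\<lambda>z. P z * (wmon_cnj ?w1 z * wmon ?w2 z)))"
    unfolding sphere_mean_cnj[symmetric] by (simp add: cnj_wmon cnj_wmon_cnj mult.commute)
  finally show ?thesis by (simp add: cnj_coeff_linear_power mult_ac)
qed

text \<open>
  The index is shifted by one, which makes the coefficient with index \<open>0\<close> vanish.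
\<close>

lemma exponential_polynomial_powi:
  assumes \<rho>: "\<rho> > 0"
  shows "complex_of_real (1 / \<rho> ^ (2 * N)) * ((\<Sum>i<m. X i * complex_of_real (\<rho>\<^sup>2) ^ i) * y)
    = (\<Sum>i=0..m. (if i = 0 then 0 else X (i - 1)) * y * complex_of_real (\<rho> powi (- 2 * (int N + 1 - int i))))"
proof -
  have e: "\<rho> powi (- 2 * (int N + 1 - int (Suc i))) = 1 / \<rho> ^ (2 * N) * (\<rho>\<^sup>2) ^ i" for i
  proof -
    have "- 2 * (int N + 1 - int (Suc i)) = - int (2 * N) + int (2 * i)" by simp
    then have "\<rho> powi (- 2 * (int N + 1 - int (Suc i))) = \<rho> powi (- int (2 * N)) * \<rho> powi (int (2 * i))"
      using \<rho> by (simp only:) (rule power_int_add, simp)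
    then show ?thesis
      by (simp only: power_int_minus power_int_of_nat power_mult[of \<rho> 2 i]) (simp add: inverse_eq_divide)
  qed
  have "(\<Sum>i=0..m. (if i = 0 then 0 else X (i - 1)) * y * complex_of_real (\<rho> powi (- 2 * (int N + 1 - int i))))
    = (\<Sum>i<m. X i * y * complex_of_real (\<rho> powi (- 2 * (int N + 1 - int (Suc i)))))"
    unfolding atLeast0AtMost sum.atMost_shift by simp
  also have "\<dots> = (\<Sum>i<m. complex_of_real (1 / \<rho> ^ (2 * N)) * (X i * complex_of_real (\<rho>\<^sup>2) ^ i * y))"
    unfolding e of_real_mult of_real_power by (simp only: mult_ac)
  finally show ?thesis by (simp only: sum_distrib_left sum_distrib_right)
qed

theorem theorem3p1:
  fixes U :: "'m::finite \<Rightarrow> real ^ ('n::{finite,linorder} + 'n) ^ ('n + 'n)"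
    and lam :: "real ^ 'm"
    and r :: real and R :: ereal
    and p q :: nat
    and d :: "nat \<Rightarrow> nat \<Rightarrow> nat"
    and Y :: "nat \<Rightarrow> nat \<Rightarrow> nat \<Rightarrow> complex ^ 'n::{finite,linorder} \<Rightarrow> complex"
    and mon :: "nat \<Rightarrow> nat \<Rightarrow> nat \<Rightarrow> ('n \<Rightarrow> nat) \<times> ('n \<Rightarrow> nat)"
    and P f :: "complex ^ 'n::{finite,linorder} \<Rightarrow> complex"
    and a :: "real \<Rightarrow> complex"
  assumes "metivier_matrices U"
    and "lam \<noteq> 0"
    and "0 \<le> r" and "ereal r < R"
    and "harmonic_basis d Y"
    and "\<forall>p' q'. \<forall>j\<in>{1..d p' q'}. monom_occurs p' q' (Y p' q' j) (mon p' q' j)"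
    and "P \<in> H_space p q"
    and "\<exists>j\<in>{1..d p q}. \<exists>c. c \<noteq> 0 \<and> P = (\<lambda>z. c * Y p q j z)"
    and "\<forall>z\<in>shell r R. f z = a (norm z) * P z"
    and "f \<in> Zstar_space d Y mon U lam r R"
  shows
    "(\<exists>\<kappa> \<kappa>' (c :: ('n \<Rightarrow> nat) \<Rightarrow> nat \<Rightarrow> complex) (e :: ('n \<Rightarrow> nat) \<Rightarrow> nat \<Rightarrow> complex).
        kappas_in p \<kappa> (gammas CARD('n) p q) \<and> kappas_in q \<kappa>' (gammas CARD('n) p q) \<and>
        ode_lead p \<kappa> c \<noteq> 0 \<and> ode_lead q \<kappa>' e \<noteq> 0 \<and>
        (\<forall>\<rho>. r < \<rho> \<and> ereal \<rho> < R \<longrightarrow>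
           ode_factor (Dbar_op U lam) q \<kappa>' e (ode_factor (D_op U lam) p \<kappa> c a) \<rho> = 0))
     \<and>
     (\<forall>l1 l2. P = (\<lambda>z. (z $ l1) ^ p * cnj (z $ l2) ^ q) \<and>
              (p = 0 \<or> q = 0 \<or> nu_diag U lam l1 + nu_diag U lam l2 \<noteq> 0) \<longrightarrow>
        (\<exists>A B :: nat \<Rightarrow> complex. A 0 = 0 \<and> B 0 = 0 \<and>
           (\<forall>\<rho>. r < \<rho> \<and> ereal \<rho> < R \<longrightarrow>
              a \<rho> =
                (\<Sum>i=0..p. A i * exp (- nu_diag U lam l1 / 4 * complex_of_real (\<rho>\<^sup>2)) *
                   complex_of_real (\<rho> powi (- 2 * (int p + int q + int CARD('n) - int i))))
              + (\<Sum>k=0..q. B k * exp (nu_diag U lam l2 / 4 * complex_of_real (\<rho>\<^sup>2)) *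
                   complex_of_real (\<rho> powi (- 2 * (int p + int q + int CARD('n) - int k)))))))"
proof -
  define I where "I = {\<rho>. r < \<rho> \<and> ereal \<rho> < R}"
  interpret radial_domain I unfolding I_def by (rule radial_domain_interval[OF assms(3)])
  have shell: "shell r R = {z :: complex ^ 'n::{finite,linorder}. norm z \<in> I}" by (auto simp: shell_def I_def)
  define N where "N = CARD('n) - 1 + p + q"
  have PH: "harmonic p q P" using assms(7) by (simp add: H_space_harmonic)
  have Pb: "bihom p q P" using PH by (rule harmonic_bihom)
  obtain j c where j: "j \<in> {1..d p q}" and c: "c \<noteq> 0" and Pc: "P = (\<lambda>z. c * Y p q j z)" using assms(8) by blast
  have unit: "sphere_mean (\<lambda>w. Y p q j w * cnj (Y p q j w)) = 1"
    using assms(5) j by (simp add: harmonic_basis_def)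
  obtain w0 where w0: "norm w0 = 1" "P w0 \<noteq> 0"
  proof (rule ccontr)
    assume "\<not> thesis"
    then have "Y p q j w = 0" if "norm w = 1" for w using that Pc c \<open>\<And>w0. \<lbrakk>norm w0 = 1; P w0 \<noteq> 0\<rbrakk> \<Longrightarrow> thesis\<close> by auto
    then have "sphere_mean (\<lambda>w. Y p q j w * cnj (Y p q j w)) = sphere_mean (\<lambda>w::complex ^ 'n::{finite,linorder}. 0)"
      by (intro sphere_mean_cong) simp
    then show False using unit by simp
  qed
  have f: "f z = a (norm z) * P z" if "norm z \<in> I" for z using assms(9) that by (simp add: shell)
  have sm: "Ck_on k {z. norm z \<in> I} f" for k
    using assms(10) by (simp add: Zstar_space_def smooth_fun_on_def shell)
  obtain bs where bs: "deriv_tower J bs"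
    and a: "\<And>\<rho>. \<rho> \<in> I \<Longrightarrow> a \<rho> = complex_of_real (1 / \<rho> ^ (2 * N)) * bs 0 (\<rho>\<^sup>2)"
    using radial_profile_tower[OF sm f Pb w0] by metis
  \<comment> \<open>for the basis index of \<open>P\<close> the function to which the operators are applied is \<open>f\<close> itself on the shell\<close>
  define G where "G = (\<lambda>z. harm_coeff_tilde Y p q j f (norm z) * Y p q j z)"
  have G: "G z = a (norm z) * P z" if z: "norm z \<in> I" for z
  proof -
    define \<rho> where "\<rho> = norm z"
    have \<rho>: "\<rho> \<in> I" "\<rho> > 0" using z pos_I by (auto simp: \<rho>_def)
    have "harm_coeff Y p q j f \<rho> = sphere_mean (\<lambda>w. a \<rho> * complex_of_real \<rho> ^ (p + q) * c * (Y p q j w * cnj (Y p q j w)))"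
      unfolding harm_coeff_def
    proof (rule sphere_mean_cong)
      fix w :: "complex ^ 'n::{finite,linorder}" assume "norm w = 1"
      then have "f (\<rho> *\<^sub>R w) = a \<rho> * (complex_of_real \<rho> ^ (p + q) * P w)"
        using f[of "\<rho> *\<^sub>R w"] bihom_scale[OF Pb, of \<rho> w] \<rho> by simp
      then show "f (\<rho> *\<^sub>R w) * cnj (Y p q j w) = a \<rho> * complex_of_real \<rho> ^ (p + q) * c * (Y p q j w * cnj (Y p q j w))"
        by (simp add: Pc)
    qed
    then have "harm_coeff Y p q j f \<rho> = a \<rho> * complex_of_real \<rho> ^ (p + q) * c"
      unfolding sphere_mean_cmult unit by simp
    then show ?thesis using \<rho>(2) unfolding G_def harm_coeff_tilde_def \<rho>_def[symmetric] by (simp add: Pc)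
  qed
  define w1 where "w1 = index_word (fst (mon p q j))"
  define w2 where "w2 = index_word (snd (mon p q j))"
  have occ: "monom_occurs p q P (count_list w1, count_list w2)"
    using monom_occurs_cmult[OF _ c, of p q "Y p q j" "mon p q j"] assms(6) j
    by (simp add: w1_def w2_def count_index_word Pc)
  have len: "length w1 = p" "length w2 = q"
    using occ by (auto simp: monom_occurs_def midx_def length_eq_sum_count)
  have lead: "sphere_mean (\<lambda>z. P z * (wmon_cnj w1 z * wmon w2 z)) \<noteq> 0"
    by (rule sphere_mean_monomial_nonzero[OF PH occ])
  have zero: "sphere_mean (\<lambda>w. foldr (Zbar_op U lam) w2 (harm_proj d Y 0 q (foldr (Z_op U lam) w1 G)) (\<rho> *\<^sub>R w)) = 0"
    if "\<rho> \<in> I" for \<rho>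
  proof (rule Z_space_mean_zero[OF assms(5,3)])
    show "harm_proj d Y 0 0 (foldr (Zbar_op U lam) w2 (harm_proj d Y 0 q (foldr (Z_op U lam) w1 G))) \<in> Z_space U lam r R"
      using assms(10) j by (simp add: Zstar_space_def w1_def w2_def G_def op_power_word)
    show "r < \<rho>" "ereal \<rho> < R" using that by (auto simp: I_def)
  qed
  let ?v = "\<lambda>j l. nu U lam j l / 4" and ?v' = "\<lambda>j l. - nu U lam j l / 4"
  define M where "M = (\<lambda>i k. sphere_mean (\<lambda>z. P z * (coeff (symbol_poly ?v w1 z) i * cnj (coeff (symbol_poly ?v' w2 z) k))))"
  have ode: "(\<Sum>i\<le>p. \<Sum>k\<le>q. M i k * bs (i + k) t) = 0" if "t \<in> J" for t
    unfolding M_def by (rule two_stage_identity[OF assms(5) PH bs a[unfolded N_def] G len zero that])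
  show ?thesis
  proof (intro conjI allI impI)
    \<comment> \<open>the characteristic polynomial; only the pair \<open>(p, q)\<close> contributes to its top coefficient\<close>
    define ch where "ch = (\<Sum>i\<le>p. \<Sum>k\<le>q. monom (M i k) (i + k))"
    have act: "poly_act ch bs 0 t = 0" if "t \<in> J" for t
      using ode[OF that] by (simp add: ch_def poly_act_sum poly_act_monom)
    have "M p q \<noteq> 0"
      using lead len coeff_symbol_poly_lead[of ?v w1] coeff_symbol_poly_lead[of ?v' w2]
      by (simp add: M_def cnj_wmon_cnj)
    moreover have "coeff ch (p + q) = M p q"
    proof -
      have "coeff ch (p + q) = (\<Sum>i\<le>p. \<Sum>k\<le>q. if i = p \<and> k = q then M i k else 0)"
        unfolding ch_def coeff_sum by (intro sum.cong refl) auto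
      also have "\<dots> = (\<Sum>i\<le>p. if i = p then M p q else 0)"
        by (intro sum.cong refl) auto
      finally show ?thesis by simp
    qed
    moreover have "degree ch \<le> p + q"
      unfolding ch_def by (intro degree_sum_le finite_atMost) (auto intro: order_trans[OF degree_monom_le])
    ultimately have ch: "degree ch = p + q" "ch \<noteq> 0" using le_degree[of ch "p + q"] by auto
    obtain \<kappa> \<kappa>' c e where "kappas_in p \<kappa> (gammas CARD('n) p q)" "kappas_in q \<kappa>' (gammas CARD('n) p q)"
      "ode_lead p \<kappa> c \<noteq> 0" "ode_lead q \<kappa>' e \<noteq> 0"
      "\<And>\<rho>. \<rho> \<in> I \<Longrightarrow> ode_factor (Dbar_op U lam) q \<kappa>' e (ode_factor (D_op U lam) p \<kappa> c a) \<rho> = 0"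
      by (rule factored_ode[where U=U and lam=lam, OF N_def bs a ch act]) (assumption | rule that)+
    then show "\<exists>\<kappa> \<kappa>' c e. kappas_in p \<kappa> (gammas CARD('n) p q) \<and> kappas_in q \<kappa>' (gammas CARD('n) p q) \<and>
        ode_lead p \<kappa> c \<noteq> 0 \<and> ode_lead q \<kappa>' e \<noteq> 0 \<and>
        (\<forall>\<rho>. r < \<rho> \<and> ereal \<rho> < R \<longrightarrow>
           ode_factor (Dbar_op U lam) q \<kappa>' e (ode_factor (D_op U lam) p \<kappa> c a) \<rho> = 0)"
      unfolding I_def by blast
  next
    fix l1 l2
    assume hyp: "P = (\<lambda>z. (z $ l1) ^ p * cnj (z $ l2) ^ q) \<and>
              (p = 0 \<or> q = 0 \<or> nu_diag U lam l1 + nu_diag U lam l2 \<noteq> 0)"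
    let ?\<nu>1 = "nu_diag U lam l1" and ?\<nu>2 = "nu_diag U lam l2"
    have d1: "d_z l P = (\<lambda>z. 0)" if "l \<noteq> l1" for l using hyp d_z_monomial[OF that, of p l2 q] by simp
    have Pc': "(\<lambda>z. cnj (P z)) = (\<lambda>z. (z $ l2) ^ q * cnj (z $ l1) ^ p)" using hyp by (simp add: mult.commute)
    have d2: "d_z l (\<lambda>z. cnj (P z)) = (\<lambda>z. 0)" if "l \<noteq> l2" for l
      unfolding Pc' by (rule d_z_monomial[OF that])
    have PH': "harmonic q p (\<lambda>z. cnj (P z))" by (rule harmonic_cnj[OF PH])
    define C where "C = sphere_mean (\<lambda>z. P z * (wmon_cnj w1 z * wmon w2 z))"
    have C: "C \<noteq> 0" using lead by (simp add: C_def)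
    have C': "sphere_mean (\<lambda>z. cnj (P z) * (wmon_cnj w2 z * wmon w1 z)) = cnj C"
      unfolding C_def sphere_mean_cnj[symmetric] by (simp add: cnj_wmon cnj_wmon_cnj mult.commute)
    \<comment> \<open>a variable that does not occur in \<open>P\<close> cannot occur in the chosen monomial\<close>
    have w1: "w1 = replicate p l1" by (rule monomial_word[OF PH d1 len lead])
    have w2: "w2 = replicate q l2"
      by (rule monomial_word[OF PH' d2 len(2,1)]) (use C C' in auto)
    let ?A = "[:?\<nu>1 / 4, 1:] ^ p" and ?B = "[:- ?\<nu>2 / 4, 1:] ^ q"
    have M: "M i k = C * (coeff ?A i * coeff ?B k)" for i k
      unfolding M_def C_def using sphere_mean_monomial_symbols[where ?l1.0=l1 and ?l2.0=l2, OF PH d1 d2, where v="?v" and v'="?v'" and i=i and k=k]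
      by (simp only: w1[symmetric] w2[symmetric]) (simp add: nu_diag_real[OF assms(1)])
    have degs: "degree ?A = p" "degree ?B = q" by (simp_all only: degree_linear_power)
    have act: "poly_act (?A * ?B) bs 0 t = 0" if t: "t \<in> J" for t
    proof -
      have "poly_act (?A * ?B) bs 0 t = (\<Sum>i\<le>p. \<Sum>k\<le>q. coeff ?A i * coeff ?B k * bs (i + k) t)"
        unfolding poly_act_mult unfolding poly_act_def degs by (simp add: sum_distrib_left mult.assoc add.commute)
      then have "C * poly_act (?A * ?B) bs 0 t = (\<Sum>i\<le>p. \<Sum>k\<le>q. M i k * bs (i + k) t)"
        by (simp add: M sum_distrib_left mult.assoc)
      then show ?thesis using ode[OF t] C by simp
    qed
    have cJ: "convex J"
    proof (rule convex_J)
      fix x y z assume "x \<in> I" "z \<in> I" "x \<le> y" "y \<le> z"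
      then have "ereal y \<le> ereal z" "r < y" "ereal z < R" by (auto simp: I_def)
      then show "y \<in> I" unfolding I_def by (simp add: le_less_trans del: ereal_less_eq)
    qed
    have ne: "p = 0 \<or> q = 0 \<or> - ?\<nu>1 / 4 \<noteq> ?\<nu>2 / 4"
      using hyp by (auto simp: field_simps add_eq_0_iff)
    have "poly_act ([:- (- ?\<nu>1 / 4), 1:] ^ p * [:- (?\<nu>2 / 4), 1:] ^ q) bs 0 t = 0" if "t \<in> J" for t
      using act[OF that] by simp
    from two_root_solution[OF open_J cJ bs ne this]
    obtain A0 B0 where AB: "\<And>t. t \<in> J \<Longrightarrow> bs 0 t = (\<Sum>i<p. A0 i * complex_of_real t ^ i) * exp (- ?\<nu>1 / 4 * complex_of_real t)
        + (\<Sum>i<q. B0 i * complex_of_real t ^ i) * exp (?\<nu>2 / 4 * complex_of_real t)" by blast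
    define A B where "A = (\<lambda>i. if i = 0 then 0 else A0 (i - 1))" and "B = (\<lambda>i. if i = 0 then 0 else B0 (i - 1))"
    have exponent: "int p + int q + int CARD('n) = int N + 1"
    proof -
      have "1 \<le> CARD('n)" by (simp add: Suc_leI)
      then show ?thesis unfolding N_def by arith
    qed
    show "\<exists>A B :: nat \<Rightarrow> complex. A 0 = 0 \<and> B 0 = 0 \<and>
           (\<forall>\<rho>. r < \<rho> \<and> ereal \<rho> < R \<longrightarrow>
              a \<rho> =
                (\<Sum>i=0..p. A i * exp (- nu_diag U lam l1 / 4 * complex_of_real (\<rho>\<^sup>2)) *
                   complex_of_real (\<rho> powi (- 2 * (int p + int q + int CARD('n) - int i))))
              + (\<Sum>k=0..q. B k * exp (nu_diag U lam l2 / 4 * complex_of_real (\<rho>\<^sup>2)) *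
                   complex_of_real (\<rho> powi (- 2 * (int p + int q + int CARD('n) - int k)))))"
    proof (rule exI[of _ A], rule exI[of _ B], intro conjI allI impI)
      show "A 0 = 0" "B 0 = 0" by (simp_all add: A_def B_def)
      fix \<rho> assume "r < \<rho> \<and> ereal \<rho> < R"
      then have \<rho>: "\<rho> \<in> I" by (simp add: I_def)
      show "a \<rho> =
                (\<Sum>i=0..p. A i * exp (- nu_diag U lam l1 / 4 * complex_of_real (\<rho>\<^sup>2)) *
                   complex_of_real (\<rho> powi (- 2 * (int p + int q + int CARD('n) - int i))))
              + (\<Sum>k=0..q. B k * exp (nu_diag U lam l2 / 4 * complex_of_real (\<rho>\<^sup>2)) *
                   complex_of_real (\<rho> powi (- 2 * (int p + int q + int CARD('n) - int k))))"
        unfolding exponent a[OF \<rho>] AB[OF I_sq(1)[OF \<rho>]] distrib_left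
          exponential_polynomial_powi[OF I_sq(2)[OF \<rho>]] A_def B_def ..
    qed
  qed
qed

end
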